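(* Let $(X,\mathcal B,\mu,T)$ be a system satisfying conditions (c1)--(c6) listed in the context, and assume that $\mu$ lifts to a probability measure $\hat\mu$ on the Hofbauer tower $(\hat X,\hat{\mathcal B})$. Let $(Y,\mathcal C,\nu,F)$ be the system of rugs built over the tower, $\pi:\hat X\to X$ and $\hat\pi:Y\to\hat X$ the projections, as defined in the context. Then $(Y,\mathcal C,\nu,F)$ is the natural extension of $(X,\mathcal B,\hat\mu\circ\pi^{-1},T)$ with factor map $\phi=\pi\circ\hat\pi$. In case $\mu$ is $T$-invariant, $\hat\mu$ is the unique lift of $\mu$ and $\hat\mu\circ\pi^{-1}=\mu$.
   Context: **Setting.** $X\subset\mathbb R^n$ is compact, $\mathcal B$ is the Lebesgue $\sigma$-algebra on $X$, $\mu$ is a probability measure on $(X,\mathcal B)$ (not assumed $T$-invariant unless stated). $\mathcal Z=\{Z_1,\dots,Z_N\}$ is a collection of closed sets with $\mu(Z_j)>0$, $\mu(Z_i\cap Z_j)=0$ for $i\ne j$, $\mu(\bigcup_j Z_j)=1$, and $T:X\to X$. Conditions: (c1) for each $Z\in\mathcal Z$, $T$ can be extended uniquely to a continuous injective map $T_Z:Z\to\overline{T(\operatorname{int}Z)}$; (c2) for each $A\in\mathcal B$ also $TA,T^{-1}A\in\mathcal B$, and $\mu(A)=0$ implies $\mu(T^{-1}A)=0$; (c3) $\bigvee_{k\ge0}T^{-k}\mathcal Z=\mathcal B$, i.e. $\mathcal B$ is the smallest $\sigma$-algebra containing all cylinder sets (elements of $\mathcal Z_n:=\bigvee_{k=0}^nT^{-k}\mathcal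 Z$); (c4) for each $j$ there is a constant $s_j\ge1$ with $\mu(TA)=s_j\mu(A)$ for all measurable $A\subseteq Z_j$; (c5) $\mu$ is ergodic: $T^{-1}A=A$, $A\in\mathcal B$, implies $\mu(A)\in\{0,1\}$ (no invariance implied); (c6) $\mu\big(\bigcup_nT^n(\bigcup_{j=1}^N\partial Z_j)\big)=0$, with $\partial$ the topological boundary. **Hofbauer tower.** $\mathcal Z_n$ consists of the $(n+1)$-cylinders $Z_{j_0\cdots j_n}=Z_{j_0}\cap T^{-1}Z_{j_1}\cap\dots\cap T^{-n}Z_{j_n}$ of positive $\mu$-measure. $\mathcal D$ is the set of equivalence classes of the closures of the sets $T^nZ_{j_0\cdots j_n}$ ($n\ge0$), where two sets are equivalent if their symmetric difference has $\mu$-measure $0$; elements of $\mathcal D$ are also treated as subsets of $X$. Write $\mathcal D=\{D_u:u\in\alpha\}$ with $\alpha\subseteq\mathbb N$ an ordered index set and $D_u=Z_u$ for $1\le u\le N$. The tower is the disjoint union $\hat X=\bigsqcup_{u\in\alpha}D_u$, with points $\hat x=(x,D)$; its base is $\hat X_0=\bigsqcup_{u=1}^ND_u$; $\pi(x,D)=x$; $\hat{\mathcal B}=\mathcal D\vee\pi^{-1}(\mathcal B)$ is the Lebesgue $\sigma$-algebra on $\hat X$. If $\mu(Z_j\cap TD)>0$ then $D'=Z_j\cap TD\in\mathcal D$ and one writes $D\to D'$. The map $\hat T:\hat X\to\hat X$ is $\hat T(x,D)=(Tx,Z_j\cap TD)$ if $Tx\in Z_j$. So $\pi\circ\hat T=T\circ\pi$.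 **Lifting.** $\bar\mu(A)=\sum_{D\in\mathcal D}\mu(\pi(A\cap D))$ for $A\in\hat{\mathcal B}$, and $\hat\mu_n(A)=\frac1n\sum_{k=0}^{n-1}\bar\mu(\hat T^{-k}A\cap\hat X_0)$. $\mu$ is liftable, and lifts to $\hat\mu$, if $(\hat\mu_n)$ converges in the vague topology (weak topology on compacta) to a non-zero measure $\hat\mu$. On each $D\in\mathcal D$ the density $\frac{d\hat\mu}{d\bar\mu}$ is the constant $\rho(D)=\hat\mu(D)/\bar\mu(D)$. **The system $(Y,\mathcal C,\nu,F)$.** Only the $D_u$ with $\hat\mu(D_u)>0$ are kept, and $\alpha$ denotes the set of their indices. The rug of $D_u$ is $R_u=D_u\times[0,\rho(D_u)]$; $Y=\bigsqcup_{u\in\alpha}R_u$; $\mathcal C$ is the Borel $\sigma$-algebra on $Y$; $\nu$ is $\bar\mu\times m$ on each rug, $m$ being one-dimensional Lebesgue measure; $\hat\pi:Y\to\hat X$ is projection to the first coordinate. For $z=(\hat x,y,u)\in R_u$ with $\pi(\hat x)\in Z_j$ and $\hat T\hat x\in D_v$, $$F(\hat x,y,u)=\Big(\hat T\hat x,\ \frac y{s_j}+\sum_{1\le k\le N}\ \sum_{t<u:\ \pi^{-1}(Z_k)\supset D_t\to D_v}\frac{\rho(D_t)}{s_k},\ v\Big),$$ which is well-defined on a set of full $\nu$-measure. **Natural extension.** $(Y,\mathcal C,\nu,F)$ is a natural extension of a measure preserving system $(X,\mathcal B,\lambda,T)$ with factor map $\phi$ if there are $X^*\in\mathcal B$, $Y^*\in\mathcal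 C$ of full measure with $T(X^* )\subseteq X^*$, $F(Y^* )\subseteq Y^*$ and $\phi:Y^*\to X^*$ such that: (ne1) $F$ is invertible $\nu$-a.e.; (ne2) $\phi$ is bi-measurable and surjective; (ne3) $\lambda=\nu\circ\phi^{-1}$; (ne4) $\phi\circ F=T\circ\phi$; (ne5) $\bigvee_{n\ge0}F^n(\phi^{-1}\mathcal B)=\mathcal C$ (up to $\nu$-null sets). Natural extensions are unique up to isomorphism.
   Formalization: Assumes in addition that μ has no point masses (otherwise (ne5) fails, e.g. for a swap of two atoms), and takes C as the tower's Lebesgue σ-algebra times Borel sets of the fibres, since with strictly Borel C (ne2) fails; (c3) is only required up to null sets. *)

theory Defs
  imports "HOL-Probability.Probability"
begin

section \<open>Piecewise systems\<close>

definition ae_eq_set :: "'a measure \<Rightarrow> 'a set \<Rightarrow> 'a set \<Rightarrow> bool" where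
  "ae_eq_set M A B \<longleftrightarrow> sym_diff A B \<in> null_sets M"

text \<open>The word \<open>w = [j0, ..., jn]\<close> encodes the cylinder
  \<open>Z j0 \<inter> T^-1 (Z j1) \<inter> ... \<inter> T^-n (Z jn)\<close>.\<close>

definition cylinder :: "'a set \<Rightarrow> (nat \<Rightarrow> 'a set) \<Rightarrow> ('a \<Rightarrow> 'a) \<Rightarrow> nat list \<Rightarrow> 'a set" where
  "cylinder X Z T w = {x \<in> X. \<forall>i<length w. (T ^^ i) x \<in> Z (w ! i)}"

definition words :: "nat \<Rightarrow> nat list set" where
  "words N = {w. w \<noteq> [] \<and> set w \<subseteq> {1..N}}"

text \<open>\<open>g\<close> is a continuous injective extension to \<open>C\<close> of the restriction of \<open>T\<close> to the interior
  of \<open>C\<close>. Interior and boundary are taken in the space \<open>X\<close>.\<close>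

definition branch_extension ::
    "'a::topological_space set \<Rightarrow> ('a \<Rightarrow> 'a) \<Rightarrow> 'a set \<Rightarrow> ('a \<Rightarrow> 'a) \<Rightarrow> bool" where
  "branch_extension X T C g \<longleftrightarrow>
     continuous_on C g \<and> inj_on g C \<and>
     (\<forall>x \<in> top_of_set X interior_of C. g x = T x) \<and>
     g ` C \<subseteq> closure (T ` (top_of_set X interior_of C))"

text \<open>The generating condition \<open>c3\<close> is stated up to null sets: the Lebesgue sigma-algebra of an
  uncountable \<open>X\<close> is not countably generated in the strict sense.\<close>

locale piecewise_system =
  fixes X :: "'a::euclidean_space set"
    and \<mu> :: "'a measure"
    and N :: nat
    and Z :: "nat \<Rightarrow> 'a set"
    and T :: "'a \<Rightarrow> 'a"
    and s :: "nat \<Rightarrow> real"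
  assumes compact_X: "compact X"
    and sets_mu: "sets \<mu> = sets (restrict_space lebesgue X)"
    and prob_mu: "prob_space \<mu>"
    and T_into: "T \<in> X \<rightarrow> X"
    and Z_closed: "\<And>j. j \<in> {1..N} \<Longrightarrow> closed (Z j) \<and> Z j \<subseteq> X"
    and Z_pos: "\<And>j. j \<in> {1..N} \<Longrightarrow> emeasure \<mu> (Z j) > 0"
    and Z_overlap: "\<And>i j. i \<in> {1..N} \<Longrightarrow> j \<in> {1..N} \<Longrightarrow> i \<noteq> j \<Longrightarrow> emeasure \<mu> (Z i \<inter> Z j) = 0"
    and Z_cover: "emeasure \<mu> (\<Union>j\<in>{1..N}. Z j) = 1"
    and c1: "\<And>j. j \<in> {1..N} \<Longrightarrow>
        \<exists>g. branch_extension X T (Z j) g \<and>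
            (\<forall>g'. branch_extension X T (Z j) g' \<longrightarrow> (\<forall>x \<in> Z j. g' x = g x))"
    and c2_image: "\<And>A. A \<in> sets \<mu> \<Longrightarrow> T ` A \<in> sets \<mu>"
    and c2_vimage: "\<And>A. A \<in> sets \<mu> \<Longrightarrow> T -` A \<inter> X \<in> sets \<mu>"
    and c2_null: "\<And>A. A \<in> sets \<mu> \<Longrightarrow> emeasure \<mu> A = 0 \<Longrightarrow> emeasure \<mu> (T -` A \<inter> X) = 0"
    and c3: "\<And>A. A \<in> sets \<mu> \<Longrightarrow>
        \<exists>B \<in> sigma_sets X (cylinder X Z T ` words N). ae_eq_set \<mu> A B"
    and c4_ge: "\<And>j. j \<in> {1..N} \<Longrightarrow> s j \<ge> 1"
    and c4: "\<And>j A. j \<in> {1..N} \<Longrightarrow> A \<in> sets \<mu> \<Longrightarrow> A \<subseteq> Z j \<Longrightarrow>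
        emeasure \<mu> (T ` A) = ennreal (s j) * emeasure \<mu> A"
    and c5: "\<And>A. A \<in> sets \<mu> \<Longrightarrow> T -` A \<inter> X = A \<Longrightarrow> emeasure \<mu> A = 0 \<or> emeasure \<mu> A = 1"
    and c6: "(\<Union>n. (T ^^ n) ` (\<Union>j\<in>{1..N}. top_of_set X frontier_of Z j)) \<in> null_sets \<mu>"


section \<open>The Hofbauer tower\<close>

definition tower_sets ::
    "'a::topological_space measure \<Rightarrow> nat \<Rightarrow> (nat \<Rightarrow> 'a set) \<Rightarrow> ('a \<Rightarrow> 'a) \<Rightarrow> 'a set set" where
  "tower_sets \<mu> N Z T =
     {closure ((T ^^ (length w - 1)) ` cylinder (space \<mu>) Z T w) | w.
        w \<in> words N \<and> emeasure \<mu> (cylinder (space \<mu>) Z T w) > 0}"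

text \<open>\<open>(D u)\<close>, \<open>u \<in> \<alpha>\<close>, lists exactly one representative of every class of \<open>tower_sets\<close> modulo
  null sets. Indices start at \<open>1\<close>; the number \<open>0\<close> is kept free as a cemetery index.\<close>

definition tower_enumeration ::
    "'a::topological_space measure \<Rightarrow> nat \<Rightarrow> (nat \<Rightarrow> 'a set) \<Rightarrow> ('a \<Rightarrow> 'a) \<Rightarrow>
     nat set \<Rightarrow> (nat \<Rightarrow> 'a set) \<Rightarrow> bool" where
  "tower_enumeration \<mu> N Z T \<alpha> D \<longleftrightarrow>
     0 \<notin> \<alpha> \<and> {1..N} \<subseteq> \<alpha> \<and> (\<forall>u \<in> {1..N}. D u = Z u) \<and>
     D ` \<alpha> \<subseteq> tower_sets \<mu> N Z T \<and>
     (\<forall>C \<in> tower_sets \<mu> N Z T. \<exists>u \<in> \<alpha>. ae_eq_set \<mu> C (D u)) \<and>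
     (\<forall>u \<in> \<alpha>. \<forall>v \<in> \<alpha>. ae_eq_set \<mu> (D u) (D v) \<longrightarrow> u = v)"

text \<open>Points of the tower are pairs \<open>(x, u)\<close> with \<open>x \<in> D u\<close>. As \<open>nat\<close> is discrete, the subspace
  topology inherited from the product type is the disjoint union topology.\<close>

definition tower :: "nat set \<Rightarrow> (nat \<Rightarrow> 'a set) \<Rightarrow> ('a \<times> nat) set" where
  "tower \<alpha> D = {(x, u). u \<in> \<alpha> \<and> x \<in> D u}"

definition level :: "(nat \<Rightarrow> 'a set) \<Rightarrow> nat \<Rightarrow> ('a \<times> nat) set" where
  "level D u = D u \<times> {u}"

definition tower_edge ::
    "'a measure \<Rightarrow> (nat \<Rightarrow> 'a set) \<Rightarrow> ('a \<Rightarrow> 'a) \<Rightarrow> (nat \<Rightarrow> 'a set) \<Rightarrow> nat \<Rightarrow> nat \<Rightarrow> nat \<Rightarrow> bool" where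
  "tower_edge \<mu> Z T D u j v \<longleftrightarrow>
     emeasure \<mu> (Z j \<inter> T ` D u) > 0 \<and> ae_eq_set \<mu> (D v) (Z j \<inter> T ` D u)"

definition arrow ::
    "'a measure \<Rightarrow> nat \<Rightarrow> (nat \<Rightarrow> 'a set) \<Rightarrow> ('a \<Rightarrow> 'a) \<Rightarrow> (nat \<Rightarrow> 'a set) \<Rightarrow> nat \<Rightarrow> nat \<Rightarrow> bool" where
  "arrow \<mu> N Z T D u v \<longleftrightarrow> (\<exists>j \<in> {1..N}. tower_edge \<mu> Z T D u j v)"

text \<open>The index \<open>j\<close> with \<open>x \<in> Z j\<close>; it is unique outside a null set, on which the choice does not
  matter.\<close>

definition branch_index :: "nat \<Rightarrow> (nat \<Rightarrow> 'a set) \<Rightarrow> 'a \<Rightarrow> nat" where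
  "branch_index N Z x =
     (if \<exists>j \<in> {1..N}. x \<in> Z j then LEAST j. j \<in> {1..N} \<and> x \<in> Z j else 0)"

definition tower_next ::
    "'a measure \<Rightarrow> nat \<Rightarrow> (nat \<Rightarrow> 'a set) \<Rightarrow> ('a \<Rightarrow> 'a) \<Rightarrow> nat set \<Rightarrow> (nat \<Rightarrow> 'a set) \<Rightarrow>
     nat \<Rightarrow> nat \<Rightarrow> nat" where
  "tower_next \<mu> N Z T \<alpha> D u j =
     (if u \<in> \<alpha> \<and> j \<in> {1..N} \<and> (\<exists>v \<in> \<alpha>. tower_edge \<mu> Z T D u j v)
      then THE v. v \<in> \<alpha> \<and> tower_edge \<mu> Z T D u j v else 0)"

definition tower_map ::
    "'a measure \<Rightarrow> nat \<Rightarrow> (nat \<Rightarrow> 'a set) \<Rightarrow> ('a \<Rightarrow> 'a) \<Rightarrow> nat set \<Rightarrow> (nat \<Rightarrow> 'a set) \<Rightarrow>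
     'a \<times> nat \<Rightarrow> 'a \<times> nat" where
  "tower_map \<mu> N Z T \<alpha> D = (\<lambda>(x, u). (T x, tower_next \<mu> N Z T \<alpha> D u (branch_index N Z (T x))))"

text \<open>The measure written as \<open>\<mu>\<close> with a bar, on the sigma-algebra generated by the levels and the
  preimages of measurable sets under the projection \<open>fst\<close>.\<close>

definition tower_measure ::
    "'a measure \<Rightarrow> nat set \<Rightarrow> (nat \<Rightarrow> 'a set) \<Rightarrow> ('a \<times> nat) measure" where
  "tower_measure \<mu> \<alpha> D =
     measure_of (tower \<alpha> D)
       (level D ` \<alpha> \<union> (\<lambda>B. fst -` B \<inter> tower \<alpha> D) ` sets \<mu>)
       (\<lambda>A. \<integral>\<^sup>+u. emeasure \<mu> (fst ` (A \<inter> level D u)) \<partial>count_space \<alpha>)"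


section \<open>Lifting\<close>

definition lift_average ::
    "'a measure \<Rightarrow> nat \<Rightarrow> (nat \<Rightarrow> 'a set) \<Rightarrow> ('a \<Rightarrow> 'a) \<Rightarrow> nat set \<Rightarrow> (nat \<Rightarrow> 'a set) \<Rightarrow>
     nat \<Rightarrow> ('a \<times> nat) measure" where
  "lift_average \<mu> N Z T \<alpha> D n =
     measure_of (tower \<alpha> D) (sets (tower_measure \<mu> \<alpha> D))
       (\<lambda>A. (\<Sum>k<n. emeasure (tower_measure \<mu> \<alpha> D)
                 ((tower_map \<mu> N Z T \<alpha> D ^^ k) -` A \<inter> tower {1..N} D)) / of_nat n)"

text \<open>The vague topology lives on Radon measures.\<close>

definition radon_measure :: "'b::topological_space measure \<Rightarrow> bool" where
  "radon_measure M \<longleftrightarrow>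
     (\<forall>K. compact K \<and> K \<subseteq> space M \<longrightarrow> K \<in> sets M \<and> emeasure M K < \<infinity>) \<and>
     (\<forall>A \<in> sets M. emeasure M A = (SUP K \<in> {K. compact K \<and> K \<subseteq> A}. emeasure M K))"

definition vague_limit ::
    "'b::topological_space set \<Rightarrow> (nat \<Rightarrow> 'b measure) \<Rightarrow> 'b measure \<Rightarrow> bool" where
  "vague_limit S Ms M \<longleftrightarrow>
     (\<forall>f :: 'b \<Rightarrow> real.
        continuous_on S f \<and> (\<exists>K. compact K \<and> K \<subseteq> S \<and> (\<forall>x \<in> S - K. f x = 0)) \<longrightarrow>
        (\<lambda>n. \<integral>x. f x \<partial>Ms n) \<longlonglongrightarrow> (\<integral>x. f x \<partial>M))"

definition lifts_to ::
    "'a::topological_space measure \<Rightarrow> nat \<Rightarrow> (nat \<Rightarrow> 'a set) \<Rightarrow> ('a \<Rightarrow> 'a) \<Rightarrow>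
     nat set \<Rightarrow> (nat \<Rightarrow> 'a set) \<Rightarrow> ('a \<times> nat) measure \<Rightarrow> bool" where
  "lifts_to \<mu> N Z T \<alpha> D M \<longleftrightarrow>
     sets M = sets (tower_measure \<mu> \<alpha> D) \<and> radon_measure M \<and> emeasure M (space M) \<noteq> 0 \<and>
     vague_limit (tower \<alpha> D) (lift_average \<mu> N Z T \<alpha> D) M"

definition invariant_measure :: "'b measure \<Rightarrow> ('b \<Rightarrow> 'b) \<Rightarrow> bool" where
  "invariant_measure M f \<longleftrightarrow>
     (\<forall>A \<in> sets M. f -` A \<inter> space M \<in> sets M \<and> emeasure M (f -` A \<inter> space M) = emeasure M A)"

definition invariant_lift ::
    "'a measure \<Rightarrow> nat \<Rightarrow> (nat \<Rightarrow> 'a set) \<Rightarrow> ('a \<Rightarrow> 'a) \<Rightarrow>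
     nat set \<Rightarrow> (nat \<Rightarrow> 'a set) \<Rightarrow> ('a \<times> nat) measure \<Rightarrow> bool" where
  "invariant_lift \<mu> N Z T \<alpha> D M \<longleftrightarrow>
     sets M = sets (tower_measure \<mu> \<alpha> D) \<and>
     invariant_measure M (tower_map \<mu> N Z T \<alpha> D) \<and> distr M \<mu> fst = \<mu>"


section \<open>The system of rugs\<close>

definition positive_levels ::
    "nat set \<Rightarrow> (nat \<Rightarrow> 'a set) \<Rightarrow> ('a \<times> nat) measure \<Rightarrow> nat set" where
  "positive_levels \<alpha> D M = {u \<in> \<alpha>. emeasure M (level D u) > 0}"

definition level_density ::
    "'a measure \<Rightarrow> nat set \<Rightarrow> (nat \<Rightarrow> 'a set) \<Rightarrow> ('a \<times> nat) measure \<Rightarrow> nat \<Rightarrow> real" where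
  "level_density \<mu> \<alpha> D M u = measure M (level D u) / measure (tower_measure \<mu> \<alpha> D) (level D u)"

text \<open>The level \<open>u\<close> is already recorded in the tower point \<open>(x, u)\<close>, so a point of a rug is a
  pair \<open>((x, u), y)\<close>.\<close>

definition rugs ::
    "'a measure \<Rightarrow> nat set \<Rightarrow> (nat \<Rightarrow> 'a set) \<Rightarrow> ('a \<times> nat) measure \<Rightarrow> (('a \<times> nat) \<times> real) set" where
  "rugs \<mu> \<alpha> D M =
     (\<Union>u \<in> positive_levels \<alpha> D M. level D u \<times> {0..level_density \<mu> \<alpha> D M u})"

text \<open>The sigma-algebra is the product of that of the tower with the Borel sets of the fibres. It
  contains every Borel subset of the rugs, and also the preimages of the Lebesgue sets of the base,
  which is needed for the factor map to be measurable.\<close>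

definition rug_measure ::
    "'a measure \<Rightarrow> nat set \<Rightarrow> (nat \<Rightarrow> 'a set) \<Rightarrow> ('a \<times> nat) measure \<Rightarrow>
     (('a \<times> nat) \<times> real) measure" where
  "rug_measure \<mu> \<alpha> D M =
     restrict_space (tower_measure \<mu> \<alpha> D \<Otimes>\<^sub>M lborel) (rugs \<mu> \<alpha> D M)"

definition rug_map ::
    "'a measure \<Rightarrow> nat \<Rightarrow> (nat \<Rightarrow> 'a set) \<Rightarrow> ('a \<Rightarrow> 'a) \<Rightarrow> (nat \<Rightarrow> real) \<Rightarrow>
     nat set \<Rightarrow> (nat \<Rightarrow> 'a set) \<Rightarrow> ('a \<times> nat) measure \<Rightarrow>
     ('a \<times> nat) \<times> real \<Rightarrow> ('a \<times> nat) \<times> real" where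
  "rug_map \<mu> N Z T s \<alpha> D M = (\<lambda>((x, u), y).
     let v = snd (tower_map \<mu> N Z T \<alpha> D (x, u)) in
     (tower_map \<mu> N Z T \<alpha> D (x, u),
      y / s (branch_index N Z x) +
      (\<Sum>k\<in>{1..N}. \<Sum>t\<in>{t \<in> positive_levels \<alpha> D M. t < u \<and> D t \<subseteq> Z k \<and> arrow \<mu> N Z T D t v}.
         level_density \<mu> \<alpha> D M t / s k)))"


section \<open>Natural extensions\<close>

definition full_set :: "'b measure \<Rightarrow> 'b set \<Rightarrow> bool" where
  "full_set M A \<longleftrightarrow> A \<in> sets M \<and> space M - A \<in> null_sets M"

definition ae_invertible :: "'b measure \<Rightarrow> ('b \<Rightarrow> 'b) \<Rightarrow> bool" where
  "ae_invertible M f \<longleftrightarrow>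
     (\<exists>A. full_set M A \<and> bij_betw f A A \<and>
        (\<forall>C \<in> sets M. f -` C \<inter> A \<in> sets M \<and> f ` (C \<inter> A) \<in> sets M))"

text \<open>The first conjunct says that the base system is measure preserving. The map \<open>F\<close> need only be
  meaningful almost everywhere, so its measurability and the invariance of \<open>\<nu>\<close> are stated on the
  full set \<open>Y'\<close>.\<close>

definition natural_extension ::
    "'b measure \<Rightarrow> ('b \<Rightarrow> 'b) \<Rightarrow> 'a measure \<Rightarrow> ('a \<Rightarrow> 'a) \<Rightarrow> ('b \<Rightarrow> 'a) \<Rightarrow> bool" where
  "natural_extension \<nu> F \<eta> T \<phi> \<longleftrightarrow>
     T \<in> space \<eta> \<rightarrow> space \<eta> \<and> invariant_measure \<eta> T \<and>
     (\<exists>X' Y'. full_set \<eta> X' \<and> full_set \<nu> Y' \<and> T ` X' \<subseteq> X' \<and> F ` Y' \<subseteq> Y' \<and>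
        (\<forall>C \<in> sets \<nu>. F -` C \<inter> Y' \<in> sets \<nu> \<and> emeasure \<nu> (F -` C \<inter> Y') = emeasure \<nu> C) \<and>
        ae_invertible \<nu> F \<and>
        \<phi> ` Y' = X' \<and>
        (\<forall>A \<in> sets \<eta>. \<phi> -` A \<inter> Y' \<in> sets \<nu>) \<and>
        (\<forall>C \<in> sets \<nu>. \<phi> ` (C \<inter> Y') \<in> sets \<eta>) \<and>
        (\<forall>A \<in> sets \<eta>. emeasure \<eta> A = emeasure \<nu> (\<phi> -` A \<inter> Y')) \<and>
        (\<forall>z \<in> Y'. \<phi> (F z) = T (\<phi> z)) \<and>
        (let \<G> = sigma_sets Y' {(F ^^ n) ` (\<phi> -` A \<inter> Y') | n A. A \<in> sets \<eta>} in
           \<G> \<subseteq> sets \<nu> \<and> (\<forall>C \<in> sets \<nu>. \<exists>E \<in> \<G>. ae_eq_set \<nu> C E)))"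

end

theory Submission
  imports Defs
begin

text \<open>
  The tower map multiplies measure by a constant on each level and sends the part of a level that
  lies over a branch onto a whole level. Hence the \<open>k\<close>-th image of the base measure has a constant
  density on every level, and so has every Cesaro average. Each level is compact and open in the
  tower, so testing vague convergence with functions that live on one level shows that a lift is
  again constant on levels, with densities the limits of those of the averages
  (\<open>lift_is_weighted\<close>). This already gives uniqueness of the lift. If the lift is a probability
  measure, then no mass can have left the tower at any time, and a Fatou argument turns the
  limit relation between the densities into an equation, \<open>push_height\<close>: the density of a level \<open>v\<close> is
  the sum over the arrows \<open>u \<rightarrow> v\<close> of the density of \<open>u\<close> divided by the slope of \<open>u\<close>.

  That equation is the geometric content of the rugs. The rug map carries the rug over \<open>u\<close>, cut along the
  branches, to horizontal strips over the levels \<open>v\<close>, of height density over slope; the equation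
  says that these strips tile the rug over \<open>v\<close>. So the rug map preserves the measure
  (\<open>F_measure_preserving\<close>), and it is injective because the strips are disjoint and the branches are
  injective. Intersecting the forward images of a good set gives a set of full measure on which it is
  bijective.

  It remains to see that the past of the projection to \<open>X\<close> determines a point \<open>(x, u, y)\<close> of the
  rugs.

  \<^item> The level \<open>u\<close>: start at the base \<open>n\<close> steps ago and push the cylinder of the past point
    forward. The image contains \<open>D u\<close>, and by linearity of the branches the proportion of \<open>D u\<close> in it is the
    proportion of the old level in its cylinder. Cylinders generate, so by an elementary density
    argument (\<open>bad_density_tendsto\<close>) this proportion is close to \<open>1\<close> with large probability when \<open>n\<close>
    is large. As finitely many levels carry most of the mass, and different levels differ by a positive measure, \<open>u\<close> can
    be read off (\<open>level_from_past\<close>). The same lemma shows that two invariant lifts agree, since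
    each is determined by its projection.
  \<^item> The height \<open>y\<close>: knowing the levels visited in the last \<open>n\<close> steps confines \<open>y\<close> to a strip. The
    widths decrease to a limit. On the set where the limit is positive, the mass of the limit strip cannot increase
    under the rug map, hence is invariant, which is only possible if the levels there
    have a single successor for ever. Almost all points of such a level share one
    itinerary, so the level is an atom for the generating cylinders, contrary to the absence of
    point masses (\<open>wide_null\<close>). So the strips shrink to \<open>y\<close>.

  The projection of a measurable subset of the rugs to \<open>X\<close> is in general not Borel. It is measurable by
  the classical theorem on analytic sets, proved in the first section.
\<close>

section \<open>Measurable projections\<close>

text \<open>A set is taken to be analytic if it is the projection of a closed set along the Baire space. In
  this form countable unions and intersections become operations on closed sets of codes.\<close>
definition analytic_set :: "'b::topological_space set \<Rightarrow> bool" where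
  "analytic_set S \<longleftrightarrow> (\<exists>H. closed H \<and> S = {z. \<exists>\<sigma>::nat \<Rightarrow> nat. (z, \<sigma>) \<in> H})"

lemma analytic_closed: "closed S \<Longrightarrow> analytic_set S"
  unfolding analytic_set_def by (rule exI[of _ "S \<times> UNIV"]) (auto intro: closed_Times)

text \<open>The first entry of the code selects the set, the remaining entries are a code for membership in it.\<close>
lemma analytic_UN:
  assumes "\<And>k::nat. analytic_set (S k)"
  shows "analytic_set (\<Union>k. S k)"
proof -
  obtain H where H: "\<And>k. closed (H k)" "\<And>k. S k = {z. \<exists>\<sigma>::nat \<Rightarrow> nat. (z, \<sigma>) \<in> H k}"
    using assms unfolding analytic_set_def by metis
  define J where "J = {p. (fst p, \<lambda>i. snd p (Suc i)) \<in> H (snd p 0)}"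
  have "J = (\<Inter>k. {p. snd p 0 = k \<longrightarrow> (fst p, \<lambda>i. snd p (Suc i)) \<in> H k})"
    by (auto simp: J_def)
  moreover have "closed {p :: 'a \<times> (nat \<Rightarrow> nat). snd p 0 = k \<longrightarrow> (fst p, \<lambda>i. snd p (Suc i)) \<in> H k}" for k
  proof -
    have c: "continuous_on UNIV (\<lambda>p::'a \<times> (nat \<Rightarrow> nat). snd p 0)"
      by (rule continuous_on_product_then_coordinatewise) (intro continuous_intros)
    have "open ((\<lambda>p::'a \<times> (nat \<Rightarrow> nat). snd p 0) -` {k})"
      by (intro open_vimage c) (simp add: Topological_Spaces.open_discrete)
    then have o: "closed {p :: 'a \<times> (nat \<Rightarrow> nat). snd p 0 \<noteq> k}"
      by (simp add: closed_def vimage_def Compl_eq)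
    have "continuous_on UNIV (\<lambda>p::'a \<times> (nat \<Rightarrow> nat). (fst p, \<lambda>i. snd p (Suc i)))"
      by (intro continuous_intros continuous_on_coordinatewise_then_product
            continuous_on_product_then_coordinatewise)
    then have "closed ((\<lambda>p::'a \<times> (nat \<Rightarrow> nat). (fst p, \<lambda>i. snd p (Suc i))) -` H k)"
      using H(1) by (intro closed_vimage) auto
    from closed_Un[OF o this] show ?thesis
      by (rule back_subst[where P=closed]) auto
  qed
  ultimately have "closed J" by auto
  moreover have "(\<Union>k. S k) = {z. \<exists>\<sigma>. (z, \<sigma>) \<in> J}"
  proof (intro set_eqI iffI)
    fix z assume "z \<in> (\<Union>k. S k)"
    then obtain k \<sigma> where "(z, \<sigma>) \<in> H k" using H(2) by auto
    then have "(z, case_nat k \<sigma>) \<in> J" by (simp add: J_def)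
    then show "z \<in> {z. \<exists>\<sigma>. (z, \<sigma>) \<in> J}" by blast
  next
    fix z assume "z \<in> {z. \<exists>\<sigma>. (z, \<sigma>) \<in> J}"
    then show "z \<in> (\<Union>k. S k)" using H(2) by (auto simp: J_def)
  qed
  ultimately show ?thesis unfolding analytic_set_def by blast
qed

text \<open>One code carries codes for all the sets, interleaved by the pairing function.\<close>
lemma analytic_INT:
  assumes "\<And>k::nat. analytic_set (S k)"
  shows "analytic_set (\<Inter>k. S k)"
proof -
  obtain H where H: "\<And>k. closed (H k)" "\<And>k. S k = {z. \<exists>\<sigma>::nat \<Rightarrow> nat. (z, \<sigma>) \<in> H k}"
    using assms unfolding analytic_set_def by metis
  define J where "J = (\<Inter>k. (\<lambda>p. (fst p, \<lambda>i. snd p (prod_encode (k, i)))) -` H k)"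
  have "continuous_on UNIV (\<lambda>p::'a \<times> (nat \<Rightarrow> nat). (fst p, \<lambda>i. snd p (prod_encode (k, i))))" for k
    by (intro continuous_intros continuous_on_coordinatewise_then_product
          continuous_on_product_then_coordinatewise)
  then have "closed J"
    unfolding J_def using H(1) by (intro closed_INT ballI closed_vimage) auto
  moreover have "(\<Inter>k. S k) = {z. \<exists>\<sigma>. (z, \<sigma>) \<in> J}"
  proof (intro set_eqI iffI)
    fix z assume "z \<in> (\<Inter>k. S k)"
    then have "\<forall>k. \<exists>\<sigma>. (z, \<sigma>) \<in> H k" using H(2) by auto
    then obtain f where "\<And>k. (z, f k) \<in> H k" by metis
    then have "(z, \<lambda>m. case prod_decode m of (k, i) \<Rightarrow> f k i) \<in> J" by (simp add: J_def)
    then show "z \<in> {z. \<exists>\<sigma>. (z, \<sigma>) \<in> J}" by blast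
  next
    fix z assume "z \<in> {z. \<exists>\<sigma>. (z, \<sigma>) \<in> J}"
    then show "z \<in> (\<Inter>k. S k)" using H(2) by (auto simp: J_def)
  qed
  ultimately show ?thesis unfolding analytic_set_def by blast
qed

lemma analytic_open:
  fixes S :: "'b::euclidean_space set"
  assumes "open S" shows "analytic_set S"
proof -
  obtain \<D> where \<D>: "countable \<D>" "\<And>A. A \<in> \<D> \<Longrightarrow> \<exists>a b. A = cbox a b" "\<Union>\<D> = S"
    using open_countable_Union_open_cbox[OF assms] by metis
  define C where "C = from_nat_into (insert {} \<D>)"
  have r: "range C = insert {} \<D>" unfolding C_def using \<D>(1) by (intro range_from_nat_into) auto
  have "closed (C k)" for k
  proof -
    have "C k \<in> insert {} \<D>" using r by blast
    then show ?thesis using \<D>(2) by fastforce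
  qed
  then have "analytic_set (\<Union>k. C k)" by (intro analytic_UN analytic_closed)
  then show ?thesis using \<D>(3) unfolding r by simp
qed

text \<open>Complements of analytic sets need not be analytic, so the induction proves the claim for a set and its complement at once.\<close>
lemma analytic_borel:
  fixes S :: "'b::euclidean_space set"
  assumes "S \<in> sets borel" shows "analytic_set S"
proof -
  have "S \<in> sigma_sets UNIV {S. open S}" using assms by (simp add: borel_def)
  then have "analytic_set S \<and> analytic_set (- S)"
  proof induction
    case (Basic a) then show ?case by (auto intro: analytic_open analytic_closed)
  next
    case Empty then show ?case by (auto intro: analytic_closed)
  next
    case (Compl a) then show ?case by (simp add: Compl_eq_Diff_UNIV[symmetric])
  next
    case (Union a)
    then have "analytic_set (\<Union>i. a i)" "analytic_set (\<Inter>i. - a i)"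
      by (auto intro: analytic_UN analytic_INT)
    then show ?case by (simp add: Compl_UN)
  qed
  then show ?thesis ..
qed

lemma compact_nat_box: "compact {\<sigma>::nat \<Rightarrow> nat. \<forall>i. \<sigma> i \<le> n i}"
proof -
  have "compactin (product_topology (\<lambda>i. euclidean) UNIV) (PiE UNIV (\<lambda>i. {..n i}))"
    unfolding compactin_PiE by (auto simp: finite_imp_compact)
  moreover have "PiE UNIV (\<lambda>i. {..n i}) = {\<sigma>. \<forall>i. \<sigma> i \<le> n i}" by auto
  ultimately show ?thesis by (simp add: euclidean_product_topology)
qed

text \<open>The real line is a countable union of compact intervals, and the projection of a closed set along
  a compact interval is closed.\<close>
lemma analytic_fst_image:
  fixes S :: "('b::euclidean_space \<times> real) set"
  assumes "analytic_set S" shows "analytic_set (fst ` S)"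
proof -
  obtain H where H: "closed H" "S = {z. \<exists>\<sigma>::nat \<Rightarrow> nat. (z, \<sigma>) \<in> H}"
    using assms unfolding analytic_set_def by metis
  define J where "J m = {(x, \<sigma>). \<exists>y\<in>{- real m..real m}. ((x, y), \<sigma>) \<in> H}" for m
  have "closed (J m)" for m
  proof (subst closed_sequential_limits, intro allI impI)
    fix f :: "nat \<Rightarrow> 'b \<times> (nat \<Rightarrow> nat)" and l assume f: "(\<forall>n. f n \<in> J m) \<and> f \<longlonglongrightarrow> l"
    then have "\<forall>n. \<exists>y\<in>{- real m..real m}. ((fst (f n), y), snd (f n)) \<in> H" by (auto simp: J_def split_def)
    then obtain g where g: "\<And>n. g n \<in> {- real m..real m}" "\<And>n. ((fst (f n), g n), snd (f n)) \<in> H" by metis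
    obtain y r where y: "y \<in> {- real m..real m}" "strict_mono (r :: nat \<Rightarrow> nat)" "(g \<circ> r) \<longlonglongrightarrow> y"
      using compact_Icc[of "- real m" "real m"] g(1) unfolding compact_eq_seq_compact_metric seq_compact_def by metis
    have fr: "(f \<circ> r) \<longlonglongrightarrow> l" using f y(2) by (auto intro: LIMSEQ_subseq_LIMSEQ)
    have "(\<lambda>n. ((fst ((f \<circ> r) n), (g \<circ> r) n), snd ((f \<circ> r) n))) \<longlonglongrightarrow> ((fst l, y), snd l)"
      by (intro tendsto_intros fr y(3))
    then have "((fst l, y), snd l) \<in> H"
      by (rule closed_sequentially[OF H(1), rotated]) (simp add: g(2))
    then show "l \<in> J m" using y(1) by (auto simp: J_def split_def)
  qed
  then have "analytic_set {x. \<exists>\<sigma>. (x, \<sigma>) \<in> J m}" for m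
    unfolding analytic_set_def by (intro exI[of _ "J m"]) simp
  then have "analytic_set (\<Union>m. {x. \<exists>\<sigma>. (x, \<sigma>) \<in> J m})" by (rule analytic_UN)
  moreover have "(\<Union>m. {x. \<exists>\<sigma>. (x, \<sigma>) \<in> J m}) = fst ` S"
  proof -
    have "x \<in> (\<Union>m. {x. \<exists>\<sigma>. (x, \<sigma>) \<in> J m})" if "((x, y), \<sigma>) \<in> H" for x y \<sigma>
    proof -
      obtain m where "\<bar>y\<bar> \<le> real m" using real_arch_simple by blast
      then have "(x, \<sigma>) \<in> J m" using that by (auto simp: J_def intro!: bexI[of _ y])
      then show ?thesis by auto
    qed
    then show ?thesis by (force simp: H(2) J_def)
  qed
  ultimately show ?thesis by simp
qed

text \<open>Choquet's capacity argument. Bound the entries of the code one after the other. Outer measure is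
  continuous along increasing unions, so each bound can be chosen large enough to keep the outer
  measure above the given value. By compactness of the set of bounded codes, the closures of the
  restricted projections intersect in a subset of the projection.\<close>
lemma analytic_inner_approx:
  fixes P :: "'b::euclidean_space set"
  assumes H: "closed H" and P: "P = {z. \<exists>\<sigma>::nat \<Rightarrow> nat. (z, \<sigma>) \<in> H}" and bd: "bounded P"
    and a: "a < outer_measure_of lebesgue P"
  shows "\<exists>L. L \<in> sets lebesgue \<and> L \<subseteq> P \<and> a \<le> emeasure lebesgue L"
proof -
  define Q where "Q b = {z. \<exists>\<sigma>. (z, \<sigma>) \<in> H \<and> (\<forall>i<length b. \<sigma> i \<le> b ! i)}" for b :: "nat list"
  have Q0: "Q [] = P" by (simp add: Q_def P)
  have QUN: "Q b = (\<Union>m. Q (b @ [m]))" for b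
    by (fastforce simp: Q_def nth_append less_Suc_eq)
  have ext: "\<exists>m. a < outer_measure_of lebesgue (Q (b @ [m]))" if "a < outer_measure_of lebesgue (Q b)" for b
  proof -
    have "incseq (\<lambda>m. Q (b @ [m]))"
      by (intro incseq_SucI) (fastforce simp: Q_def nth_append less_Suc_eq)
    moreover have "Q c \<subseteq> space lebesgue" for c by simp
    ultimately have "(SUP m. outer_measure_of lebesgue (Q (b @ [m]))) = outer_measure_of lebesgue (Q b)"
      by (subst QUN) (rule SUP_outer_measure_of_incseq, auto)
    with that have "a < (SUP m. outer_measure_of lebesgue (Q (b @ [m])))" by simp
    then show ?thesis unfolding less_SUP_iff by simp
  qed
  define bs where "bs = rec_nat [] (\<lambda>_ b. b @ [SOME m. a < outer_measure_of lebesgue (Q (b @ [m]))])"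
  define n where "n k = (SOME m. a < outer_measure_of lebesgue (Q (bs k @ [m])))" for k
  have bs0: "bs 0 = []" and bsS: "bs (Suc k) = bs k @ [n k]" for k by (simp_all add: bs_def n_def)
  have big: "a < outer_measure_of lebesgue (Q (bs k))" for k
  proof (induction k)
    case 0 then show ?case using a by (simp add: bs0 Q0)
  next
    case (Suc k) show ?case unfolding bsS n_def by (rule someI_ex[OF ext[OF Suc]])
  qed
  have bs: "bs k = map n [0..<k]" for k by (induction k) (simp_all add: bs0 bsS)
  define L where "L = (\<Inter>k. closure (Q (bs k)))"
  have dec: "Q (bs (Suc k)) \<subseteq> Q (bs k)" for k unfolding bsS by (subst QUN) auto
  have QP: "Q b \<subseteq> P" for b by (auto simp: Q_def P)
  have "emeasure lebesgue L = (INF k. emeasure lebesgue (closure (Q (bs k))))"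
    unfolding L_def
  proof (rule INF_emeasure_decseq[symmetric])
    show "range (\<lambda>k. closure (Q (bs k))) \<subseteq> sets lebesgue" by auto
    show "decseq (\<lambda>k. closure (Q (bs k)))" by (intro decseq_SucI closure_mono dec)
    fix k
    have "bounded (closure (Q (bs k)))" by (intro bounded_closure bounded_subset[OF bd QP])
    from emeasure_bounded_finite[OF this] show "emeasure lebesgue (closure (Q (bs k))) \<noteq> \<infinity>" by simp
  qed
  moreover have "a \<le> emeasure lebesgue (closure (Q (bs k)))" for k
  proof -
    have "outer_measure_of lebesgue (Q (bs k)) \<le> outer_measure_of lebesgue (closure (Q (bs k)))"
      by (intro outer_measure_of_mono closure_subset)
    also have "\<dots> = emeasure lebesgue (closure (Q (bs k)))" by (intro outer_measure_of_eq) auto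
    finally show ?thesis using big[of k] by auto
  qed
  ultimately have "a \<le> emeasure lebesgue L" by (auto intro: INF_greatest)
  moreover have "L \<subseteq> P"
  proof
    fix x assume "x \<in> L"
    then have "\<exists>x'\<in>Q (bs k). dist x' x < inverse (real (Suc k))" for k
      unfolding L_def closure_approachable INT_iff
      by (metis UNIV_I inverse_positive_iff_positive of_nat_0_less_iff zero_less_Suc)
    then obtain f where f: "\<And>k. dist (f k) x < inverse (real (Suc k))" "\<And>k. f k \<in> Q (bs k)" by metis
    have fx: "f \<longlonglongrightarrow> x"
    proof (rule metric_LIMSEQ_I)
      fix e :: real assume "0 < e"
      then obtain m where m: "inverse (real (Suc m)) < e" using reals_Archimedean by blast
      have "dist (f k) x < e" if "m \<le> k" for k
      proof -
        have "inverse (real (Suc k)) \<le> inverse (real (Suc m))" using that by simp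
        then show ?thesis using f(1)[of k] m by linarith
      qed
      then show "\<exists>no. \<forall>n\<ge>no. dist (f n) x < e" by blast
    qed
    have "\<exists>\<sigma>. (f k, \<sigma>) \<in> H \<and> (\<forall>i<k. \<sigma> i \<le> n i)" for k
      using f(2)[of k] unfolding Q_def bs by auto
    then obtain \<sigma> where "\<forall>k. (f k, \<sigma> k) \<in> H \<and> (\<forall>i<k. \<sigma> k i \<le> n i)"
      using choice_iff[of "\<lambda>k \<sigma>. (f k, \<sigma>) \<in> H \<and> (\<forall>i<k. \<sigma> i \<le> n i)"] by blast
    then have \<sigma>: "\<And>k. (f k, \<sigma> k) \<in> H" "\<And>k i. i < k \<Longrightarrow> \<sigma> k i \<le> n i" by auto
    define \<tau> where "\<tau> k i = min (\<sigma> k i) (n i)" for k i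
    have "\<forall>k. \<tau> k \<in> {\<sigma>. \<forall>i. \<sigma> i \<le> n i}" by (simp add: \<tau>_def)
    moreover have "seq_compact {\<sigma>. \<forall>i. \<sigma> i \<le> n i}"
      by (rule compact_imp_seq_compact[OF compact_nat_box])
    ultimately obtain t r where r: "strict_mono (r :: nat \<Rightarrow> nat)" "(\<tau> \<circ> r) \<longlonglongrightarrow> t"
      by (elim seq_compactE)
    have "(\<sigma> \<circ> r) \<longlonglongrightarrow> t"
    proof -
      have "(\<lambda>k. (\<sigma> \<circ> r) k i) \<longlonglongrightarrow> t i" for i
      proof -
        have "(\<lambda>k. (\<tau> \<circ> r) k i) \<longlonglongrightarrow> t i"
          using continuous_on_tendsto_compose[OF continuous_on_product_coordinates r(2)] by simp
        moreover have "eventually (\<lambda>k. (\<tau> \<circ> r) k i = (\<sigma> \<circ> r) k i) sequentially"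
          using eventually_gt_at_top[of i]
        proof eventually_elim
          case (elim k)
          then have "i < r k" using seq_suble[OF r(1), of k] by linarith
          then show ?case using \<sigma>(2) by (simp add: \<tau>_def min_def)
        qed
        ultimately show ?thesis using tendsto_cong by force
      qed
      then show ?thesis
        using limitin_componentwise[of "\<lambda>_. euclidean" UNIV "\<sigma> \<circ> r" t sequentially]
        by (simp add: euclidean_product_topology limitin_canonical_iff)
    qed
    moreover have "(f \<circ> r) \<longlonglongrightarrow> x" using fx r(1) by (rule LIMSEQ_subseq_LIMSEQ)
    ultimately have "(\<lambda>k. ((f \<circ> r) k, (\<sigma> \<circ> r) k)) \<longlonglongrightarrow> (x, t)" by (rule tendsto_Pair[rotated])
    then have "(x, t) \<in> H" by (rule closed_sequentially[OF H, rotated]) (simp add: \<sigma>(1))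
    then show "x \<in> P" unfolding P by auto
  qed
  moreover have "L \<in> sets lebesgue" unfolding L_def by auto
  ultimately show ?thesis by blast
qed

text \<open>The inner approximations exhaust the outer measure, so the set differs from a measurable one by a null set.\<close>
lemma analytic_bounded_lebesgue:
  fixes P :: "'b::euclidean_space set"
  assumes "analytic_set P" and bd: "bounded P"
  shows "P \<in> sets lebesgue"
proof -
  obtain H where H: "closed H" "P = {z. \<exists>\<sigma>::nat \<Rightarrow> nat. (z, \<sigma>) \<in> H}"
    using assms unfolding analytic_set_def by metis
  let ?o = "outer_measure_of lebesgue P"
  obtain E where E: "E \<in> sets lebesgue" "P \<subseteq> E" "?o = emeasure lebesgue E"
    using outer_measure_of_attain[of P lebesgue] by auto
  obtain c where "P \<subseteq> ball 0 c" using bounded_subset_ballD[OF bd] by blast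
  then have "P \<subseteq> cball 0 c" by auto
  then have "?o \<le> emeasure lebesgue (cball (0::'b) c)"
    using outer_measure_of_mono[of P "cball 0 c" lebesgue] by simp
  then have fin: "?o < \<infinity>" using emeasure_lborel_cball_finite[of "0::'b" c] by (simp add: order_le_less_trans)
  have "\<exists>L. L \<in> sets lebesgue \<and> L \<subseteq> P \<and> ?o - ennreal (inverse (Suc k)) \<le> emeasure lebesgue L" for k
  proof (cases "?o = 0")
    case False
    then have "?o - ennreal (inverse (Suc k)) < ?o" using fin
      by (intro ennreal_between) (auto simp: zero_less_iff_neq_zero)
    from analytic_inner_approx[OF H bd this] show ?thesis .
  qed (auto intro: exI[of _ "{}"])
  then obtain L where L: "\<And>k::nat. L k \<in> sets lebesgue" "\<And>k. L k \<subseteq> P"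
      "\<And>k. ?o - ennreal (inverse (Suc k)) \<le> emeasure lebesgue (L k)" by metis
  define U where "U = (\<Union>k. L k)"
  have U: "U \<in> sets lebesgue" "U \<subseteq> P" using L by (auto simp: U_def)
  have "?o \<le> emeasure lebesgue U"
  proof (rule ennreal_le_epsilon)
    fix e :: real assume "0 < e"
    then obtain k where k: "inverse (real (Suc k)) < e" using reals_Archimedean by blast
    have "?o - ennreal (inverse (Suc k)) \<le> emeasure lebesgue U"
      by (rule order_trans[OF L(3) emeasure_mono]) (use U in \<open>auto simp: U_def\<close>)
    then have "?o \<le> emeasure lebesgue U + ennreal (inverse (Suc k))"
      by (simp add: ennreal_minus_le_iff add.commute)
    also have "\<dots> \<le> emeasure lebesgue U + ennreal e" using k by (intro add_left_mono ennreal_leI) simp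
    finally show "?o \<le> emeasure lebesgue U + ennreal e" .
  qed
  moreover have "emeasure lebesgue U \<le> emeasure lebesgue E" using E U by (intro emeasure_mono) auto
  ultimately have eq: "emeasure lebesgue U = emeasure lebesgue E" using E by auto
  have "emeasure lebesgue (E - U) = 0"
    using U E fin eq by (subst emeasure_Diff) auto
  then have "E - U \<in> null_sets lebesgue" using E U by auto
  then have "P - U \<in> sets lebesgue"
    using null_sets_completion_subset[of "P - U" "E - U" lborel] E(2) by auto
  then have "(P - U) \<union> U \<in> sets lebesgue" using U(1) by (rule sets.Un)
  moreover have "(P - U) \<union> U = P" using U(2) by auto
  ultimately show ?thesis by simp
qed

text \<open>Over the complement of a null set of the base every measurable set of the product is Borel, and
  what lies over the null set projects to a null set.\<close>
theorem measurable_projection_lebesgue: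
  fixes X :: "'b::euclidean_space set"
  assumes X: "bounded X" and M: "sets M = sets (restrict_space lebesgue X)" "X \<in> sets lebesgue"
    and C: "C \<in> sets (M \<Otimes>\<^sub>M (borel :: real measure))"
  shows "fst ` C \<in> sets M"
proof -
  have spM: "space M = X" using sets_eq_imp_space_eq[OF M(1)] by simp
  have sM: "A \<in> sets M \<longleftrightarrow> A \<in> sets lebesgue \<and> A \<subseteq> X" for A
    using M by (auto simp: sets_restrict_space_iff)
  have "C \<in> sigma_sets (X \<times> UNIV) {a \<times> b |a b. a \<in> sets M \<and> b \<in> sets borel}"
    using C by (simp add: sets_pair_measure spM)
  then have "\<exists>S \<in> null_sets lborel. \<exists>B \<in> sets borel. C - S \<times> UNIV = B - S \<times> UNIV"
  proof induction
    case (Basic c)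
    then obtain a b where ab: "c = a \<times> b" "a \<in> sets lebesgue" "b \<in> sets borel" using sM by auto
    from \<open>a \<in> sets lebesgue\<close> obtain A N N' where A: "A \<in> sets borel" "N' \<in> null_sets lborel" "N \<subseteq> N'" "a = A \<union> N"
      by (elim sets_completionE) auto
    have "A \<times> b \<in> sets borel" using A ab by (auto simp: borel_prod[symmetric])
    moreover have "c - N' \<times> UNIV = A \<times> b - N' \<times> UNIV" using A ab by auto
    ultimately show ?case using A by blast
  next
    case Empty then show ?case by (intro bexI[of _ "{}"]) auto
  next
    case (Compl a)
    then obtain S B where SB: "S \<in> null_sets lborel" "B \<in> sets borel" "a - S \<times> UNIV = B - S \<times> UNIV" by auto
    obtain A N N' where A: "A \<in> sets borel" "N' \<in> null_sets lborel" "N \<subseteq> N'" "X = A \<union> N"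
      using M(2) by (elim sets_completionE) auto
    have "A \<times> (UNIV::real set) - B \<in> sets borel" using A SB by (intro sets.Diff) (auto simp: borel_prod[symmetric])
    moreover have "X \<times> UNIV - a - (S \<union> N') \<times> UNIV = A \<times> UNIV - B - (S \<union> N') \<times> UNIV" using A SB(3) by auto
    moreover have "S \<union> N' \<in> null_sets lborel" using SB A by auto
    ultimately show ?case
      by (intro bexI[of _ "S \<union> N'"] bexI[of _ "A \<times> UNIV - B"]) auto
  next
    case (Union a)
    let ?P = "\<lambda>i S B. S \<in> null_sets lborel \<and> B \<in> sets borel \<and> a i - S \<times> UNIV = B - S \<times> UNIV"
    from Union.IH have "\<forall>i. \<exists>S B. ?P i S B" by blast
    then obtain S B where "\<forall>i. ?P i (S i) (B i)" unfolding choice_iff by blast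
    then have SB: "\<And>i. S i \<in> null_sets lborel" "\<And>i. B i \<in> sets borel"
        "\<And>i. a i - S i \<times> UNIV = B i - S i \<times> UNIV" by blast+
    have "(\<Union>i. S i) \<in> null_sets lborel" using SB by auto
    moreover have "(\<Union>i. B i) \<in> sets borel" using SB by auto
    moreover have "(\<Union>i. a i) - (\<Union>i. S i) \<times> UNIV = (\<Union>i. B i) - (\<Union>i. S i) \<times> UNIV"
      using SB(3) by (simp add: set_eq_iff) blast
    ultimately show ?case
      by (intro bexI[of _ "\<Union>i. S i"] bexI[of _ "\<Union>i. B i"])
  qed
  then obtain S B where SB: "S \<in> null_sets lborel" "B \<in> sets borel" "C - S \<times> UNIV = B - S \<times> UNIV" by auto
  have CX: "C \<subseteq> X \<times> UNIV" using sets.sets_into_space[OF C] by (simp add: space_pair_measure spM)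
  have "B - S \<times> UNIV \<in> sets borel" using SB by (intro sets.Diff) (auto simp: borel_prod[symmetric])
  then have "analytic_set (fst ` (C - S \<times> UNIV))" unfolding SB(3) by (intro analytic_fst_image analytic_borel)
  moreover have "fst ` (C - S \<times> UNIV) \<subseteq> X" using CX by auto
  ultimately have 1: "fst ` (C - S \<times> UNIV) \<in> sets lebesgue"
    using X by (intro analytic_bounded_lebesgue) (auto intro: bounded_subset)
  have 2: "fst ` (C \<inter> S \<times> UNIV) \<in> sets lebesgue"
  proof -
    have "fst ` (C \<inter> S \<times> UNIV) \<in> null_sets lebesgue"
      by (rule null_sets_completion_subset[OF _ null_sets_completionI[OF SB(1)]]) auto
    then show ?thesis by auto
  qed
  have "fst ` C = fst ` (C - S \<times> UNIV) \<union> fst ` (C \<inter> S \<times> UNIV)" by auto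
  then show ?thesis using 1 2 CX unfolding sM by (auto intro!: sets.Un)
qed

section \<open>Regular points of a piecewise system\<close>

context piecewise_system begin

sublocale prob_space \<mu> by (rule prob_mu)

abbreviation bi where "bi \<equiv> branch_index N Z"
abbreviation cyl where "cyl \<equiv> cylinder X Z T"

lemma X_leb: "X \<in> sets lebesgue"
  using compact_X by (simp add: compact_imp_closed)

lemma space_mu: "space \<mu> = X"
  using sets_eq_imp_space_eq[OF sets_mu] by simp

lemma sets_mu_iff: "A \<in> sets \<mu> \<longleftrightarrow> A \<in> sets lebesgue \<and> A \<subseteq> X"
  using X_leb by (auto simp: sets_mu sets_restrict_space_iff)

lemma X_sets[measurable, simp]: "X \<in> sets \<mu>"
  using sets.top[of \<mu>] by (simp add: space_mu)

lemma closed_sets: "closed C \<Longrightarrow> C \<subseteq> X \<Longrightarrow> C \<in> sets \<mu>"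
  by (simp add: sets_mu_iff)

lemma mu_subset: "A \<in> sets \<mu> \<Longrightarrow> A \<subseteq> X"
  by (simp add: sets_mu_iff)

lemma T_meas[measurable]: "T \<in> measurable \<mu> \<mu>"
  by (rule measurableI) (use T_into c2_vimage in \<open>auto simp: space_mu\<close>)

lemma Tn_meas[measurable]: "(T ^^ n) \<in> measurable \<mu> \<mu>"
proof (induction n)
  case (Suc n) then show ?case using measurable_comp[OF Suc T_meas] by (simp add: comp_def)
qed simp

lemma T_X: "x \<in> X \<Longrightarrow> T x \<in> X" using T_into by auto
lemma Tn_X: "x \<in> X \<Longrightarrow> (T ^^ n) x \<in> X" by (induction n) (auto intro: T_X)

lemma id_borel_meas: "(\<lambda>x. x) \<in> borel_measurable \<mu>"
proof (rule measurableI)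
  fix A :: "'a set" assume "A \<in> sets borel"
  then show "(\<lambda>x. x) -` A \<inter> space \<mu> \<in> sets \<mu>"
    using X_leb by (auto simp: sets_mu_iff space_mu intro!: sets.Int)
qed simp

lemma continuous_meas: "continuous_on UNIV f \<Longrightarrow> (f :: 'a \<Rightarrow> real) \<in> borel_measurable \<mu>"
  using measurable_compose[OF id_borel_meas borel_measurable_continuous_onI] by simp

lemma Z_sets[measurable, simp]: "j \<in> {1..N} \<Longrightarrow> Z j \<in> sets \<mu>"
  using Z_closed by (intro closed_sets) auto

lemma bi_meas[measurable]: "bi \<in> measurable \<mu> (count_space UNIV)"
proof -
  have *: "{x \<in> space \<mu>. bi x = j} \<in> sets \<mu>" for j
  proof -
    have "{x \<in> space \<mu>. bi x = j} =
      (if j \<in> {1..N} then Z j - (\<Union>i\<in>{1..N} \<inter> {..<j}. Z i)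
       else if j = 0 then X - (\<Union>i\<in>{1..N}. Z i) else {})" (is "?L = ?R")
    proof (rule set_eqI)
      fix x
      show "x \<in> ?L \<longleftrightarrow> x \<in> ?R"
      proof (cases "\<exists>k\<in>{1..N}. x \<in> Z k")
        case True
        let ?k = "LEAST k. k \<in> {1..N} \<and> x \<in> Z k"
        have k: "?k \<in> {1..N} \<and> x \<in> Z ?k" using True LeastI_ex[of "\<lambda>k. k \<in> {1..N} \<and> x \<in> Z k"] by blast
        have least: "i < ?k \<Longrightarrow> \<not> (i \<in> {1..N} \<and> x \<in> Z i)" for i by (rule not_less_Least)
        have bx: "bi x = ?k" using True by (simp add: branch_index_def)
        have xX: "x \<in> X" using True Z_closed by blast
        show ?thesis
        proof (cases "j \<in> {1..N} \<and> x \<in> Z j")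
          case t: True
          have "j = ?k \<longleftrightarrow> (\<forall>i\<in>{1..N} \<inter> {..<j}. x \<notin> Z i)"
          proof
            assume "j = ?k"
            then show "\<forall>i\<in>{1..N} \<inter> {..<j}. x \<notin> Z i" using least by blast
          next
            assume a: "\<forall>i\<in>{1..N} \<inter> {..<j}. x \<notin> Z i"
            have "\<not> ?k < j" using a k by blast
            moreover have "\<not> j < ?k" using least[of j] t by blast
            ultimately show "j = ?k" by simp
          qed
          then show ?thesis using t bx xX by (auto simp: space_mu)
        next
          case False then show ?thesis using k bx True by (auto simp: space_mu)
        qed
      next
        case False then show ?thesis using Z_closed by (auto simp: branch_index_def space_mu)
      qed
    qed
    also have "\<dots> \<in> sets \<mu>" by auto
    finally show ?thesis .
  qed
  show ?thesis
    by (subst measurable_count_space_eq2_countable) (use * in \<open>auto simp: vimage_def Int_def conj_commute\<close>)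
qed

text \<open>At a regular point the branch is unambiguous, and the map agrees near the point with the injective
  extension of its branch.\<close>
definition regular_pt :: "'a \<Rightarrow> bool" where
  "regular_pt x \<longleftrightarrow> (\<exists>j\<in>{1..N}. x \<in> top_of_set X interior_of Z j \<and> (\<forall>i\<in>{1..N}. x \<in> Z i \<longrightarrow> i = j))"

lemma frontier_null: "(\<Union>j\<in>{1..N}. top_of_set X frontier_of Z j) \<in> null_sets \<mu>"
proof -
  have "top_of_set X frontier_of Z j \<in> sets \<mu>" for j
  proof -
    have "closedin (top_of_set X) (top_of_set X frontier_of Z j)" by (rule closedin_frontier_of)
    then have "closed (top_of_set X frontier_of Z j)"
      using closedin_closed_trans compact_X compact_imp_closed by blast
    then show ?thesis using frontier_of_subset_topspace[of "top_of_set X" "Z j"] by (intro closed_sets) auto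
  qed
  then have "(\<Union>j\<in>{1..N}. top_of_set X frontier_of Z j) \<in> sets \<mu>" by auto
  moreover have "(T ^^ 0) ` (\<Union>j\<in>{1..N}. top_of_set X frontier_of Z j) \<subseteq>
       (\<Union>n. (T ^^ n) ` (\<Union>j\<in>{1..N}. top_of_set X frontier_of Z j))"
    by (rule UN_upper) simp
  ultimately show ?thesis using null_sets_subset[OF c6] by simp
qed

lemma AE_regular_pt: "AE x in \<mu>. regular_pt x"
proof -
  let ?F = "\<Union>j\<in>{1..N}. top_of_set X frontier_of Z j"
  let ?O = "\<Union>i\<in>{1..N}. \<Union>j\<in>{1..N}-{i}. Z i \<inter> Z j"
  have 1: "AE x in \<mu>. x \<notin> ?F" by (rule AE_not_in[OF frontier_null])
  have "Z i \<inter> Z j \<in> null_sets \<mu>" if "i \<in> {1..N}" "j \<in> {1..N} - {i}" for i j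
    using that Z_overlap[of i j] by (auto intro!: null_setsI)
  then have "?O \<in> null_sets \<mu>" by (intro null_sets.finite_UN) auto
  from AE_not_in[OF this] have 2: "AE x in \<mu>. x \<notin> ?O" .
  have "prob (\<Union>j\<in>{1..N}. Z j) = 1" using Z_cover by (simp add: emeasure_eq_measure)
  then have 3: "AE x in \<mu>. x \<in> (\<Union>j\<in>{1..N}. Z j)" by (subst prob_eq_1[symmetric]) auto
  show ?thesis using 1 2 3 AE_space
  proof eventually_elim
    case (elim x)
    from elim(3) obtain j where j: "j \<in> {1..N}" "x \<in> Z j" by (rule UN_E)
    have "Z j \<subseteq> top_of_set X closure_of Z j" using Z_closed[OF j(1)] by (intro closure_of_subset) simp
    with j have "x \<in> top_of_set X closure_of Z j" by (rule_tac subsetD)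
    moreover have "x \<notin> top_of_set X frontier_of Z j" using elim(1) j(1) by (meson UN_I)
    ultimately have 1: "x \<in> top_of_set X interior_of Z j" by (simp add: frontier_of_def)
    have "i = j" if "i \<in> {1..N}" "x \<in> Z i" for i
    proof (rule ccontr)
      assume "i \<noteq> j"
      then have "x \<in> Z i \<inter> Z j" "j \<in> {1..N} - {i}" using j that by auto
      then show False using elim(2) that(1) by (meson UN_I)
    qed
    then show ?case using j(1) 1 unfolding regular_pt_def by (intro bexI[of _ j]) auto
  qed
qed

lemma regular_bi: "regular_pt x \<Longrightarrow> bi x \<in> {1..N} \<and> x \<in> Z (bi x)"
proof -
  assume "regular_pt x"
  then obtain j where "j \<in> {1..N}" "x \<in> Z j"
    unfolding regular_pt_def using interior_of_subset[of "top_of_set X"] by (meson subsetD)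
  then have ex: "\<exists>j\<in>{1..N}. x \<in> Z j" by auto
  then have "bi x = (LEAST j. j \<in> {1..N} \<and> x \<in> Z j)" by (simp add: branch_index_def)
  moreover have "(LEAST j. j \<in> {1..N} \<and> x \<in> Z j) \<in> {1..N} \<and> x \<in> Z (LEAST j. j \<in> {1..N} \<and> x \<in> Z j)"
    using ex by (intro LeastI_ex[of "\<lambda>j. j \<in> {1..N} \<and> x \<in> Z j"]) blast
  ultimately show ?thesis by simp
qed

lemma regular_in_Z: "regular_pt x \<Longrightarrow> j \<in> {1..N} \<Longrightarrow> x \<in> Z j \<longleftrightarrow> bi x = j"
  using regular_bi[of x] unfolding regular_pt_def by metis

text \<open>On the interior of a piece the map coincides with the injective extension provided by \<open>c1\<close>.\<close>
lemma regular_inj: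
  assumes "regular_pt x" "regular_pt y" "bi x = bi y" "T x = T y" shows "x = y"
proof -
  let ?I = "top_of_set X interior_of Z (bi x)"
  have j: "bi x \<in> {1..N}" using regular_bi assms(1) by auto
  have xy: "x \<in> ?I" "y \<in> ?I"
    using assms(1,2,3) regular_bi[OF assms(1)] regular_bi[OF assms(2)] unfolding regular_pt_def by auto
  obtain g where "branch_extension X T (Z (bi x)) g" using c1[OF j] by blast
  then have "inj_on g (Z (bi x))" "\<forall>x\<in>?I. g x = T x" by (auto simp: branch_extension_def)
  moreover have "?I \<subseteq> Z (bi x)" by (rule interior_of_subset)
  ultimately show ?thesis using xy assms(4) unfolding inj_on_def by (metis subsetD)
qed

lemma AE_T: assumes "AE x in \<mu>. P x" shows "AE x in \<mu>. P (T x)"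
proof -
  obtain N where N: "{x \<in> space \<mu>. \<not> P x} \<subseteq> N" "N \<in> sets \<mu>" "emeasure \<mu> N = 0" using AE_E[OF assms] .
  then have "T -` N \<inter> X \<in> null_sets \<mu>" using c2_null c2_vimage by (intro null_setsI) auto
  then show ?thesis by (rule AE_I') (use N T_X in \<open>auto simp: space_mu\<close>)
qed

lemma AE_orbit: assumes "AE x in \<mu>. P x" shows "AE x in \<mu>. \<forall>n. P ((T ^^ n) x)"
proof -
  have "AE x in \<mu>. P ((T ^^ n) x)" for n
  proof (induction n)
    case (Suc n) from AE_T[OF Suc] show ?case by (simp add: funpow_swap1)
  qed (use assms in simp)
  then show ?thesis by (simp add: AE_all_countable)
qed

text \<open>A property that holds almost everywhere holds along the whole orbit on a forward invariant set of
  full measure: remove all preimages of the exceptional null set, which are null by \<open>c2\<close>.\<close>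
lemma invariant_core:
  assumes "AE x in \<mu>. P x"
  obtains G where "G \<in> sets \<mu>" "X - G \<in> null_sets \<mu>" "\<And>x. x \<in> G \<Longrightarrow> P x" "\<And>x. x \<in> G \<Longrightarrow> T x \<in> G"
proof -
  obtain N where N: "{x \<in> space \<mu>. \<not> P x} \<subseteq> N" "N \<in> sets \<mu>" "emeasure \<mu> N = 0" using AE_E[OF assms] .
  define G where "G = (\<Inter>n. {x \<in> space \<mu>. (T ^^ n) x \<notin> N})"
  have G: "G \<in> sets \<mu>" unfolding G_def using N(2) by measurable
  have "AE x in \<mu>. x \<notin> N" using N by (intro AE_not_in null_setsI)
  from AE_orbit[OF this] have "AE x in \<mu>. x \<in> G" by (auto simp: G_def)
  then have "AE x in \<mu>. x \<notin> X - G" by eventually_elim simp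
  then have "X - G \<in> null_sets \<mu>" using G by (subst AE_iff_null_sets) auto
  moreover have "P x" if "x \<in> G" for x
  proof -
    have "(T ^^ 0) x \<notin> N" "x \<in> space \<mu>" using that unfolding G_def by blast+
    then show ?thesis using N(1) by auto
  qed
  moreover have "T x \<in> G" if "x \<in> G" for x
  proof -
    have "(T ^^ Suc n) x \<notin> N" "x \<in> space \<mu>" for n using that unfolding G_def by blast+
    then show ?thesis using T_X by (auto simp: G_def funpow_swap1 space_mu)
  qed
  ultimately show thesis using G that by blast
qed

section \<open>Branches and cylinders\<close>

lemma s_pos: "j \<in> {1..N} \<Longrightarrow> 0 < s j" using c4_ge by fastforce

text \<open>Since \<open>T ` (A \<inter> T -` B) = T ` A \<inter> B\<close>, the scaling of images \<open>c4\<close> becomes a formula for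
  preimages within one branch.\<close>
lemma branch_preimage:
  assumes j: "j \<in> {1..N}" and A: "A \<in> sets \<mu>" "A \<subseteq> Z j" and B: "B \<in> sets \<mu>"
  shows "emeasure \<mu> (A \<inter> T -` B) = ennreal (1 / s j) * emeasure \<mu> (T ` A \<inter> B)"
proof -
  have eq: "A \<inter> T -` B = A \<inter> (T -` B \<inter> X)" using A mu_subset by auto
  have m: "A \<inter> T -` B \<in> sets \<mu>" unfolding eq using A B c2_vimage by auto
  have "T ` A \<inter> B = T ` (A \<inter> T -` B)" by auto
  then have "emeasure \<mu> (T ` A \<inter> B) = ennreal (s j) * emeasure \<mu> (A \<inter> T -` B)"
    using c4[OF j m] A by auto
  then have "ennreal (1 / s j) * emeasure \<mu> (T ` A \<inter> B) = (ennreal (1 / s j) * ennreal (s j)) * emeasure \<mu> (A \<inter> T -` B)"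
    by (simp add: mult.assoc)
  then show ?thesis using s_pos[OF j] by (simp add: ennreal_mult[symmetric])
qed

lemma branch_nn_integral:
  assumes j: "j \<in> {1..N}" and A: "A \<in> sets \<mu>" "A \<subseteq> Z j" and g: "g \<in> borel_measurable \<mu>"
  shows "(\<integral>\<^sup>+x. g (T x) * indicator A x \<partial>\<mu>) = ennreal (1 / s j) * (\<integral>\<^sup>+x. g x * indicator (T ` A) x \<partial>\<mu>)"
proof -
  have TA: "T ` A \<in> sets \<mu>" using A c2_image by auto
  have "distr (density \<mu> (indicator A)) \<mu> T = density \<mu> (\<lambda>x. ennreal (1 / s j) * indicator (T ` A) x)" (is "?L = ?R")
  proof (rule measure_eqI)
    fix B assume "B \<in> sets ?L"
    then have B: "B \<in> sets \<mu>" by simp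
    have "emeasure ?L B = emeasure (density \<mu> (indicator A)) (T -` B \<inter> space \<mu>)"
      using B by (subst emeasure_distr) auto
    also have "\<dots> = (\<integral>\<^sup>+x. indicator A x * indicator (T -` B \<inter> space \<mu>) x \<partial>\<mu>)"
      using A B c2_vimage by (subst emeasure_density) (auto simp: space_mu)
    also have "\<dots> = (\<integral>\<^sup>+x. indicator (A \<inter> T -` B) x \<partial>\<mu>)"
      using A mu_subset by (intro nn_integral_cong) (auto simp: space_mu split: split_indicator)
    also have "\<dots> = emeasure \<mu> (A \<inter> T -` B)"
    proof (rule nn_integral_indicator)
      have "A \<inter> T -` B = A \<inter> (T -` B \<inter> X)" using A mu_subset by auto
      then show "A \<inter> T -` B \<in> sets \<mu>" using A B c2_vimage by auto
    qed
    also have "\<dots> = ennreal (1 / s j) * emeasure \<mu> (T ` A \<inter> B)" by (rule branch_preimage[OF j A B])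
    also have "\<dots> = (\<integral>\<^sup>+x. ennreal (1 / s j) * indicator (T ` A \<inter> B) x \<partial>\<mu>)"
      using TA B by (subst nn_integral_cmult_indicator) auto
    also have "\<dots> = (\<integral>\<^sup>+x. (ennreal (1 / s j) * indicator (T ` A) x) * indicator B x \<partial>\<mu>)"
      by (intro nn_integral_cong) (auto split: split_indicator)
    also have "\<dots> = emeasure ?R B" using TA B by (subst emeasure_density) auto
    finally show "emeasure ?L B = emeasure ?R B" .
  qed simp
  then have "nn_integral ?L g = nn_integral ?R g" by simp
  moreover have "nn_integral ?L g = (\<integral>\<^sup>+x. g (T x) * indicator A x \<partial>\<mu>)"
    using A g by (subst nn_integral_distr) (auto simp: nn_integral_density mult.commute)
  moreover have "nn_integral ?R g = ennreal (1 / s j) * (\<integral>\<^sup>+x. g x * indicator (T ` A) x \<partial>\<mu>)"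
    using TA g by (subst nn_integral_density) (auto simp: nn_integral_cmult[symmetric] ac_simps)
  ultimately show ?thesis by simp
qed

lemma image_null: "j \<in> {1..N} \<Longrightarrow> A \<in> null_sets \<mu> \<Longrightarrow> A \<subseteq> Z j \<Longrightarrow> T ` A \<in> null_sets \<mu>"
  using c4[of j A] c2_image by (auto simp: null_sets_def)

text \<open>Closed cylinders overlap in null sets. The itinerary, which records the least index of a piece, gives
  instead an exact partition into cells that agree with the cylinders almost everywhere.\<close>
definition itinerary :: "'a \<Rightarrow> nat \<Rightarrow> nat list" where
  "itinerary x n = map (\<lambda>i. bi ((T ^^ i) x)) [0..<n]"

lemma itinerary_length[simp]: "length (itinerary x n) = n" by (simp add: itinerary_def)
lemma itinerary_Suc: "itinerary x (Suc n) = itinerary x n @ [bi ((T ^^ n) x)]" by (simp add: itinerary_def)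
lemma itinerary_take: "n \<le> m \<Longrightarrow> take n (itinerary x m) = itinerary x n"
  by (simp add: itinerary_def take_map)

lemma itinerary_meas[measurable]: "(\<lambda>x. itinerary x n) \<in> measurable \<mu> (count_space UNIV)"
proof (induction n)
  case 0 then show ?case by (simp add: itinerary_def)
next
  case (Suc n)
  note [measurable] = Suc
  have "(\<lambda>x. (\<lambda>p. fst p @ [snd p]) (itinerary x n, bi ((T ^^ n) x))) \<in> measurable \<mu> (count_space UNIV)"
    by (rule measurable_compose[where N="count_space UNIV \<Otimes>\<^sub>M count_space UNIV"])
      (auto simp: pair_measure_countable)
  then show ?case by (simp add: itinerary_Suc)
qed

lemma cell_sets[measurable, simp]: "{x \<in> X. itinerary x n \<in> W} \<in> sets \<mu>"
proof -
  have "{x \<in> space \<mu>. itinerary x n \<in> W} \<in> sets \<mu>" by measurable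
  then show ?thesis by (simp add: space_mu)
qed

lemma cyl_sets[measurable, simp]: "set w \<subseteq> {1..N} \<Longrightarrow> cyl w \<in> sets \<mu>"
proof -
  assume w: "set w \<subseteq> {1..N}"
  have "{x \<in> space \<mu>. (T ^^ i) x \<in> Z (w ! i)} \<in> sets \<mu>" if "i < length w" for i
  proof -
    have [measurable]: "Z (w ! i) \<in> sets \<mu>" using w that by (intro Z_sets) (auto simp: subset_iff)
    show ?thesis by measurable
  qed
  moreover have "cyl w = X \<inter> (\<Inter>i\<in>{..<length w}. {x \<in> space \<mu>. (T ^^ i) x \<in> Z (w ! i)})"
    if "w \<noteq> []" using that by (auto simp: cylinder_def space_mu)
  moreover have "cyl [] = X" by (auto simp: cylinder_def)
  ultimately show ?thesis by (cases "w = []") (auto intro!: sets.Int sets.finite_INT)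
qed

lemma cyl_itinerary:
  assumes "\<forall>n. regular_pt ((T ^^ n) x)" "x \<in> X" "set w \<subseteq> {1..N}"
  shows "x \<in> cyl w \<longleftrightarrow> itinerary x (length w) = w"
proof -
  have "x \<in> cyl w \<longleftrightarrow> (\<forall>i<length w. bi ((T ^^ i) x) = w ! i)"
    using assms by (auto simp: cylinder_def regular_in_Z subset_iff)
  also have "\<dots> \<longleftrightarrow> itinerary x (length w) = w"
    unfolding itinerary_def list_eq_iff_nth_eq by simp
  finally show ?thesis .
qed

lemma AE_cyl_itinerary: "AE x in \<mu>. \<forall>w. set w \<subseteq> {1..N} \<longrightarrow> (x \<in> cyl w \<longleftrightarrow> itinerary x (length w) = w)"
  using AE_orbit[OF AE_regular_pt] AE_space
  by eventually_elim (auto simp: cyl_itinerary space_mu)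

lemma itinerary_set: "\<forall>n. regular_pt ((T ^^ n) x) \<Longrightarrow> set (itinerary x n) \<subseteq> {1..N}"
  using regular_bi by (auto simp: itinerary_def)

text \<open>Along the first \<open>n\<close> steps the whole cylinder stays in one piece at a time, so the scaling factors multiply.\<close>
lemma scale_cyl:
  assumes B: "B \<in> sets \<mu>" "B \<subseteq> cyl w" and w: "set w \<subseteq> {1..N}" and n: "n \<le> length w"
  shows "(T ^^ n) ` B \<in> sets \<mu>" "emeasure \<mu> ((T ^^ n) ` B) = ennreal (\<Prod>i<n. s (w ! i)) * emeasure \<mu> B"
proof -
  have "(T ^^ n) ` B \<in> sets \<mu> \<and> emeasure \<mu> ((T ^^ n) ` B) = ennreal (\<Prod>i<n. s (w ! i)) * emeasure \<mu> B" using n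
  proof (induction n)
    case 0 then show ?case using B by simp
  next
    case (Suc n)
    have j: "w ! n \<in> {1..N}" using w Suc.prems by (auto simp: subset_iff)
    have sub: "(T ^^ n) ` B \<subseteq> Z (w ! n)" using B Suc.prems by (auto simp: cylinder_def)
    have IH: "(T ^^ n) ` B \<in> sets \<mu>" "emeasure \<mu> ((T ^^ n) ` B) = ennreal (\<Prod>i<n. s (w ! i)) * emeasure \<mu> B"
      using Suc by auto
    have im: "(T ^^ Suc n) ` B = T ` ((T ^^ n) ` B)" by (simp add: image_comp)
    have p: "0 \<le> (\<Prod>i<n. s (w ! i))"
    proof (rule prod_nonneg)
      fix i assume "i \<in> {..<n}"
      then have "w ! i \<in> {1..N}" using w Suc.prems by (auto simp: subset_iff)
      then show "0 \<le> s (w ! i)" using s_pos by fastforce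
    qed
    show ?case
      unfolding im using c2_image[OF IH(1)] c4[OF j IH(1) sub] IH(2) p s_pos[OF j]
      by (simp add: ennreal_mult mult.assoc mult.commute mult.left_commute)
  qed
  then show "(T ^^ n) ` B \<in> sets \<mu>" "emeasure \<mu> ((T ^^ n) ` B) = ennreal (\<Prod>i<n. s (w ! i)) * emeasure \<mu> B" by auto
qed

lemma scale_pos:
  assumes w: "set w \<subseteq> {1..N}" and n: "n \<le> length w" shows "1 \<le> (\<Prod>i<n. s (w ! i))"
proof (rule prod_ge_1)
  fix i assume "i \<in> {..<n}"
  then have "w ! i \<in> {1..N}" using w n by (auto simp: subset_iff)
  then show "1 \<le> s (w ! i)" using c4_ge by auto
qed

end

section \<open>Approximation by cylinders\<close>

context piecewise_system begin

text \<open>Approximation in measure by unions of cells of a fixed order. The set of words may be infinite, but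
  only finitely many of its words of that order describe cells of positive measure.\<close>
definition approximable :: "'a set \<Rightarrow> bool" where
  "approximable A \<longleftrightarrow> A \<in> sets \<mu> \<and>
     (\<forall>\<epsilon>>0. \<exists>n W. prob (sym_diff A {x \<in> X. itinerary x n \<in> W}) < \<epsilon>)"

lemma approximable_Compl:
  assumes "approximable A" shows "approximable (X - A)"
  unfolding approximable_def
proof (intro conjI allI impI)
  show "X - A \<in> events" using assms by (auto simp: approximable_def)
  fix \<epsilon> :: real assume "0 < \<epsilon>"
  then obtain n W where W: "prob (sym_diff A {x \<in> X. itinerary x n \<in> W}) < \<epsilon>"
    using assms by (auto simp: approximable_def)
  have "sym_diff (X - A) {x \<in> X. itinerary x n \<in> - W} = sym_diff A {x \<in> X. itinerary x n \<in> W}"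
    using assms mu_subset by (auto simp: approximable_def)
  with W have "prob (sym_diff (X - A) {x \<in> X. itinerary x n \<in> - W}) < \<epsilon>" by simp
  then show "\<exists>n W. prob (sym_diff (X - A) {x \<in> X. itinerary x n \<in> W}) < \<epsilon>" by (intro exI)
qed

text \<open>Finitely many of the sets carry the union up to a small error; their cells are refined to a common order.\<close>
lemma approximable_UN:
  assumes a: "\<And>i::nat. approximable (a i)" shows "approximable (\<Union>i. a i)"
  unfolding approximable_def
proof (intro conjI allI impI)
  have as: "\<And>i. a i \<in> sets \<mu>" using a by (auto simp: approximable_def)
  then show U: "(\<Union>i. a i) \<in> events" by auto
  fix \<epsilon> :: real assume e: "0 < \<epsilon>"
  have "(\<lambda>n. prob (\<Union>i<n. a i)) \<longlonglongrightarrow> prob (\<Union>n. \<Union>i<n. a i)"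
    using as by (intro finite_Lim_measure_incseq incseq_SucI UN_mono) auto
  moreover have "(\<Union>n. \<Union>i<n. a i) = (\<Union>i. a i)" by auto
  ultimately have "(\<lambda>n. prob (\<Union>i<n. a i)) \<longlonglongrightarrow> prob (\<Union>i. a i)" by simp
  then obtain K where "dist (prob (\<Union>i<K. a i)) (prob (\<Union>i. a i)) < \<epsilon> / 2"
    using e by (meson half_gt_zero metric_LIMSEQ_D order_refl)
  moreover have "prob ((\<Union>i. a i) - (\<Union>i<K. a i)) = prob (\<Union>i. a i) - prob (\<Union>i<K. a i)"
    using as by (intro finite_measure_Diff) auto
  ultimately have K: "prob ((\<Union>i. a i) - (\<Union>i<K. a i)) < \<epsilon> / 2"
    unfolding dist_real_def by linarith
  have "\<forall>i. \<exists>n W. prob (sym_diff (a i) {x \<in> X. itinerary x n \<in> W}) < \<epsilon> / (2 * (real K + 1))"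
    using a e by (auto simp: approximable_def)
  then obtain n W where W: "\<And>i. prob (sym_diff (a i) {x \<in> X. itinerary x (n i) \<in> W i}) < \<epsilon> / (2 * (real K + 1))"
    unfolding choice_iff by blast
  define m where "m = Max (n ` {..K})"
  have m: "n i \<le> m" if "i < K" for i unfolding m_def using that by (intro Max_ge) auto
  (* the cells of order n i, written as unions of cells of the common order m *)
  define V where "V = {w. \<exists>i<K. take (n i) w \<in> W i}"
  let ?S = "\<lambda>i. sym_diff (a i) {x \<in> X. itinerary x (n i) \<in> W i}"
  have S: "?S i \<in> sets \<mu>" for i using as by auto
  have "sym_diff (\<Union>i. a i) {x \<in> X. itinerary x m \<in> V} \<subseteq> ((\<Union>i. a i) - (\<Union>i<K. a i)) \<union> (\<Union>i<K. ?S i)"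
  proof
    fix x assume "x \<in> sym_diff (\<Union>i. a i) {x \<in> X. itinerary x m \<in> V}"
    then consider "x \<in> (\<Union>i. a i)" "\<not> (x \<in> X \<and> itinerary x m \<in> V)"
      | "x \<notin> (\<Union>i. a i)" "x \<in> X" "itinerary x m \<in> V" by blast
    then show "x \<in> ((\<Union>i. a i) - (\<Union>i<K. a i)) \<union> (\<Union>i<K. ?S i)"
    proof cases
      case 1
      show ?thesis
      proof (cases "x \<in> (\<Union>i<K. a i)")
        case True
        then obtain i where i: "i < K" "x \<in> a i" by auto
        have "\<not> (x \<in> X \<and> itinerary x (n i) \<in> W i)" using 1(2) i m[OF i(1)] by (auto simp: V_def itinerary_take)
        then have "x \<in> ?S i" using i by blast
        then show ?thesis using i(1) by blast
      qed (use 1 in blast)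
    next
      case 2
      then obtain i where i: "i < K" "itinerary x (n i) \<in> W i" using m by (auto simp: V_def itinerary_take)
      then have "x \<in> ?S i" using 2 by blast
      then show ?thesis using i(1) by blast
    qed
  qed
  then have "prob (sym_diff (\<Union>i. a i) {x \<in> X. itinerary x m \<in> V}) \<le> prob (((\<Union>i. a i) - (\<Union>i<K. a i)) \<union> (\<Union>i<K. ?S i))"
    using as S by (intro finite_measure_mono) auto
  also have "\<dots> \<le> prob ((\<Union>i. a i) - (\<Union>i<K. a i)) + prob (\<Union>i<K. ?S i)"
    using as S by (intro measure_Un_le) auto
  also have "prob (\<Union>i<K. ?S i) \<le> (\<Sum>i<K. prob (?S i))"
    using S by (intro finite_measure_subadditive_finite) auto
  also have "\<dots> \<le> (\<Sum>i<K. \<epsilon> / (2 * (real K + 1)))"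
    using W by (intro sum_mono less_imp_le)
  also have "\<dots> = \<epsilon> / 2 * (real K / (real K + 1))" by (simp add: field_simps)
  also have "\<dots> \<le> \<epsilon> / 2 * 1" using e by (intro mult_left_mono) auto
  finally have "prob (sym_diff (\<Union>i. a i) {x \<in> X. itinerary x m \<in> V}) < \<epsilon>" using K by simp
  then show "\<exists>n W. prob (sym_diff (\<Union>i. a i) {x \<in> X. itinerary x n \<in> W}) < \<epsilon>" by blast
qed

lemma approximable_cyl:
  assumes w: "set w \<subseteq> {1..N}" shows "approximable (cyl w)"
  unfolding approximable_def
proof (intro conjI allI impI)
  show "cyl w \<in> events" using w by simp
  fix \<epsilon> :: real assume e: "0 < \<epsilon>"
  have "AE x in \<mu>. x \<notin> sym_diff (cyl w) {x \<in> X. itinerary x (length w) \<in> {w}}"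
    using AE_cyl_itinerary AE_space
  proof eventually_elim
    case (elim x) then show ?case using w by (auto simp: space_mu)
  qed
  moreover have m: "sym_diff (cyl w) {x \<in> X. itinerary x (length w) \<in> {w}} \<in> events"
    using cyl_sets[OF w] cell_sets by (intro sets.Un sets.Diff)
  ultimately have "sym_diff (cyl w) {x \<in> X. itinerary x (length w) \<in> {w}} \<in> null_sets \<mu>"
    by (subst AE_iff_null_sets)
  then have "prob (sym_diff (cyl w) {x \<in> X. itinerary x (length w) \<in> {w}}) = 0"
    by (simp add: null_sets_def measure_def)
  then show "\<exists>n W. prob (sym_diff (cyl w) {x \<in> X. itinerary x n \<in> W}) < \<epsilon>"
    using e by (intro exI[of _ "length w"] exI[of _ "{w}"]) simp
qed

lemma words_set: "w \<in> words N \<Longrightarrow> set w \<subseteq> {1..N}" by (simp add: words_def)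

text \<open>Approximable sets form a sigma-algebra containing the cylinders, so \<open>c3\<close> applies.\<close>
lemma approximable_all:
  assumes A: "A \<in> sets \<mu>" shows "approximable A"
proof -
  obtain B where B: "B \<in> sigma_sets X (cyl ` words N)" "ae_eq_set \<mu> A B" using c3[OF A] by blast
  have apB: "approximable B" using B(1)
  proof induction
    case (Basic a)
    then obtain w where "w \<in> words N" "a = cyl w" by blast
    then show ?case using approximable_cyl[OF words_set] by simp
  next
    case Empty
    have "\<exists>n W. prob (sym_diff {} {x \<in> X. itinerary x n \<in> W}) < \<epsilon>" if "0 < \<epsilon>" for \<epsilon> :: real
      using that by (intro exI[of _ 0] exI[of _ "{}"]) simp
    then show ?case by (auto simp: approximable_def)
  next
    case (Compl a) then show ?case by (rule_tac approximable_Compl)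
  next
    case (Union a) then show ?case by (rule_tac approximable_UN)
  qed
  have Bs: "B \<in> sets \<mu>" using apB by (simp add: approximable_def)
  show ?thesis unfolding approximable_def
  proof (intro conjI allI impI A)
    fix \<epsilon> :: real assume "0 < \<epsilon>"
    then obtain n W where W: "prob (sym_diff B {x \<in> X. itinerary x n \<in> W}) < \<epsilon>"
      using apB by (auto simp: approximable_def)
    have "prob (sym_diff A {x \<in> X. itinerary x n \<in> W}) \<le> prob (sym_diff B {x \<in> X. itinerary x n \<in> W} \<union> sym_diff A B)"
      using A Bs by (intro finite_measure_mono sets.Un sets.Diff cell_sets) auto
    also have "\<dots> \<le> prob (sym_diff B {x \<in> X. itinerary x n \<in> W}) + prob (sym_diff A B)"
      using A Bs by (intro measure_Un_le sets.Un sets.Diff cell_sets)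
    also have "prob (sym_diff A B) = 0" using B(2) by (simp add: ae_eq_set_def null_sets_def measure_def)
    finally have "prob (sym_diff A {x \<in> X. itinerary x n \<in> W}) < \<epsilon>" using W by simp
    then show "\<exists>n W. prob (sym_diff A {x \<in> X. itinerary x n \<in> W}) < \<epsilon>" by (intro exI)
  qed
qed

definition full_words :: "nat \<Rightarrow> nat list set" where
  "full_words n = {w. set w \<subseteq> {1..N} \<and> length w = n}"

lemma finite_full_words: "finite (full_words n)"
  unfolding full_words_def by (intro finite_lists_length_eq) auto

lemma prob_cyl_cell:
  assumes w: "w \<in> full_words n" and A: "A \<in> sets \<mu>"
  shows "prob (cyl w - A) = prob ({x \<in> X. itinerary x n \<in> {w}} - A)"
proof (rule finite_measure_eq_AE)
  show "AE x in \<mu>. (x \<in> cyl w - A) = (x \<in> {x \<in> X. itinerary x n \<in> {w}} - A)"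
    using AE_cyl_itinerary AE_space by eventually_elim (use w in \<open>auto simp: full_words_def space_mu\<close>)
qed (use w A in \<open>auto simp: full_words_def\<close>)

text \<open>Points of a set of which a proportion more than \<open>\<delta>\<close> of their cylinder of order \<open>m\<close> lies outside the set.\<close>
definition bad_density :: "'a set \<Rightarrow> real \<Rightarrow> nat \<Rightarrow> 'a set" where
  "bad_density D \<delta> m = {x \<in> D. prob (cyl (itinerary x m) - D) > \<delta> * prob (cyl (itinerary x m))}"

lemma bad_density_sets[simp]:
  assumes "D \<in> sets \<mu>" shows "bad_density D \<delta> m \<in> sets \<mu>"
proof -
  have "bad_density D \<delta> m = D \<inter> {x \<in> X. itinerary x m \<in> {w. prob (cyl w - D) > \<delta> * prob (cyl w)}}"
    using mu_subset[OF assms] by (auto simp: bad_density_def)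
  then show ?thesis using assms by (simp del: mem_Collect_eq)
qed

text \<open>This convergence in measure replaces the density theorem for cylinders. Let a union of cells
  approximate \<open>D\<close> up to \<open>\<epsilon>\<close>. The bad cells inside the union have total measure at most \<open>\<epsilon> / \<delta>\<close>, because
  each has more than \<open>\<delta>\<close> times its measure outside \<open>D\<close>; the bad points outside the union are among the
  \<open>\<epsilon>\<close> of \<open>D\<close> that was missed.\<close>
lemma bad_density_tendsto:
  assumes D: "D \<in> sets \<mu>" and \<delta>: "0 < \<delta>"
  shows "(\<lambda>m. prob (bad_density D \<delta> m)) \<longlonglongrightarrow> 0"
proof (rule LIMSEQ_I)
  fix r :: real assume r: "0 < r"
  (* the bound will be \<epsilon> + \<epsilon> / \<delta> *)
  define \<epsilon> where "\<epsilon> = r / (1 + 1 / \<delta>)"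
  have d: "0 < 1 + 1 / \<delta>" using \<delta> by (simp add: add_pos_pos)
  have "\<epsilon> + \<epsilon> / \<delta> = \<epsilon> * (1 + 1 / \<delta>)" by (simp add: algebra_simps)
  then have \<epsilon>: "0 < \<epsilon>" "\<epsilon> + \<epsilon> / \<delta> = r" using r d by (simp_all add: \<epsilon>_def)
  obtain n W where W: "prob (sym_diff D {x \<in> X. itinerary x n \<in> W}) < \<epsilon>"
    using approximable_all[OF D] \<epsilon>(1) unfolding approximable_def by blast
  let ?C = "{x \<in> X. itinerary x n \<in> W}"
  have "prob (bad_density D \<delta> m) < r" if m: "n \<le> m" for m
  proof -
    define B where "B = {w \<in> full_words m. take n w \<in> W \<and> prob (cyl w - D) > \<delta> * prob (cyl w)}"
    have finB: "finite B" unfolding B_def using finite_full_words by simp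
    have Bw: "w \<in> full_words m" if "w \<in> B" for w using that by (simp add: B_def)
    have "AE x in \<mu>. x \<in> bad_density D \<delta> m \<longrightarrow> x \<in> (D - ?C) \<union> {x \<in> X. itinerary x m \<in> B}"
      using AE_orbit[OF AE_regular_pt] AE_space
    proof eventually_elim
      case (elim x)
      have "itinerary x m \<in> full_words m" using itinerary_set[OF elim(1)] by (simp add: full_words_def)
      then show ?case using m elim(2) by (auto simp: bad_density_def B_def itinerary_take space_mu)
    qed
    then have "prob (bad_density D \<delta> m) \<le> prob ((D - ?C) \<union> {x \<in> X. itinerary x m \<in> B})"
      using D by (intro finite_measure_mono_AE sets.Un sets.Diff cell_sets)
    also have "\<dots> \<le> prob (D - ?C) + prob {x \<in> X. itinerary x m \<in> B}"
      using D by (intro measure_Un_le sets.Diff cell_sets)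
    also have "prob (D - ?C) \<le> prob (sym_diff D ?C)"
      using D by (intro finite_measure_mono sets.Un sets.Diff cell_sets) auto
    also have "prob {x \<in> X. itinerary x m \<in> B} \<le> (1 / \<delta>) * prob (sym_diff D ?C)"
    proof -
      have dU: "{x \<in> X. itinerary x m \<in> B} = (\<Union>w\<in>B. {x \<in> X. itinerary x m \<in> {w}})" by auto
      have "prob {x \<in> X. itinerary x m \<in> B} = (\<Sum>w\<in>B. prob {x \<in> X. itinerary x m \<in> {w}})"
        unfolding dU using finB by (intro finite_measure_finite_Union) (auto simp: disjoint_family_on_def simp del: singleton_iff)
      also have "\<dots> \<le> (\<Sum>w\<in>B. (1 / \<delta>) * prob ({x \<in> X. itinerary x m \<in> {w}} - D))"
      proof (rule sum_mono)
        fix w assume w: "w \<in> B"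
        have "prob {x \<in> X. itinerary x m \<in> {w}} = prob (cyl w)" using prob_cyl_cell[OF Bw[OF w], of "{}"] by simp
        also have "\<dots> \<le> (1 / \<delta>) * prob (cyl w - D)" using w \<delta> by (simp add: B_def field_simps)
        also have "prob (cyl w - D) = prob ({x \<in> X. itinerary x m \<in> {w}} - D)" using prob_cyl_cell[OF Bw[OF w] D] .
        finally show "prob {x \<in> X. itinerary x m \<in> {w}} \<le> (1 / \<delta>) * prob ({x \<in> X. itinerary x m \<in> {w}} - D)" .
      qed
      also have "\<dots> = (1 / \<delta>) * (\<Sum>w\<in>B. prob ({x \<in> X. itinerary x m \<in> {w}} - D))" by (rule sum_distrib_left[symmetric])
      also have "(\<Sum>w\<in>B. prob ({x \<in> X. itinerary x m \<in> {w}} - D)) = prob (\<Union>w\<in>B. {x \<in> X. itinerary x m \<in> {w}} - D)"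
        using finB D by (intro finite_measure_finite_Union[symmetric]) (auto simp: disjoint_family_on_def simp del: singleton_iff)
      also have "\<dots> \<le> prob (sym_diff D ?C)"
        using D m by (intro finite_measure_mono sets.Un sets.Diff cell_sets) (auto simp: B_def itinerary_take)
      finally show ?thesis using \<delta> by (simp add: divide_right_mono)
    qed
    finally have "prob (bad_density D \<delta> m) \<le> prob (sym_diff D ?C) + (1 / \<delta>) * prob (sym_diff D ?C)" by simp
    also have "\<dots> < \<epsilon> + (1 / \<delta>) * \<epsilon>" using W \<delta> by (intro add_strict_mono mult_strict_left_mono) auto
    finally show ?thesis using \<epsilon>(2) by simp
  qed
  then show "\<exists>no. \<forall>n\<ge>no. norm (prob (bad_density D \<delta> n) - 0) < r" by (intro exI[of _ n]) auto
qed

end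

section \<open>Levels of the Hofbauer tower\<close>

lemma suminf_swap_ennreal:
  fixes f :: "nat \<Rightarrow> nat \<Rightarrow> ennreal"
  shows "(\<Sum>i. \<Sum>j. f i j) = (\<Sum>j. \<Sum>i. f i j)"
proof -
  have "(\<Sum>i. \<Sum>j. f i j) = (\<integral>\<^sup>+i. (\<Sum>j. f i j) \<partial>count_space UNIV)" by (simp add: nn_integral_count_space_nat)
  also have "\<dots> = (\<Sum>j. \<integral>\<^sup>+i. f i j \<partial>count_space UNIV)" by (intro nn_integral_suminf) auto
  finally show ?thesis by (simp add: nn_integral_count_space_nat)
qed

definition slice :: "('a \<times> nat) set \<Rightarrow> nat \<Rightarrow> 'a set" where
  "slice A u = {x. (x, u) \<in> A}"

lemma slice_iff[simp]: "x \<in> slice A u \<longleftrightarrow> (x, u) \<in> A" by (simp add: slice_def)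

locale hofbauer_tower = piecewise_system X \<mu> N Z T s
  for X :: "'a::euclidean_space set" and \<mu> N Z T s +
  fixes \<alpha> :: "nat set" and D :: "nat \<Rightarrow> 'a set"
  assumes enum: "tower_enumeration \<mu> N Z T \<alpha> D"
begin

abbreviation tw where "tw \<equiv> tower \<alpha> D"
abbreviation tm where "tm \<equiv> tower_measure \<mu> \<alpha> D"
abbreviation That where "That \<equiv> tower_map \<mu> N Z T \<alpha> D"
abbreviation nxt where "nxt \<equiv> tower_next \<mu> N Z T \<alpha> D"
abbreviation arr where "arr \<equiv> arrow \<mu> N Z T D"

lemma zero_notin: "0 \<notin> \<alpha>" using enum by (simp add: tower_enumeration_def)
lemma base_in: "{1..N} \<subseteq> \<alpha>" using enum by (simp add: tower_enumeration_def)
lemma base_D: "u \<in> {1..N} \<Longrightarrow> D u = Z u" using enum by (auto simp: tower_enumeration_def)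
lemma D_unique: "u \<in> \<alpha> \<Longrightarrow> v \<in> \<alpha> \<Longrightarrow> ae_eq_set \<mu> (D u) (D v) \<Longrightarrow> u = v"
  using enum unfolding tower_enumeration_def by blast

lemma D_cyl:
  assumes "u \<in> \<alpha>"
  obtains w where "w \<in> words N" "D u = closure ((T ^^ (length w - 1)) ` cyl w)" "emeasure \<mu> (cyl w) > 0"
proof -
  have "D u \<in> tower_sets \<mu> N Z T" using enum assms by (auto simp: tower_enumeration_def)
  then show thesis using that unfolding tower_sets_def space_mu by blast
qed

lemma D_closed: assumes "u \<in> \<alpha>" shows "closed (D u)" "D u \<subseteq> X"
proof -
  from D_cyl[OF assms] obtain w where w: "D u = closure ((T ^^ (length w - 1)) ` cyl w)" by metis
  then show "closed (D u)" by simp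
  have "(T ^^ (length w - 1)) ` cyl w \<subseteq> X" using Tn_X by (auto simp: cylinder_def)
  then show "D u \<subseteq> X" unfolding w using compact_imp_closed[OF compact_X] by (rule closure_minimal)
qed

lemma D_sets[simp]: "u \<in> \<alpha> \<Longrightarrow> D u \<in> sets \<mu>" using D_closed closed_sets by blast

text \<open>Every level is the closure of an image of a cylinder that ends in some piece, and pieces are closed,
  so a level lies in a single piece.\<close>
definition branch_of :: "nat \<Rightarrow> nat" where "branch_of u = (SOME k. k \<in> {1..N} \<and> D u \<subseteq> Z k)"

lemma branch_of: assumes u: "u \<in> \<alpha>" shows "branch_of u \<in> {1..N}" "D u \<subseteq> Z (branch_of u)"
proof -
  from D_cyl[OF u] obtain w where w: "w \<in> words N" "D u = closure ((T ^^ (length w - 1)) ` cyl w)" by metis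
  let ?k = "w ! (length w - 1)"
  have l: "length w - 1 < length w" using w(1) by (cases w) (auto simp: words_def)
  then have k: "?k \<in> {1..N}" using w(1) nth_mem[OF l] by (auto simp: words_def simp del: atLeastAtMost_iff)
  have "(T ^^ (length w - 1)) ` cyl w \<subseteq> Z ?k" using l by (auto simp: cylinder_def)
  then have "D u \<subseteq> Z ?k" unfolding w(2) using Z_closed[OF k] by (intro closure_minimal) auto
  with k have "branch_of u \<in> {1..N} \<and> D u \<subseteq> Z (branch_of u)" unfolding branch_of_def by (rule_tac someI) blast
  then show "branch_of u \<in> {1..N}" "D u \<subseteq> Z (branch_of u)" by auto
qed

text \<open>Branches do not decrease measure since the slopes are at least \<open>1\<close>.\<close>
lemma D_pos: assumes u: "u \<in> \<alpha>" shows "emeasure \<mu> (D u) > 0"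
proof -
  from D_cyl[OF u] obtain w where w: "w \<in> words N" "D u = closure ((T ^^ (length w - 1)) ` cyl w)" "emeasure \<mu> (cyl w) > 0" by metis
  have ws: "set w \<subseteq> {1..N}" using w by (simp add: words_def)
  note sc = scale_cyl[OF cyl_sets[OF ws] subset_refl ws diff_le_self[of "length w" 1]]
  have "1 \<le> (\<Prod>i<length w - 1. s (w ! i))" by (rule scale_pos[OF ws diff_le_self])
  then have "emeasure \<mu> ((T ^^ (length w - 1)) ` cyl w) > 0"
    unfolding sc(2) using w(3) by (simp add: ennreal_zero_less_mult_iff)
  also have "emeasure \<mu> ((T ^^ (length w - 1)) ` cyl w) \<le> emeasure \<mu> (D u)"
    using D_sets[OF u] unfolding w(2) by (intro emeasure_mono closure_subset)
  finally show ?thesis .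
qed

lemma Z_D_zero: assumes "u \<in> \<alpha>" "k \<in> {1..N}" "k \<noteq> branch_of u" shows "emeasure \<mu> (Z k \<inter> D u) = 0"
proof -
  have "emeasure \<mu> (Z k \<inter> D u) \<le> emeasure \<mu> (Z k \<inter> Z (branch_of u))"
    using branch_of[OF assms(1)] assms(2) by (intro emeasure_mono sets.Int Z_sets) auto
  then show ?thesis using Z_overlap[OF assms(2) branch_of(1)[OF assms(1)] assms(3)] by simp
qed

lemma branch_of_unique: assumes "u \<in> \<alpha>" "k \<in> {1..N}" "D u \<subseteq> Z k" shows "k = branch_of u"
proof (rule ccontr)
  assume "k \<noteq> branch_of u"
  from Z_D_zero[OF assms(1,2) this] have "emeasure \<mu> (D u) = 0" using assms(3) by (simp add: Int_absorb1)
  then show False using D_pos[OF assms(1)] by simp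
qed

definition slope :: "nat \<Rightarrow> real" where "slope u = s (branch_of u)"
lemma slope_ge: "u \<in> \<alpha> \<Longrightarrow> 1 \<le> slope u" using c4_ge branch_of by (auto simp: slope_def)

lemma TD_sets[simp]: "u \<in> \<alpha> \<Longrightarrow> T ` D u \<in> sets \<mu>" by (simp add: c2_image)

lemma TD_emeasure: "u \<in> \<alpha> \<Longrightarrow> emeasure \<mu> (T ` D u) = ennreal (slope u) * emeasure \<mu> (D u)"
  unfolding slope_def by (rule c4) (use branch_of in auto)

text \<open>The piece that cuts out the target of an edge is the one that contains the target, since different pieces overlap in null sets.\<close>
lemma edge_target:
  assumes "u \<in> \<alpha>" "v \<in> \<alpha>" "j \<in> {1..N}" "tower_edge \<mu> Z T D u j v" shows "j = branch_of v"
proof (rule ccontr)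
  assume "j \<noteq> branch_of v"
  then have 0: "emeasure \<mu> (Z j \<inter> D v) = 0" using Z_D_zero[OF assms(2,3)] by simp
  have "sym_diff (D v) (Z j \<inter> T ` D u) \<in> null_sets \<mu>"
    using assms(4) by (simp add: tower_edge_def ae_eq_set_def)
  moreover have "D v - Z j \<in> sets \<mu>" using assms by (intro sets.Diff D_sets Z_sets)
  moreover have "D v - Z j \<subseteq> sym_diff (D v) (Z j \<inter> T ` D u)" by blast
  ultimately have "D v - Z j \<in> null_sets \<mu>" by (rule null_sets_subset)
  moreover have "Z j \<inter> D v \<in> null_sets \<mu>" using 0 assms by (intro null_setsI sets.Int Z_sets D_sets)
  ultimately have "(D v - Z j) \<union> (Z j \<inter> D v) \<in> null_sets \<mu>" by (rule null_sets.Un)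
  moreover have "(D v - Z j) \<union> (Z j \<inter> D v) = D v" by auto
  ultimately show False using D_pos[OF assms(2)] by auto
qed

lemma arr_iff: "u \<in> \<alpha> \<Longrightarrow> v \<in> \<alpha> \<Longrightarrow> arr u v \<longleftrightarrow> tower_edge \<mu> Z T D u (branch_of v) v"
  unfolding arrow_def using edge_target branch_of by metis

lemma arr_null:
  assumes "u \<in> \<alpha>" "v \<in> \<alpha>" "arr u v" shows "sym_diff (D v) (Z (branch_of v) \<inter> T ` D u) \<in> null_sets \<mu>"
  using assms by (simp add: arr_iff tower_edge_def ae_eq_set_def)

lemma AE_arr:
  assumes "u \<in> \<alpha>" "v \<in> \<alpha>" "arr u v" shows "AE x in \<mu>. x \<in> D v \<longleftrightarrow> x \<in> Z (branch_of v) \<and> x \<in> T ` D u"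
  using AE_not_in[OF arr_null[OF assms]] by eventually_elim auto

text \<open>Levels are listed once modulo null sets, so an edge has at most one target and the definite description in the tower map is harmless.\<close>
lemma nxt_iff:
  assumes v: "v \<in> \<alpha>"
  shows "nxt u j = v \<longleftrightarrow> u \<in> \<alpha> \<and> j \<in> {1..N} \<and> tower_edge \<mu> Z T D u j v"
proof -
  have uniq: "v = v'" if "u \<in> \<alpha>" "v \<in> \<alpha>" "v' \<in> \<alpha>" "j \<in> {1..N}" "tower_edge \<mu> Z T D u j v" "tower_edge \<mu> Z T D u j v'" for v v'
  proof (rule D_unique)
    have "sym_diff (D v) (Z j \<inter> T ` D u) \<in> null_sets \<mu>" "sym_diff (D v') (Z j \<inter> T ` D u) \<in> null_sets \<mu>"
      using that(5,6) unfolding tower_edge_def ae_eq_set_def by blast+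
    then have "sym_diff (D v) (Z j \<inter> T ` D u) \<union> sym_diff (D v') (Z j \<inter> T ` D u) \<in> null_sets \<mu>"
      by (rule null_sets.Un)
    moreover have "sym_diff (D v) (D v') \<in> sets \<mu>" using that(2,3) by (intro sets.Un sets.Diff D_sets)
    moreover have "sym_diff (D v) (D v') \<subseteq> sym_diff (D v) (Z j \<inter> T ` D u) \<union> sym_diff (D v') (Z j \<inter> T ` D u)" by blast
    ultimately show "ae_eq_set \<mu> (D v) (D v')" unfolding ae_eq_set_def by (rule null_sets_subset)
  qed (rule that(2), rule that(3))
  show ?thesis
  proof (cases "u \<in> \<alpha> \<and> j \<in> {1..N} \<and> (\<exists>v \<in> \<alpha>. tower_edge \<mu> Z T D u j v)")
    case True
    then have ex: "\<exists>!v. v \<in> \<alpha> \<and> tower_edge \<mu> Z T D u j v" using uniq by blast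
    have eq: "nxt u j = (THE v. v \<in> \<alpha> \<and> tower_edge \<mu> Z T D u j v)" using True by (simp add: tower_next_def)
    show ?thesis
      using theI'[OF ex] the1_equality[OF ex, of v] True v unfolding eq by blast
  next
    case False
    then have "nxt u j = 0" unfolding tower_next_def by (rule if_not_P)
    then show ?thesis using False v zero_notin by metis
  qed
qed

lemma nxt_range: "nxt u j \<in> \<alpha> \<or> nxt u j = 0"
proof (cases "u \<in> \<alpha> \<and> j \<in> {1..N} \<and> (\<exists>v \<in> \<alpha>. tower_edge \<mu> Z T D u j v)")
  case True
  then obtain v where "v \<in> \<alpha>" "tower_edge \<mu> Z T D u j v" by blast
  then have "nxt u j = v" using True nxt_iff by blast
  then show ?thesis using \<open>v \<in> \<alpha>\<close> by simp
next
  case False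
  then have "nxt u j = 0" unfolding tower_next_def by (rule if_not_P)
  then show ?thesis by simp
qed

text \<open>At such points one step of the tower map follows the arrows exactly, without exceptional null sets.\<close>
definition good_step :: "'a \<Rightarrow> bool" where
  "good_step x \<longleftrightarrow> (\<forall>u\<in>\<alpha>. x \<in> D u \<longrightarrow> (\<forall>v\<in>\<alpha>. nxt u (bi (T x)) = v \<longleftrightarrow> arr u v \<and> T x \<in> D v))"

lemma AE_good_step: "AE x in \<mu>. good_step x"
proof -
  have "AE y in \<mu>. \<forall>u\<in>\<alpha>. \<forall>v\<in>\<alpha>. arr u v \<longrightarrow> (y \<in> D v \<longleftrightarrow> y \<in> Z (branch_of v) \<and> y \<in> T ` D u)"
    by (intro AE_ball_countable[THEN iffD2] ballI) (auto intro: AE_impI AE_arr)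
  from AE_T[OF this] AE_T[OF AE_regular_pt] show ?thesis
  proof eventually_elim
    case (elim x)
    show ?case unfolding good_step_def
    proof (intro ballI impI)
      fix u v assume u: "u \<in> \<alpha>" "x \<in> D u" and v: "v \<in> \<alpha>"
      have Tx: "T x \<in> T ` D u" using u by simp
      show "nxt u (bi (T x)) = v \<longleftrightarrow> arr u v \<and> T x \<in> D v"
      proof
        assume "nxt u (bi (T x)) = v"
        then have e: "bi (T x) \<in> {1..N}" "tower_edge \<mu> Z T D u (bi (T x)) v" using nxt_iff[OF v] by blast+
        then have k: "bi (T x) = branch_of v" using edge_target u v by blast
        then have a: "arr u v" using e arr_iff u v by simp
        have "T x \<in> Z (branch_of v)" using regular_bi[OF elim(2)] k by simp
        then show "arr u v \<and> T x \<in> D v" using a elim(1) u v Tx by blast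
      next
        assume a: "arr u v \<and> T x \<in> D v"
        then have "T x \<in> Z (branch_of v)" using branch_of[OF v] by blast
        then have "bi (T x) = branch_of v" using regular_in_Z[OF elim(2) branch_of(1)[OF v]] by simp
        moreover have "tower_edge \<mu> Z T D u (branch_of v) v" using a arr_iff u v by simp
        ultimately show "nxt u (bi (T x)) = v" using nxt_iff[OF v] u branch_of(1)[OF v] by simp
      qed
    qed
  qed
qed

section \<open>The measure on the tower\<close>

lemma slice_tw: "slice tw u = (if u \<in> \<alpha> then D u else {})" by (auto simp: tower_def)
lemma slice_subset: "A \<subseteq> tw \<Longrightarrow> u \<in> \<alpha> \<Longrightarrow> slice A u \<subseteq> D u" by (auto simp: tower_def)
lemma slice_empty: "A \<subseteq> tw \<Longrightarrow> u \<notin> \<alpha> \<Longrightarrow> slice A u = {}" by (auto simp: tower_def)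

abbreviation (input) gens where "gens \<equiv> level D ` \<alpha> \<union> (\<lambda>B. fst -` B \<inter> tw) ` sets \<mu>"

lemma gens_Pow: "gens \<subseteq> Pow tw" by (auto simp: level_def tower_def)

lemma space_tm: "space tm = tw" unfolding tower_measure_def using gens_Pow by (rule space_measure_of)

text \<open>There are countably many levels, so a set is measurable if and only if it is so on each level.\<close>
lemma sets_tm_iff: "A \<in> sets tm \<longleftrightarrow> A \<subseteq> tw \<and> (\<forall>u. slice A u \<in> sets \<mu>)"
proof -
  have sets: "sets tm = sigma_sets tw gens" unfolding tower_measure_def using gens_Pow by (rule sets_measure_of)
  show ?thesis unfolding sets
  proof
    assume A: "A \<in> sigma_sets tw gens"
    have "A \<subseteq> tw" using sigma_sets_into_sp[OF gens_Pow A] .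
    moreover have "slice A u \<in> sets \<mu>" for u using A
    proof induction
      case (Basic a)
      then consider v where "v \<in> \<alpha>" "a = level D v" | B where "B \<in> sets \<mu>" "a = fst -` B \<inter> tw" by blast
      then show ?case
      proof cases
        case 1
        then have "slice a u = (if u = v then D v else {})" by (auto simp: level_def)
        then show ?thesis using 1 by simp
      next
        case 2
        then have "slice a u = B \<inter> slice tw u" by auto
        moreover have "B \<inter> slice tw u \<in> sets \<mu>" using 2 by (simp add: slice_tw sets.Int)
        ultimately show ?thesis by simp
      qed
    next
      case Empty then show ?case by (simp add: slice_def)
    next
      case (Compl a)
      have "slice (tw - a) u = slice tw u - slice a u" by auto
      moreover have "slice tw u \<in> sets \<mu>" by (simp add: slice_tw)
      ultimately show ?case using Compl.IH by (simp add: sets.Diff)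
    next
      case (Union a)
      have "slice (\<Union> (range a)) u = (\<Union>i. slice (a i) u)" by auto
      then show ?case using Union by simp
    qed
    ultimately show "A \<subseteq> tw \<and> (\<forall>u. slice A u \<in> sets \<mu>)" by blast
  next
    assume A: "A \<subseteq> tw \<and> (\<forall>u. slice A u \<in> sets \<mu>)"
    have fin: "(\<Union>u\<in>\<alpha>. (fst -` (slice A u) \<inter> tw) \<inter> level D u) = A"
      using A by (auto simp: level_def tower_def)
    have gl: "level D u \<in> gens" if "u \<in> \<alpha>" for u using that by blast
    have gf: "fst -` (slice A u) \<inter> tw \<in> gens" for u using A by blast
    interpret S: sigma_algebra tw "sigma_sets tw gens" by (rule sigma_algebra_sigma_sets[OF gens_Pow])
    have "(\<Union>u\<in>\<alpha>. (fst -` (slice A u) \<inter> tw) \<inter> level D u) \<in> sigma_sets tw gens"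
    proof (rule S.countable_UN'')
      fix u assume "u \<in> \<alpha>"
      then show "(fst -` (slice A u) \<inter> tw) \<inter> level D u \<in> sigma_sets tw gens"
        by (intro S.Int sigma_sets.Basic gl gf)
    qed (rule countable_subset[OF subset_UNIV], rule countableI_type)
    then show "A \<in> sigma_sets tw gens" unfolding fin .
  qed
qed

lemma slice_sets[simp]: "A \<in> sets tm \<Longrightarrow> slice A u \<in> sets \<mu>" by (simp add: sets_tm_iff)

lemma tm_subset: "A \<in> sets tm \<Longrightarrow> A \<subseteq> tw" by (simp add: sets_tm_iff)

lemma tw_sets[simp]: "tw \<in> sets tm" using sets.top[of tm] by (simp add: space_tm)

lemma emeasure_tm: assumes A: "A \<in> sets tm" shows "emeasure tm A = (\<Sum>u. emeasure \<mu> (slice A u))"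
proof -
  let ?f = "\<lambda>A. \<integral>\<^sup>+u. emeasure \<mu> (fst ` (A \<inter> level D u)) \<partial>count_space \<alpha>"
  have f: "?f A = (\<Sum>u. emeasure \<mu> (slice A u))" if "A \<subseteq> tw" for A
  proof -
    have "?f A = (\<integral>\<^sup>+u. emeasure \<mu> (slice A u) \<partial>count_space \<alpha>)"
    proof (intro nn_integral_cong)
      fix u assume "u \<in> space (count_space \<alpha>)"
      have "fst ` (A \<inter> level D u) = slice A u" using that by (force simp: level_def tower_def)
      then show "emeasure \<mu> (fst ` (A \<inter> level D u)) = emeasure \<mu> (slice A u)" by simp
    qed
    also have "\<dots> = (\<integral>\<^sup>+u. emeasure \<mu> (slice A u) * indicator \<alpha> u \<partial>count_space UNIV)"
      by (rule nn_integral_count_space_indicator) simp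
    also have "\<dots> = (\<integral>\<^sup>+u. emeasure \<mu> (slice A u) \<partial>count_space UNIV)"
      by (intro nn_integral_cong) (auto simp: slice_empty[OF that] split: split_indicator)
    finally show ?thesis by (simp add: nn_integral_count_space_nat)
  qed
  have "emeasure tm A = ?f A"
  proof (rule emeasure_measure_of[OF tower_measure_def gens_Pow])
    show "positive (sets tm) ?f" by (simp add: positive_def)
    show "countably_additive (sets tm) ?f"
    proof (rule countably_additiveI)
      fix A :: "nat \<Rightarrow> ('a \<times> nat) set"
      assume A: "range A \<subseteq> sets tm" "disjoint_family A" "\<Union> (range A) \<in> sets tm"
      have Ai: "A i \<in> sets tm" for i using A by auto
      have "(\<Sum>i. ?f (A i)) = (\<Sum>i. \<Sum>u. emeasure \<mu> (slice (A i) u))" using f[OF tm_subset[OF Ai]] by simp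
      also have "\<dots> = (\<Sum>u. \<Sum>i. emeasure \<mu> (slice (A i) u))" by (rule suminf_swap_ennreal)
      also have "\<dots> = (\<Sum>u. emeasure \<mu> (slice (\<Union> (range A)) u))"
      proof (intro suminf_cong)
        fix u
        have "slice (\<Union> (range A)) u = (\<Union>i. slice (A i) u)" by auto
        moreover have "disjoint_family (\<lambda>i. slice (A i) u)" using A(2) by (fastforce simp: disjoint_family_on_def)
        ultimately show "(\<Sum>i. emeasure \<mu> (slice (A i) u)) = emeasure \<mu> (slice (\<Union> (range A)) u)"
          using Ai by (simp add: suminf_emeasure subset_eq image_iff)
      qed
      also have "\<dots> = ?f (\<Union> (range A))" using f[OF tm_subset[OF A(3)]] by simp
      finally show "(\<Sum>i. ?f (A i)) = ?f (\<Union> (range A))" .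
    qed
  qed (rule A)
  then show ?thesis using f[OF tm_subset[OF A]] by simp
qed

lemma level_sets[simp]: "u \<in> \<alpha> \<Longrightarrow> level D u \<in> sets tm"
proof -
  assume u: "u \<in> \<alpha>"
  have "slice (level D u) v = (if v = u then D u else {})" for v by (auto simp: level_def)
  then show ?thesis using u by (auto simp: sets_tm_iff level_def tower_def)
qed

lemma slice_prod: "slice (A \<times> {u}) v = (if v = u then A else {})" by auto

lemma prod_sets: "u \<in> \<alpha> \<Longrightarrow> A \<in> sets \<mu> \<Longrightarrow> A \<subseteq> D u \<Longrightarrow> A \<times> {u} \<in> sets tm"
  by (auto simp: sets_tm_iff slice_prod tower_def)

lemma fst_vimage_sets: "B \<in> sets \<mu> \<Longrightarrow> fst -` B \<inter> tw \<in> sets tm"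
proof -
  assume B: "B \<in> sets \<mu>"
  have "slice (fst -` B \<inter> tw) u = B \<inter> slice tw u" for u by auto
  then show ?thesis using B by (auto simp: sets_tm_iff slice_tw)
qed

lemma fst_meas[measurable]: "fst \<in> measurable tm \<mu>"
proof (rule measurableI)
  fix z assume "z \<in> space tm"
  then have "fst z \<in> D (snd z)" "snd z \<in> \<alpha>" by (auto simp: space_tm tower_def)
  then show "fst z \<in> space \<mu>" using D_closed(2) by (auto simp: space_mu)
qed (simp add: space_tm fst_vimage_sets)

lemma snd_meas[measurable]: "snd \<in> measurable tm (count_space UNIV)"
proof -
  have "{z \<in> space tm. snd z = u} \<in> sets tm" for u
  proof -
    have "{z \<in> space tm. snd z = u} = (if u \<in> \<alpha> then level D u else {})"
      by (auto simp: space_tm tower_def level_def)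
    then show ?thesis by simp
  qed
  then show ?thesis
    by (subst measurable_count_space_eq2_countable) (auto simp: vimage_def Int_def conj_commute)
qed

text \<open>Measures with a constant density on every level: all measures on the tower that occur in the construction of the lift have this form.\<close>
definition weighted :: "(nat \<Rightarrow> ennreal) \<Rightarrow> ('a \<times> nat) measure" where
  "weighted c = density tm (\<lambda>z. c (snd z))"

lemma sets_weighted[simp]: "sets (weighted c) = sets tm" and space_weighted: "space (weighted c) = tw"
  by (simp_all add: weighted_def space_tm)

lemma weight_meas[measurable]: "(\<lambda>z. c (snd z) :: ennreal) \<in> borel_measurable tm"
  by (rule measurable_compose[OF snd_meas]) simp

lemma emb_meas: "u \<in> \<alpha> \<Longrightarrow> (\<lambda>x. (x, u)) \<in> measurable (restrict_space \<mu> (D u)) tm"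
proof (rule measurableI)
  fix A assume u: "u \<in> \<alpha>" and A: "A \<in> sets tm"
  have "(\<lambda>x. (x, u)) -` A \<inter> space (restrict_space \<mu> (D u)) = slice A u"
    using slice_subset[OF tm_subset[OF A] u] D_closed[OF u] by (auto simp: space_restrict_space space_mu slice_def)
  then show "(\<lambda>x. (x, u)) -` A \<inter> space (restrict_space \<mu> (D u)) \<in> sets (restrict_space \<mu> (D u))"
    using A slice_subset[OF tm_subset[OF A] u] u by (auto simp: sets_restrict_space_iff)
qed (auto simp: space_restrict_space space_tm tower_def)

lemma level_density_distr:
  assumes u: "u \<in> \<alpha>"
  shows "density tm (indicator (level D u)) = distr (restrict_space \<mu> (D u)) tm (\<lambda>x. (x, u))" (is "?L = ?R")
proof (rule measure_eqI)
  fix A assume "A \<in> sets ?L"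
  then have A: "A \<in> sets tm" by simp
  have "emeasure ?L A = emeasure tm (A \<inter> level D u)"
    using A level_sets[OF u] by (subst emeasure_density)
      (simp_all add: indicator_inter_arith[symmetric] Int_commute nn_integral_indicator[OF sets.Int])
  also have "\<dots> = (\<Sum>v. emeasure \<mu> (slice (A \<inter> level D u) v))" using A u by (intro emeasure_tm sets.Int) auto
  also have "\<dots> = (\<Sum>v. if v = u then emeasure \<mu> (slice A u) else 0)"
  proof (intro suminf_cong)
    fix v
    have "slice (A \<inter> level D u) v = (if v = u then slice A u else {})"
      using slice_subset[OF tm_subset[OF A] u] by (auto simp: level_def subset_iff)
    then show "emeasure \<mu> (slice (A \<inter> level D u) v) = (if v = u then emeasure \<mu> (slice A u) else 0)" by simp
  qed
  also have "\<dots> = emeasure \<mu> (slice A u)" by (subst suminf_finite[of "{u}"]) auto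
  also have "\<dots> = emeasure ?R A"
  proof -
    have "(\<lambda>x. (x, u)) -` A \<inter> space (restrict_space \<mu> (D u)) = slice A u"
      using slice_subset[OF tm_subset[OF A] u] D_closed[OF u] by (auto simp: space_restrict_space space_mu slice_def)
    then show ?thesis using A u slice_subset[OF tm_subset[OF A] u]
      by (simp add: emeasure_distr emb_meas emeasure_restrict_space)
  qed
  finally show "emeasure ?L A = emeasure ?R A" .
qed simp

lemma nn_integral_level:
  assumes u: "u \<in> \<alpha>" and f: "f \<in> borel_measurable tm"
  shows "(\<integral>\<^sup>+z. f z * indicator (level D u) z \<partial>tm) = (\<integral>\<^sup>+x. f (x, u) * indicator (D u) x \<partial>\<mu>)"
proof -
  have "(\<integral>\<^sup>+z. f z * indicator (level D u) z \<partial>tm) = (\<integral>\<^sup>+z. f z \<partial>density tm (indicator (level D u)))"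
    using f level_sets[OF u] by (subst nn_integral_density) (simp_all add: mult.commute)
  also have "\<dots> = (\<integral>\<^sup>+x. f (x, u) \<partial>restrict_space \<mu> (D u))"
    unfolding level_density_distr[OF u] using f emb_meas[OF u] by (subst nn_integral_distr) auto
  also have "\<dots> = (\<integral>\<^sup>+x. f (x, u) * indicator (D u) x \<partial>\<mu>)"
    using u by (subst nn_integral_restrict_space) auto
  finally show ?thesis .
qed

text \<open>The tower measure restricted to a level is the image of the restriction of \<open>\<mu>\<close>.\<close>
lemma nn_integral_tm:
  assumes f: "f \<in> borel_measurable tm"
  shows "(\<integral>\<^sup>+z. f z \<partial>tm) = (\<Sum>u. if u \<in> \<alpha> then \<integral>\<^sup>+x. f (x, u) * indicator (D u) x \<partial>\<mu> else 0)"
proof -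
  let ?g = "\<lambda>u z. if u \<in> \<alpha> then f z * indicator (level D u) z else 0"
  have "(\<integral>\<^sup>+z. f z \<partial>tm) = (\<integral>\<^sup>+z. (\<Sum>u. ?g u z) \<partial>tm)"
  proof (intro nn_integral_cong)
    fix z assume "z \<in> space tm"
    then have z: "snd z \<in> \<alpha>" "z \<in> level D (snd z)" by (auto simp: space_tm tower_def level_def)
    have "(\<Sum>u. ?g u z) = (\<Sum>u\<in>{snd z}. ?g u z)"
      by (rule suminf_finite) (auto simp: level_def indicator_def mem_Times_iff)
    then show "f z = (\<Sum>u. ?g u z)" using z by simp
  qed
  also have "\<dots> = (\<Sum>u. \<integral>\<^sup>+z. ?g u z \<partial>tm)"
  proof (intro nn_integral_suminf)
    fix u show "?g u \<in> borel_measurable tm" using f by (cases "u \<in> \<alpha>") (simp_all del: level_sets add: borel_measurable_times_ennreal borel_measurable_indicator[OF level_sets])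
  qed
  also have "\<dots> = (\<Sum>u. if u \<in> \<alpha> then \<integral>\<^sup>+x. f (x, u) * indicator (D u) x \<partial>\<mu> else 0)"
    using nn_integral_level[OF _ f] by (intro suminf_cong) simp
  finally show ?thesis .
qed

lemma emeasure_weighted: assumes A: "A \<in> sets tm" shows "emeasure (weighted c) A = (\<Sum>u. c u * emeasure \<mu> (slice A u))"
proof -
  have "emeasure (weighted c) A = (\<integral>\<^sup>+z. c (snd z) * indicator A z \<partial>tm)"
    using A unfolding weighted_def by (subst emeasure_density) auto
  also have "\<dots> = (\<Sum>u. if u \<in> \<alpha> then \<integral>\<^sup>+x. c u * indicator A (x, u) * indicator (D u) x \<partial>\<mu> else 0)"
    using A by (subst nn_integral_tm) (auto cong: if_cong)
  also have "\<dots> = (\<Sum>u. c u * emeasure \<mu> (slice A u))"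
  proof (intro suminf_cong)
    fix u
    show "(if u \<in> \<alpha> then \<integral>\<^sup>+x. c u * indicator A (x, u) * indicator (D u) x \<partial>\<mu> else 0) = c u * emeasure \<mu> (slice A u)"
    proof (cases "u \<in> \<alpha>")
      case True
      have "(\<integral>\<^sup>+x. c u * indicator A (x, u) * indicator (D u) x \<partial>\<mu>) = (\<integral>\<^sup>+x. c u * indicator (slice A u) x \<partial>\<mu>)"
        using slice_subset[OF tm_subset[OF A] True] by (intro nn_integral_cong) (auto split: split_indicator)
      also have "\<dots> = c u * emeasure \<mu> (slice A u)" using A by (intro nn_integral_cmult_indicator) simp
      finally show ?thesis using True by simp
    qed (simp add: slice_empty[OF tm_subset[OF A]])
  qed
  finally show ?thesis .
qed

lemma AE_weighted: assumes "AE x in \<mu>. Q x" shows "AE z in weighted c. Q (fst z)"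
proof -
  obtain N where N: "{x \<in> space \<mu>. \<not> Q x} \<subseteq> N" "N \<in> sets \<mu>" "emeasure \<mu> N = 0" using AE_E[OF assms] .
  have z: "emeasure \<mu> (slice (fst -` N \<inter> tw) u) = 0" for u
  proof -
    have "slice (fst -` N \<inter> tw) u \<subseteq> N" by auto
    from emeasure_mono[OF this N(2)] N(3) show ?thesis by simp
  qed
  have "emeasure (weighted c) (fst -` N \<inter> tw) = 0"
    using fst_vimage_sets[OF N(2)] by (simp add: emeasure_weighted z)
  then have "fst -` N \<inter> tw \<in> null_sets (weighted c)" using fst_vimage_sets[OF N(2)] by (intro null_setsI) auto
  then show ?thesis
    by (rule AE_I') (use N(1) D_closed(2) in \<open>auto simp: space_weighted space_mu tower_def\<close>, blast)
qed

end

section \<open>Transport of weights along arrows\<close>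

context hofbauer_tower begin

lemma That_simp: "That (x, u) = (T x, nxt u (bi (T x)))"
  by (simp add: tower_map_def)

definition level_at :: "nat \<Rightarrow> nat \<Rightarrow> 'a \<Rightarrow> nat" where "level_at n u x = snd ((That ^^ n) (x, u))"

lemma level_at_0[simp]: "level_at 0 u x = u" by (simp add: level_at_def)

lemma fst_That: "fst ((That ^^ n) z) = (T ^^ n) (fst z)"
proof (induction n)
  case (Suc n) then show ?case by (cases "(That ^^ n) z") (auto simp: That_simp)
qed simp

lemma That_pow: "(That ^^ n) (x, u) = ((T ^^ n) x, level_at n u x)"
  by (rule prod_eqI) (simp_all add: fst_That level_at_def)

lemma level_at_Suc: "level_at (Suc n) u x = nxt (level_at n u x) (bi ((T ^^ Suc n) x))"
proof -
  have "(That ^^ Suc n) (x, u) = That ((T ^^ n) x, level_at n u x)" by (simp add: That_pow)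
  then show ?thesis by (simp add: level_at_def That_simp)
qed

lemma level_at_meas[measurable]: "level_at n u \<in> measurable \<mu> (count_space UNIV)"
proof (induction n)
  case (Suc n)
  note [measurable] = Suc
  have "(\<lambda>x. (\<lambda>p. nxt (fst p) (snd p)) (level_at n u x, bi ((T ^^ Suc n) x))) \<in> measurable \<mu> (count_space UNIV)"
    by (rule measurable_compose[where N="count_space UNIV \<Otimes>\<^sub>M count_space UNIV"])
      (auto simp: pair_measure_countable)
  then show ?case by (simp add: level_at_Suc)
qed (simp add: level_at_def)

text \<open>The iterates of the tower map are defined off the tower as well; the preimage collects the points of
  the tower whose \<open>n\<close>-th image lies in \<open>A\<close>, whatever happened in between.\<close>
definition pre_iter :: "nat \<Rightarrow> ('a \<times> nat) set \<Rightarrow> ('a \<times> nat) set" where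
  "pre_iter n A = (That ^^ n) -` A \<inter> tw"

abbreviation pre where "pre A \<equiv> That -` A \<inter> tw"

lemma pre_iter_1: "pre_iter (Suc 0) A = pre A" by (simp add: pre_iter_def)

lemma slice_pre_iter: "slice (pre_iter n A) u = slice tw u \<inter> {x. (T ^^ n) x \<in> slice A (level_at n u x)}"
  by (auto simp: pre_iter_def That_pow)

lemma pre_iter_sets[simp]: assumes A: "A \<in> sets tm" shows "pre_iter n A \<in> sets tm"
  unfolding sets_tm_iff
proof (intro conjI allI)
  show "pre_iter n A \<subseteq> tw" by (auto simp: pre_iter_def)
  fix u
  have [measurable]: "slice A v \<in> sets \<mu>" for v using A by simp
  have m: "{x \<in> space \<mu>. level_at n u x = v \<and> (T ^^ n) x \<in> slice A v} \<in> sets \<mu>" for v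
    by measurable
  have sub: "slice tw u \<subseteq> space \<mu>" using D_closed[of u] by (auto simp: slice_tw space_mu)
  have "slice (pre_iter n A) u = slice tw u \<inter> (\<Union>v. {x \<in> space \<mu>. level_at n u x = v \<and> (T ^^ n) x \<in> slice A v})"
    using sub unfolding slice_pre_iter by auto
  also have "\<dots> \<in> sets \<mu>" using m by (intro sets.Int sets.countable_UN) (auto simp: slice_tw)
  finally show "slice (pre_iter n A) u \<in> sets \<mu>" .
qed

lemma pre_sets[simp]: "A \<in> sets tm \<Longrightarrow> pre A \<in> sets tm"
  using pre_iter_sets[of A "Suc 0"] by (simp add: pre_iter_1)

lemma slice_pre: "u \<in> \<alpha> \<Longrightarrow> slice (pre A) u = {x \<in> D u. (T x, nxt u (bi (T x))) \<in> A}"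
  by (auto simp: That_simp tower_def)

text \<open>The factor by which a unit density on level \<open>u\<close> contributes to the density on level \<open>v\<close>.\<close>
definition edge_weight :: "nat \<Rightarrow> nat \<Rightarrow> ennreal" where
  "edge_weight u v = (if u \<in> \<alpha> \<and> v \<in> \<alpha> \<and> arr u v then ennreal (1 / slope u) else 0)"

text \<open>The target level \<open>D v\<close> is covered by \<open>T ` D u\<close> up to a null set, so the part of \<open>D u\<close> over \<open>D v\<close> is stretched onto all of \<open>D v\<close>.\<close>
lemma edge_emeasure:
  assumes u: "u \<in> \<alpha>" and v: "v \<in> \<alpha>" and a: "arr u v" and B: "B \<in> sets \<mu>" "B \<subseteq> D v"
  shows "emeasure \<mu> (D u \<inter> T -` B) = ennreal (1 / slope u) * emeasure \<mu> B"
proof -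
  have "emeasure \<mu> (D u \<inter> T -` B) = ennreal (1 / slope u) * emeasure \<mu> (T ` D u \<inter> B)"
    unfolding slope_def using branch_of[OF u] by (intro branch_preimage D_sets u B(1))
  moreover have "emeasure \<mu> (T ` D u \<inter> B) = emeasure \<mu> B"
  proof (rule emeasure_eq_AE)
    show "AE x in \<mu>. (x \<in> T ` D u \<inter> B) = (x \<in> B)"
      using AE_arr[OF u v a] by eventually_elim (use B in blast)
  qed (use B u in auto)
  ultimately show ?thesis by simp
qed

lemma step_sets: "u \<in> \<alpha> \<Longrightarrow> B \<in> sets \<mu> \<Longrightarrow> {x \<in> D u. nxt u (bi (T x)) = v \<and> T x \<in> B} \<in> sets \<mu>"
proof -
  assume u: "u \<in> \<alpha>" and [measurable]: "B \<in> sets \<mu>"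
  have [measurable]: "(\<lambda>x. nxt u (bi (T x))) \<in> measurable \<mu> (count_space UNIV)"
    by (rule measurable_compose[OF measurable_compose[OF T_meas bi_meas]]) simp
  have "{x \<in> D u. nxt u (bi (T x)) = v \<and> T x \<in> B} = D u \<inter> {x \<in> space \<mu>. nxt u (bi (T x)) = v \<and> T x \<in> B}"
    using D_closed[OF u] by (auto simp: space_mu)
  moreover have "{x \<in> space \<mu>. nxt u (bi (T x)) = v \<and> T x \<in> B} \<in> sets \<mu>" by measurable
  ultimately show ?thesis using u by (simp add: sets.Int)
qed

lemma step_emeasure:
  assumes u: "u \<in> \<alpha>" and v: "v \<in> \<alpha>" and B: "B \<in> sets \<mu>" "B \<subseteq> D v"
  shows "emeasure \<mu> {x \<in> D u. nxt u (bi (T x)) = v \<and> T x \<in> B} = edge_weight u v * emeasure \<mu> B"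
proof -
  have AE: "AE x in \<mu>. (x \<in> {x \<in> D u. nxt u (bi (T x)) = v \<and> T x \<in> B}) = (x \<in> D u \<and> arr u v \<and> T x \<in> B)"
    using AE_good_step by eventually_elim (use u v B in \<open>auto simp: good_step_def\<close>)
  show ?thesis
  proof (cases "arr u v")
    case True
    have eq: "D u \<inter> T -` B = D u \<inter> (T -` B \<inter> X)" using D_closed[OF u] by auto
    have "D u \<inter> T -` B \<in> sets \<mu>" unfolding eq by (intro sets.Int D_sets u c2_vimage B(1))
    then have "emeasure \<mu> {x \<in> D u. nxt u (bi (T x)) = v \<and> T x \<in> B} = emeasure \<mu> (D u \<inter> T -` B)"
      using AE True step_sets[OF u B(1)] by (intro emeasure_eq_AE) auto
    then show ?thesis using edge_emeasure[OF u v True B] True u v by (simp add: edge_weight_def)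
  next
    case False
    have "AE x in \<mu>. x \<notin> {x \<in> D u. nxt u (bi (T x)) = v \<and> T x \<in> B}"
      using AE by eventually_elim (use False in auto)
    then have "{x \<in> D u. nxt u (bi (T x)) = v \<and> T x \<in> B} \<in> null_sets \<mu>"
      using step_sets[OF u B(1)] by (subst AE_iff_null_sets)
    then show ?thesis using False by (simp add: edge_weight_def null_sets_def)
  qed
qed

lemma emeasure_slice_pre:
  assumes u: "u \<in> \<alpha>" and A: "A \<in> sets tm"
  shows "emeasure \<mu> (slice (pre A) u) = (\<Sum>v. edge_weight u v * emeasure \<mu> (slice A v))"
proof -
  let ?S = "\<lambda>v. {x \<in> D u. nxt u (bi (T x)) = v \<and> T x \<in> slice A v}"
  have "slice (pre A) u = (\<Union>v. ?S v)" unfolding slice_pre[OF u] by auto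
  moreover have "(\<Sum>v. emeasure \<mu> (?S v)) = emeasure \<mu> (\<Union>v. ?S v)"
    using step_sets[OF u slice_sets[OF A]] by (intro suminf_emeasure) (auto simp: disjoint_family_on_def)
  moreover have "emeasure \<mu> (?S v) = edge_weight u v * emeasure \<mu> (slice A v)" for v
  proof (cases "v \<in> \<alpha>")
    case True
    show ?thesis by (rule step_emeasure[OF u True slice_sets[OF A] slice_subset[OF tm_subset[OF A] True]])
  next
    case False
    have "?S v = {}" using slice_empty[OF tm_subset[OF A] False] by blast
    then show ?thesis using False by (simp only: edge_weight_def emeasure_empty) simp
  qed
  ultimately show ?thesis by simp
qed

text \<open>The transfer operator of the tower map, acting on densities that are constant on levels.\<close>
definition push :: "(nat \<Rightarrow> ennreal) \<Rightarrow> nat \<Rightarrow> ennreal" where "push c v = (\<Sum>u. c u * edge_weight u v)"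

text \<open>The heart of the Markov structure: pushing forward a measure with constant densities yields constant densities.\<close>
lemma weighted_pre:
  assumes A: "A \<in> sets tm" shows "emeasure (weighted c) (pre A) = emeasure (weighted (push c)) A"
proof -
  have "emeasure (weighted c) (pre A) = (\<Sum>u. c u * emeasure \<mu> (slice (pre A) u))" using A by (intro emeasure_weighted pre_sets)
  also have "\<dots> = (\<Sum>u. \<Sum>v. c u * edge_weight u v * emeasure \<mu> (slice A v))"
  proof (intro suminf_cong)
    fix u
    show "c u * emeasure \<mu> (slice (pre A) u) = (\<Sum>v. c u * edge_weight u v * emeasure \<mu> (slice A v))"
    proof (cases "u \<in> \<alpha>")
      case True
      show ?thesis by (simp only: emeasure_slice_pre[OF True A] ennreal_suminf_cmult mult.assoc)
    next
      case False
      have "slice (pre A) u = {}" by (rule slice_empty[OF _ False]) auto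
      then show ?thesis using False by (simp add: edge_weight_def)
    qed
  qed
  also have "\<dots> = (\<Sum>v. \<Sum>u. c u * edge_weight u v * emeasure \<mu> (slice A v))" by (rule suminf_swap_ennreal)
  also have "\<dots> = (\<Sum>v. push c v * emeasure \<mu> (slice A v))" by (simp add: push_def ennreal_suminf_multc)
  also have "\<dots> = emeasure (weighted (push c)) A" using A by (rule emeasure_weighted[symmetric])
  finally show ?thesis .
qed

text \<open>An orbit that leaves the tower does so by reaching the index \<open>0\<close>, which is absorbing, up to a null
  set of starting points. Hence preimages may be computed step by step.\<close>
lemma AE_stay: "AE x in \<mu>. \<forall>u n. (x, u) \<in> tw \<longrightarrow> (That ^^ n) (x, u) \<in> tw \<or> level_at n u x = 0"
  using AE_orbit[OF AE_good_step]
proof eventually_elim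
  case (elim x)
  have "(x, u) \<in> tw \<longrightarrow> (That ^^ n) (x, u) \<in> tw \<or> level_at n u x = 0" for u n
  proof (induction n)
    case (Suc n)
    show ?case
    proof
      assume xu: "(x, u) \<in> tw"
      let ?v = "level_at n u x" and ?w = "level_at (Suc n) u x"
      show "(That ^^ Suc n) (x, u) \<in> tw \<or> ?w = 0"
      proof (cases "?w = 0")
        case False
        then have w: "?w \<in> \<alpha>" using nxt_range level_at_Suc by metis
        have e: "nxt ?v (bi (T ((T ^^ n) x))) = ?w" by (simp add: level_at_Suc)
        then have "?v \<in> \<alpha>" using nxt_iff[OF w] by blast
        then have "?v \<noteq> 0" using zero_notin by metis
        then have "((T ^^ n) x, ?v) \<in> tw" using Suc.IH xu by (simp add: That_pow)
        then have "(T ^^ n) x \<in> D ?v" by (simp add: tower_def)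
        then have "T ((T ^^ n) x) \<in> D ?w" using elim e w \<open>?v \<in> \<alpha>\<close> unfolding good_step_def by blast
        then show ?thesis using w unfolding That_pow by (simp add: tower_def)
      qed simp
    qed
  qed simp
  then show ?case by blast
qed

lemma weighted_pre_iter_Suc:
  assumes A: "A \<in> sets tm" shows "emeasure (weighted c) (pre_iter (Suc n) A) = emeasure (weighted c) (pre_iter n (pre A))"
proof (rule emeasure_eq_AE)
  show "AE z in weighted c. (z \<in> pre_iter (Suc n) A) = (z \<in> pre_iter n (pre A))"
    using AE_weighted[OF AE_stay, of c]
  proof eventually_elim
    case (elim z)
    show ?case
    proof
      assume z: "z \<in> pre_iter (Suc n) A"
      obtain x u where xu: "z = (x, u)" by fastforce
      have "(x, u) \<in> tw" using z xu by (simp add: pre_iter_def)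
      moreover have "level_at n u x \<noteq> 0"
      proof
        assume "level_at n u x = 0"
        then have "level_at (Suc n) u x \<notin> \<alpha>" using nxt_iff zero_notin by (metis level_at_Suc)
        moreover have "(That ^^ Suc n) (x, u) \<in> tw" using z xu tm_subset[OF A] by (auto simp: pre_iter_def)
        ultimately show False unfolding That_pow by (simp add: tower_def)
      qed
      ultimately have "(That ^^ n) (x, u) \<in> tw" using elim xu by fastforce
      then show "z \<in> pre_iter n (pre A)" using z xu by (simp add: pre_iter_def)
    qed (auto simp: pre_iter_def)
  qed
qed (use A in auto)

lemma weighted_pre_iter: "A \<in> sets tm \<Longrightarrow> emeasure (weighted c) (pre_iter n A) = emeasure (weighted ((push ^^ n) c)) A"
proof (induction n arbitrary: A)
  case 0
  have "pre_iter 0 A = A" using tm_subset[OF 0] by (auto simp: pre_iter_def)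
  then show ?case by simp
next
  case (Suc n)
  then show ?case by (simp add: weighted_pre_iter_Suc weighted_pre)
qed

section \<open>Images of the base measure\<close>

definition base_weight :: "nat \<Rightarrow> ennreal" where "base_weight u = (if u \<in> {1..N} then 1 else 0)"
text \<open>The density after \<open>k\<close> steps, started from the base.\<close>
definition step_weight :: "nat \<Rightarrow> nat \<Rightarrow> ennreal" where "step_weight k = (push ^^ k) base_weight"
text \<open>The densities of the averages that define the lift.\<close>
definition mean_weight :: "nat \<Rightarrow> nat \<Rightarrow> ennreal" where "mean_weight n v = (\<Sum>k<n. step_weight k v) / of_nat n"

lemma emeasure_base_preimage:
  assumes A: "A \<in> sets tm"
  shows "emeasure tm ((That ^^ k) -` A \<inter> tower {1..N} D) = emeasure (weighted (step_weight k)) A"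
proof -
  let ?B = "(That ^^ k) -` A \<inter> tower {1..N} D"
  have l: "slice ?B u = (if u \<in> {1..N} then slice (pre_iter k A) u else {})" for u
    using base_in by (auto simp: pre_iter_def tower_def)
  have "?B \<subseteq> tw" using base_in by (auto simp: tower_def)
  then have B: "?B \<in> sets tm" unfolding sets_tm_iff l using A by auto
  have "emeasure tm ?B = (\<Sum>u. emeasure \<mu> (slice ?B u))" by (rule emeasure_tm[OF B])
  also have "\<dots> = (\<Sum>u. base_weight u * emeasure \<mu> (slice (pre_iter k A) u))"
    unfolding l by (intro suminf_cong) (simp add: base_weight_def)
  also have "\<dots> = emeasure (weighted base_weight) (pre_iter k A)" using A by (intro emeasure_weighted[symmetric] pre_iter_sets)
  finally show ?thesis using A by (simp add: weighted_pre_iter step_weight_def)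
qed

lemma emeasure_weighted_mean_weight:
  assumes A: "A \<in> sets tm"
  shows "emeasure (weighted (mean_weight n)) A = (\<Sum>k<n. emeasure (weighted (step_weight k)) A) / of_nat n"
proof -
  have "(\<Sum>k<n. emeasure (weighted (step_weight k)) A) / of_nat n = (\<Sum>k<n. \<Sum>u. step_weight k u * emeasure \<mu> (slice A u)) / of_nat n"
    using A by (simp add: emeasure_weighted)
  also have "\<dots> = (\<Sum>u. (\<Sum>k<n. step_weight k u * emeasure \<mu> (slice A u))) * inverse (of_nat n)"
    by (subst suminf_sum) (auto simp: divide_ennreal_def)
  also have "\<dots> = (\<Sum>u. (\<Sum>k<n. step_weight k u * emeasure \<mu> (slice A u)) * inverse (of_nat n))"
    by (rule ennreal_suminf_multc[symmetric])
  also have "\<dots> = (\<Sum>u. mean_weight n u * emeasure \<mu> (slice A u))"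
    by (intro suminf_cong) (simp add: mean_weight_def sum_distrib_left[symmetric] divide_ennreal_def ac_simps)
  also have "\<dots> = emeasure (weighted (mean_weight n)) A" using A by (rule emeasure_weighted[symmetric])
  finally show ?thesis ..
qed

lemma lift_average_eq: "lift_average \<mu> N Z T \<alpha> D n = weighted (mean_weight n)"
proof -
  have "lift_average \<mu> N Z T \<alpha> D n = measure_of (space (weighted (mean_weight n))) (sets (weighted (mean_weight n))) (emeasure (weighted (mean_weight n)))"
    unfolding lift_average_def space_weighted sets_weighted
  proof (rule measure_of_eq)
    show "sets tm \<subseteq> Pow tw" using tm_subset by auto
    fix A assume "A \<in> sigma_sets tw (sets tm)"
    then have A: "A \<in> sets tm" using sets.sigma_sets_eq[of tm] by (simp add: space_tm)
    then show "(\<Sum>k<n. emeasure tm ((That ^^ k) -` A \<inter> tower {1..N} D)) / of_nat n = emeasure (weighted (mean_weight n)) A"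
      by (simp add: emeasure_base_preimage emeasure_weighted_mean_weight del: One_nat_def)
  qed
  then show ?thesis by (simp only: measure_of_of_measure)
qed

lemma weighted_base_fst:
  assumes B: "B \<in> sets \<mu>" shows "emeasure (weighted base_weight) (fst -` B \<inter> tw) = emeasure \<mu> B"
proof -
  have "emeasure (weighted base_weight) (fst -` B \<inter> tw) = (\<Sum>u. base_weight u * emeasure \<mu> (slice (fst -` B \<inter> tw) u))"
    using B by (intro emeasure_weighted fst_vimage_sets)
  also have "\<dots> = (\<Sum>u\<in>{1..N}. base_weight u * emeasure \<mu> (slice (fst -` B \<inter> tw) u))"
    by (rule suminf_finite) (auto simp: base_weight_def)
  also have "\<dots> = (\<Sum>u\<in>{1..N}. emeasure \<mu> (Z u \<inter> B))"
  proof (rule sum.cong)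
    fix u assume u: "u \<in> {1..N}"
    have "slice (fst -` B \<inter> tw) u = Z u \<inter> B" using base_D[OF u] base_in u by (auto simp: tower_def)
    then show "base_weight u * emeasure \<mu> (slice (fst -` B \<inter> tw) u) = emeasure \<mu> (Z u \<inter> B)"
      using u by (simp add: base_weight_def)
  qed simp
  also have "\<dots> = (\<Sum>u\<in>{1..N}. \<integral>\<^sup>+x. indicator (Z u \<inter> B) x \<partial>\<mu>)"
    using B by (intro sum.cong nn_integral_indicator[symmetric] sets.Int Z_sets) simp_all
  also have "\<dots> = (\<integral>\<^sup>+x. (\<Sum>u\<in>{1..N}. indicator (Z u \<inter> B) x) \<partial>\<mu>)"
    using B by (intro nn_integral_sum[symmetric] borel_measurable_indicator sets.Int Z_sets)
  also have "\<dots> = (\<integral>\<^sup>+x. indicator B x \<partial>\<mu>)"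
  proof (rule nn_integral_cong_AE)
    show "AE x in \<mu>. (\<Sum>u\<in>{1..N}. indicator (Z u \<inter> B) x) = (indicator B x :: ennreal)"
      using AE_regular_pt
    proof eventually_elim
      case (elim x)
      have "(\<Sum>u\<in>{1..N}. indicator (Z u \<inter> B) x) = (\<Sum>u\<in>{1..N}. if u = bi x then indicator B x else (0::ennreal))"
        using regular_in_Z[OF elim] by (intro sum.cong) (auto simp: indicator_def)
      then show ?case using regular_bi[OF elim] by simp
    qed
  qed
  finally show ?thesis using B by simp
qed

lemma mass_0: "emeasure (weighted base_weight) tw = 1"
proof -
  have "fst z \<in> X" if "z \<in> tw" for z using that D_closed(2)[of "snd z"] by (auto simp: tower_def)
  then have "fst -` X \<inter> tw = tw" by auto
  then show ?thesis using weighted_base_fst[OF X_sets] emeasure_space_1 by (simp add: space_mu)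
qed

lemma mass_Suc: "emeasure (weighted (step_weight (Suc k))) tw \<le> emeasure (weighted (step_weight k)) tw"
proof -
  have "emeasure (weighted (step_weight (Suc k))) tw = emeasure (weighted (step_weight k)) (pre tw)"
    by (subst weighted_pre) (simp_all add: step_weight_def)
  also have "\<dots> \<le> emeasure (weighted (step_weight k)) tw" by (intro emeasure_mono) auto
  finally show ?thesis .
qed

text \<open>Mass can be lost to the absorbing index but never comes back.\<close>
lemma mass_decreasing: "k \<le> l \<Longrightarrow> emeasure (weighted (step_weight l)) tw \<le> emeasure (weighted (step_weight k)) tw"
  by (induction l rule: dec_induct) (auto intro: order_trans[OF mass_Suc])

lemma mass_le_1: "emeasure (weighted (step_weight k)) tw \<le> 1"
  using mass_decreasing[of 0 k] mass_0 by (simp add: step_weight_def)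

end

section \<open>Lifts have constant density on levels\<close>

context hofbauer_tower begin

lemma emeasure_levels:
  assumes M: "sets M = sets tm" and A: "A \<in> sets tm"
  shows "emeasure M A = (\<Sum>u. if u \<in> \<alpha> then emeasure M (slice A u \<times> {u}) else 0)"
proof -
  let ?S = "\<lambda>u. if u \<in> \<alpha> then slice A u \<times> {u} else {}"
  have S: "?S u \<in> sets M" for u
    using prod_sets[OF _ slice_sets[OF A] slice_subset[OF tm_subset[OF A]]] by (simp add: M)
  have "snd z \<in> \<alpha>" if "z \<in> A" for z using that tm_subset[OF A] by (auto simp: tower_def)
  then have "z \<in> A \<longleftrightarrow> z \<in> ?S (snd z)" for z by (cases z) auto
  moreover have "z \<in> ?S u \<Longrightarrow> u = snd z" for z u by (cases "u \<in> \<alpha>") auto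
  ultimately have "A = (\<Union>u. ?S u)" by blast
  moreover have "(\<Sum>u. emeasure M (?S u)) = emeasure M (\<Union>u. ?S u)"
  proof (rule suminf_emeasure)
    show "range ?S \<subseteq> sets M" using S by (intro image_subsetI)
  qed (auto simp: disjoint_family_on_def)
  ultimately have "emeasure M A = (\<Sum>u. emeasure M (?S u))" by simp
  also have "\<dots> = (\<Sum>u. if u \<in> \<alpha> then emeasure M (slice A u \<times> {u}) else 0)"
    by (intro suminf_cong) simp
  finally show ?thesis .
qed

lemma level_compact: "v \<in> \<alpha> \<Longrightarrow> compact (level D v)"
proof -
  assume v: "v \<in> \<alpha>"
  have "compact (D v)"
    using D_closed[OF v] compact_X by (meson bounded_subset compact_eq_bounded_closed)
  then show ?thesis by (simp add: level_def compact_Times)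
qed

lemma measure_tm_level: assumes v: "v \<in> \<alpha>" shows "measure tm (level D v) = prob (D v)"
proof -
  have "emeasure tm (level D v) = (\<Sum>u. emeasure \<mu> (slice (level D v) u))" using v by (intro emeasure_tm) simp
  also have "\<dots> = (\<Sum>u\<in>{v}. emeasure \<mu> (slice (level D v) u))"
    by (rule suminf_finite) (auto simp: level_def slice_def)
  also have "\<dots> = emeasure \<mu> (D v)" by (simp add: level_def slice_def)
  finally show ?thesis by (simp add: measure_def)
qed

text \<open>A continuous function on the base, placed on level \<open>v\<close> and extended by zero. It is continuous on the tower because \<open>nat\<close> is discrete.\<close>
definition test_fun :: "nat \<Rightarrow> ('a \<Rightarrow> real) \<Rightarrow> 'a \<times> nat \<Rightarrow> real" where
  "test_fun v g z = (if snd z = v then g (fst z) else 0)"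

lemma test_fun_continuous:
  assumes "continuous_on UNIV g" shows "continuous_on S (test_fun v g)"
proof -
  have "test_fun v g = (\<lambda>z. (\<lambda>u. if u = v then 1 else 0) (snd z) * g (fst z))"
    by (auto simp: test_fun_def fun_eq_iff)
  moreover have "continuous_on S (\<lambda>z. (\<lambda>u. if u = v then 1 else (0::real)) (snd z))"
    by (rule continuous_on_compose2[of UNIV]) (auto intro: continuous_intros)
  moreover have "continuous_on S (\<lambda>z. g (fst z))"
    by (rule continuous_on_compose2[OF assms]) (auto intro: continuous_intros)
  ultimately show ?thesis by (simp add: continuous_on_mult)
qed

lemma test_fun_meas:
  assumes "continuous_on UNIV g" shows "test_fun v g \<in> borel_measurable tm"
proof -
  have [measurable]: "(\<lambda>z. g (fst z)) \<in> borel_measurable tm"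
    using measurable_compose[OF fst_meas continuous_meas[OF assms]] .
  show ?thesis unfolding test_fun_def[abs_def] by measurable
qed

lemma integral_test_weighted:
  assumes v: "v \<in> \<alpha>" and g: "continuous_on UNIV g" "\<And>x. 0 \<le> g x"
  shows "(\<integral>z. test_fun v g z \<partial>weighted c) = enn2real (c v) * (\<integral>x. g x * indicator (D v) x \<partial>\<mu>)"
proof -
  have [measurable]: "g \<in> borel_measurable \<mu>" "test_fun v g \<in> borel_measurable tm" "D v \<in> sets \<mu>"
    using continuous_meas[OF g(1)] test_fun_meas[OF g(1)] v by auto
  have nn: "0 \<le> test_fun v g z" for z using g(2) by (simp add: test_fun_def)
  have "(\<integral>\<^sup>+z. ennreal (test_fun v g z) \<partial>weighted c) = (\<integral>\<^sup>+z. c (snd z) * ennreal (test_fun v g z) \<partial>tm)"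
    unfolding weighted_def by (subst nn_integral_density) auto
  also have "\<dots> = (\<Sum>u. if u \<in> \<alpha> then \<integral>\<^sup>+x. c u * ennreal (test_fun v g (x, u)) * indicator (D u) x \<partial>\<mu> else 0)"
    by (subst nn_integral_tm) (auto cong: if_cong)
  also have "\<dots> = (\<Sum>u\<in>{v}. if u \<in> \<alpha> then \<integral>\<^sup>+x. c u * ennreal (test_fun v g (x, u)) * indicator (D u) x \<partial>\<mu> else 0)"
    by (rule suminf_finite) (auto simp: test_fun_def)
  also have "\<dots> = (\<integral>\<^sup>+x. c v * ennreal (g x * indicator (D v) x) \<partial>\<mu>)"
    using v by (auto simp: test_fun_def intro!: nn_integral_cong split: split_indicator)
  also have "\<dots> = c v * (\<integral>\<^sup>+x. ennreal (g x * indicator (D v) x) \<partial>\<mu>)"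
    by (intro nn_integral_cmult) auto
  finally have eq: "(\<integral>\<^sup>+z. ennreal (test_fun v g z) \<partial>weighted c) = c v * (\<integral>\<^sup>+x. ennreal (g x * indicator (D v) x) \<partial>\<mu>)" .
  have m: "test_fun v g \<in> borel_measurable (weighted c)" by (simp add: weighted_def)
  have "(\<integral>z. test_fun v g z \<partial>weighted c) = enn2real (\<integral>\<^sup>+z. ennreal (test_fun v g z) \<partial>weighted c)"
    using nn m by (intro integral_eq_nn_integral) auto
  moreover have "(\<integral>x. g x * indicator (D v) x \<partial>\<mu>) = enn2real (\<integral>\<^sup>+x. ennreal (g x * indicator (D v) x) \<partial>\<mu>)"
    using g(2) by (intro integral_eq_nn_integral) auto
  ultimately show ?thesis by (simp add: eq enn2real_mult)
qed

context
  fixes M :: "('a \<times> nat) measure"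
  assumes M: "lifts_to \<mu> N Z T \<alpha> D M"
begin

lemma lift_sets: "sets M = sets tm" using M by (simp add: lifts_to_def)
lemma lift_space: "space M = tw" using sets_eq_imp_space_eq[OF lift_sets] by (simp add: space_tm)

abbreviation rho where "rho \<equiv> level_density \<mu> \<alpha> D M"

lemma lift_level_finite: "v \<in> \<alpha> \<Longrightarrow> emeasure M (level D v) < \<infinity>"
proof -
  assume v: "v \<in> \<alpha>"
  have "level D v \<subseteq> space M" using v by (auto simp: lift_space level_def tower_def)
  then show ?thesis using M level_compact[OF v] unfolding lifts_to_def radon_measure_def by blast
qed

lemma lift_test_limit:
  assumes v: "v \<in> \<alpha>" and g: "continuous_on UNIV g" "\<And>x. 0 \<le> g x"
  shows "(\<lambda>n. enn2real (mean_weight n v) * (\<integral>x. g x * indicator (D v) x \<partial>\<mu>)) \<longlonglongrightarrow> (\<integral>z. test_fun v g z \<partial>M)"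
proof -
  have "\<exists>K. compact K \<and> K \<subseteq> tw \<and> (\<forall>x\<in>tw - K. test_fun v g x = 0)"
    using level_compact[OF v] v
    by (intro exI[of _ "level D v"]) (auto simp: level_def tower_def test_fun_def)
  then have "(\<lambda>n. \<integral>z. test_fun v g z \<partial>lift_average \<mu> N Z T \<alpha> D n) \<longlonglongrightarrow> (\<integral>z. test_fun v g z \<partial>M)"
    using M test_fun_continuous[OF g(1)] unfolding lifts_to_def vague_limit_def by blast
  then show ?thesis by (simp add: lift_average_eq integral_test_weighted[OF v g])
qed

lemma prob_D_pos: "v \<in> \<alpha> \<Longrightarrow> 0 < prob (D v)"
  using D_pos[of v] by (simp add: emeasure_eq_measure)

text \<open>Testing with the indicator of a level, which is continuous with compact support.\<close>
lemma lift_weight_limit: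
  assumes v: "v \<in> \<alpha>" shows "(\<lambda>n. enn2real (mean_weight n v)) \<longlonglongrightarrow> rho v"
proof -
  have "(\<integral>z. test_fun v (\<lambda>_. 1) z \<partial>M) = (\<integral>z. indicator (level D v) z \<partial>M)"
    by (intro Bochner_Integration.integral_cong)
      (auto simp: test_fun_def lift_space tower_def level_def split: split_indicator)
  also have "\<dots> = measure M (level D v)"
  proof -
    have "level D v \<inter> space M = level D v" using v by (auto simp: lift_space level_def tower_def)
    then show ?thesis by simp
  qed
  finally have "(\<lambda>n. enn2real (mean_weight n v) * prob (D v)) \<longlonglongrightarrow> measure M (level D v)"
    using lift_test_limit[OF v, of "\<lambda>_. 1"] D_closed[OF v] by (simp add: space_mu Int_absorb2)
  then have "(\<lambda>n. enn2real (mean_weight n v) * prob (D v) / prob (D v)) \<longlonglongrightarrow> measure M (level D v) / prob (D v)"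
    using prob_D_pos[OF v] by (intro tendsto_divide) auto
  then show ?thesis using prob_D_pos[OF v] by (simp add: level_density_def measure_tm_level[OF v])
qed

lemma rho_nonneg: "0 \<le> rho v" by (simp add: level_density_def)

lemma rho_level: "v \<in> \<alpha> \<Longrightarrow> measure M (level D v) = rho v * prob (D v)"
  using prob_D_pos[of v] by (simp add: level_density_def measure_tm_level)

lemma lift_integral:
  assumes v: "v \<in> \<alpha>" and g: "continuous_on UNIV g" "\<And>x. 0 \<le> g x"
  shows "(\<integral>z. test_fun v g z \<partial>M) = rho v * (\<integral>x. g x * indicator (D v) x \<partial>\<mu>)"
  by (rule LIMSEQ_unique[OF lift_test_limit[OF v g]])
    (intro tendsto_mult_right lift_weight_limit v)

text \<open>The indicator of a compact set is the decreasing limit of continuous functions of the distance to it.\<close>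
lemma lift_compact:
  assumes v: "v \<in> \<alpha>" and K: "compact K" "K \<subseteq> D v"
  shows "emeasure M (K \<times> {v}) = ennreal (rho v) * emeasure \<mu> K"
proof (cases "K = {}")
  case False
  define g where "g m x = max 0 (1 - real m * infdist x K)" for m x
  have gc: "continuous_on UNIV (g m)" for m unfolding g_def by (intro continuous_intros)
  have g01: "0 \<le> g m x" "g m x \<le> 1" for m x by (auto simp: g_def infdist_nonneg)
  have glim: "(\<lambda>m. g m x) \<longlonglongrightarrow> indicator K x" for x
  proof (cases "x \<in> K")
    case True then show ?thesis by (simp add: g_def)
  next
    case x: False
    then have pos: "0 < infdist x K"
      using in_closed_iff_infdist_zero[OF compact_imp_closed[OF K(1)] False, of x] infdist_nonneg[of x K] by auto
    obtain m0 where m0: "1 < real m0 * infdist x K" using reals_Archimedean3[OF pos] by blast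
    have "eventually (\<lambda>m. g m x = 0) sequentially" using eventually_ge_at_top[of m0]
    proof eventually_elim
      case (elim m)
      have "real m0 * infdist x K \<le> real m * infdist x K" using elim pos by (intro mult_right_mono) auto
      then show ?case using m0 by (simp add: g_def)
    qed
    then show ?thesis using x by (simp add: tendsto_eventually)
  qed
  have Ks: "K \<in> sets \<mu>" using K D_closed[OF v] by (intro closed_sets compact_imp_closed) auto
  then have KM: "K \<times> {v} \<in> sets M" using prod_sets[OF v Ks K(2)] by (simp add: lift_sets)
  have LM: "level D v \<in> sets M" using v by (simp add: lift_sets)
  have iM: "integrable M (indicator (level D v) :: _ \<Rightarrow> real)"
    using LM lift_level_finite[OF v] by (simp add: less_top)
  have "(\<lambda>m. \<integral>z. test_fun v (g m) z \<partial>M) \<longlonglongrightarrow> (\<integral>z. indicator (K \<times> {v}) z \<partial>M)"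
  proof (rule integral_dominated_convergence[where w="indicator (level D v)"])
    show "AE z in M. (\<lambda>m. test_fun v (g m) z) \<longlonglongrightarrow> indicator (K \<times> {v}) z"
    proof (rule AE_I2)
      fix z :: "'a \<times> nat"
      show "(\<lambda>m. test_fun v (g m) z) \<longlonglongrightarrow> indicator (K \<times> {v}) z"
        using glim[of "fst z"] by (cases "snd z = v") (auto simp: test_fun_def indicator_def mem_Times_iff)
    qed
    show "AE z in M. norm (test_fun v (g m) z) \<le> indicator (level D v) z" for m
      by (rule AE_I2) (use g01 in \<open>auto simp: test_fun_def lift_space tower_def level_def split: split_indicator\<close>)
    show "test_fun v (g m) \<in> borel_measurable M" for m
      using test_fun_meas[OF gc] measurable_cong_sets[OF lift_sets refl, of borel] by blast
  qed (use KM iM in \<open>auto intro!: borel_measurable_indicator\<close>)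
  moreover have "(\<lambda>m. \<integral>x. g m x * indicator (D v) x \<partial>\<mu>) \<longlonglongrightarrow> (\<integral>x. indicator K x \<partial>\<mu>)"
  proof (rule integral_dominated_convergence[where w="\<lambda>_. 1"])
    show "AE x in \<mu>. (\<lambda>m. g m x * indicator (D v) x) \<longlonglongrightarrow> indicator K x"
    proof (rule AE_I2)
      fix x
      have "(\<lambda>m. g m x * indicator (D v) x) \<longlonglongrightarrow> indicator K x * indicator (D v) x"
        by (intro tendsto_mult glim tendsto_const)
      moreover have "indicator K x * indicator (D v) x = (indicator K x :: real)"
        using K(2) by (auto split: split_indicator)
      ultimately show "(\<lambda>m. g m x * indicator (D v) x) \<longlonglongrightarrow> indicator K x" by simp
    qed
    show "AE x in \<mu>. norm (g m x * indicator (D v) x) \<le> 1" for m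
      using g01 by (intro AE_I2) (auto split: split_indicator)
    show "(\<lambda>x. g m x * indicator (D v) x) \<in> borel_measurable \<mu>" for m
      using continuous_meas[OF gc] v by (intro borel_measurable_times borel_measurable_indicator) auto
  qed (use Ks in auto)
  then have "(\<lambda>m. rho v * (\<integral>x. g m x * indicator (D v) x \<partial>\<mu>)) \<longlonglongrightarrow> rho v * (\<integral>x. indicator K x \<partial>\<mu>)"
    by (intro tendsto_mult_left)
  moreover have "(\<integral>z. test_fun v (g m) z \<partial>M) = rho v * (\<integral>x. g m x * indicator (D v) x \<partial>\<mu>)" for m
    by (rule lift_integral[OF v gc g01(1)])
  ultimately have "(\<integral>z. indicator (K \<times> {v}) z \<partial>M) = rho v * (\<integral>x. indicator K x \<partial>\<mu>)"
    using LIMSEQ_unique by auto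
  then have m: "measure M (K \<times> {v}) = rho v * prob K"
    using sets.sets_into_space[OF KM] sets.sets_into_space[OF Ks] by (simp add: Int_absorb2)
  have "emeasure M (K \<times> {v}) \<le> emeasure M (level D v)" using LM K by (intro emeasure_mono) (auto simp: level_def)
  then have "emeasure M (K \<times> {v}) < \<infinity>" using lift_level_finite[OF v] by simp
  then have "emeasure M (K \<times> {v}) = ennreal (measure M (K \<times> {v}))" by (simp add: emeasure_eq_ennreal_measure less_top)
  then show ?thesis using m rho_nonneg[of v] by (simp add: emeasure_eq_measure ennreal_mult)
qed simp

text \<open>By inner regularity of the lift it suffices to bound the measure of compact subsets.\<close>
lemma lift_le:
  assumes v: "v \<in> \<alpha>" and A: "A \<in> sets \<mu>" "A \<subseteq> D v"
  shows "emeasure M (A \<times> {v}) \<le> ennreal (rho v) * emeasure \<mu> A"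
proof -
  have "A \<times> {v} \<in> sets M" using prod_sets[OF v A] by (simp add: lift_sets)
  then have "emeasure M (A \<times> {v}) = (SUP K \<in> {K. compact K \<and> K \<subseteq> A \<times> {v}}. emeasure M K)"
    using M unfolding lifts_to_def radon_measure_def by blast
  also have "\<dots> \<le> ennreal (rho v) * emeasure \<mu> A"
  proof (rule SUP_least)
    fix K assume "K \<in> {K. compact K \<and> K \<subseteq> A \<times> {v}}"
    then have K: "compact K" "K \<subseteq> A \<times> {v}" by auto
    have Ke: "K = (fst ` K) \<times> {v}" using K(2) by force
    have c: "compact (fst ` K)" using K(1) by (intro compact_continuous_image continuous_intros)
    have s: "fst ` K \<subseteq> A" using K(2) by auto
    have "emeasure M K = ennreal (rho v) * emeasure \<mu> (fst ` K)"
      using lift_compact[OF v c] s A(2) Ke by auto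
    also have "\<dots> \<le> ennreal (rho v) * emeasure \<mu> A" using s A by (intro mult_left_mono emeasure_mono) auto
    finally show "emeasure M K \<le> ennreal (rho v) * emeasure \<mu> A" .
  qed
  finally show ?thesis .
qed

text \<open>The inequality holds for the set and for its complement in the level, and it is an equality for the whole level.\<close>
lemma lift_eq:
  assumes v: "v \<in> \<alpha>" and A: "A \<in> sets \<mu>" "A \<subseteq> D v"
  shows "emeasure M (A \<times> {v}) = ennreal (rho v) * emeasure \<mu> A"
proof (rule antisym[OF lift_le[OF assms]])
  have B: "D v - A \<in> sets \<mu>" "D v - A \<subseteq> D v" using v A by auto
  have sA: "A \<times> {v} \<in> sets M" and sB: "(D v - A) \<times> {v} \<in> sets M"
    using prod_sets[OF v A] prod_sets[OF v B] by (simp_all add: lift_sets)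
  have un: "A \<times> {v} \<union> (D v - A) \<times> {v} = level D v" using A(2) by (auto simp: level_def)
  have "emeasure M (level D v) = emeasure M (A \<times> {v}) + emeasure M ((D v - A) \<times> {v})"
    unfolding un[symmetric] using sA sB by (intro plus_emeasure[symmetric]) auto
  moreover have "emeasure M (level D v) = ennreal (rho v) * emeasure \<mu> (D v)"
  proof -
    have "emeasure M (level D v) = ennreal (measure M (level D v))"
      using lift_level_finite[OF v] by (simp add: emeasure_eq_ennreal_measure less_top)
    then show ?thesis using rho_level[OF v] rho_nonneg[of v] by (simp add: emeasure_eq_measure ennreal_mult)
  qed
  moreover have "emeasure \<mu> (D v) = emeasure \<mu> A + emeasure \<mu> (D v - A)"
    using A v by (subst plus_emeasure) (auto simp: Un_absorb1)
  ultimately have "ennreal (rho v) * emeasure \<mu> A + ennreal (rho v) * emeasure \<mu> (D v - A)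
      \<le> emeasure M (A \<times> {v}) + ennreal (rho v) * emeasure \<mu> (D v - A)"
    using lift_le[OF v B] by (metis add_left_mono distrib_left)
  moreover have "ennreal (rho v) * emeasure \<mu> (D v - A) \<noteq> \<top>"
    by (simp add: emeasure_eq_measure ennreal_mult_eq_top_iff)
  ultimately show "ennreal (rho v) * emeasure \<mu> A \<le> emeasure M (A \<times> {v})"
    by (simp add: add.commute[of _ "ennreal (rho v) * emeasure \<mu> (D v - A)"] ennreal_add_left_cancel_le)
qed

lemma lift_is_weighted: "M = weighted (\<lambda>u. if u \<in> \<alpha> then ennreal (rho u) else 0)"
proof (rule measure_eqI)
  fix A assume "A \<in> sets M"
  then have A: "A \<in> sets tm" by (simp add: lift_sets)
  have "emeasure M A = (\<Sum>u. if u \<in> \<alpha> then emeasure M (slice A u \<times> {u}) else 0)"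
    by (rule emeasure_levels[OF lift_sets A])
  also have "\<dots> = (\<Sum>u. (if u \<in> \<alpha> then ennreal (rho u) else 0) * emeasure \<mu> (slice A u))"
    using lift_eq[OF _ slice_sets[OF A] slice_subset[OF tm_subset[OF A]]] by (intro suminf_cong) simp
  also have "\<dots> = emeasure (weighted (\<lambda>u. if u \<in> \<alpha> then ennreal (rho u) else 0)) A" by (rule emeasure_weighted[OF A, symmetric])
  finally show "emeasure M A = emeasure (weighted (\<lambda>u. if u \<in> \<alpha> then ennreal (rho u) else 0)) A" .
qed (simp add: lift_sets)

end

text \<open>The densities of a lift are limits that do not depend on the lift.\<close>
lemma lift_unique:
  assumes "lifts_to \<mu> N Z T \<alpha> D M" "lifts_to \<mu> N Z T \<alpha> D M'" shows "M = M'"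
proof -
  have "level_density \<mu> \<alpha> D M u = level_density \<mu> \<alpha> D M' u" if "u \<in> \<alpha>" for u
    using LIMSEQ_unique[OF lift_weight_limit[OF assms(1) that] lift_weight_limit[OF assms(2) that]] .
  then have "(\<lambda>u. if u \<in> \<alpha> then ennreal (level_density \<mu> \<alpha> D M u) else 0)
      = (\<lambda>u. if u \<in> \<alpha> then ennreal (level_density \<mu> \<alpha> D M' u) else 0)" by auto
  then show ?thesis using lift_is_weighted[OF assms(1)] lift_is_weighted[OF assms(2)] by simp
qed

end

section \<open>Invariance of the lift\<close>

text \<open>The form of Fatou's lemma for series that is used for the densities.\<close>
lemma suminf_limit_le_ennreal:
  fixes f :: "nat \<Rightarrow> nat \<Rightarrow> ennreal"
  assumes lim: "\<And>u. (\<lambda>n. f n u) \<longlonglongrightarrow> g u" and le: "\<And>n. (\<Sum>u. f n u) \<le> b n" and b: "b \<longlonglongrightarrow> B"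
  shows "(\<Sum>u. g u) \<le> B"
  unfolding suminf_eq_SUP
proof (rule SUP_least)
  fix m
  have "(\<lambda>n. sum (f n) {..<m}) \<longlonglongrightarrow> sum g {..<m}" by (intro tendsto_sum lim)
  moreover have "sum (f n) {..<m} \<le> b n" for n
    by (rule order_trans[OF sum_le_suminf le]) auto
  ultimately show "sum g {..<m} \<le> B" using b by (intro LIMSEQ_le[of "\<lambda>n. sum (f n) {..<m}"]) auto
qed

lemma le_suminf_ennreal: "f (u::nat) \<le> (\<Sum>i. f i :: ennreal)"
  using sum_le_suminf[of f "{u}"] by simp

lemma suminf_eq_imp_eq_ennreal:
  fixes a b :: "nat \<Rightarrow> ennreal"
  assumes le: "\<And>u. a u \<le> b u" and eq: "(\<Sum>u. a u) = (\<Sum>u. b u)" and fin: "(\<Sum>u. b u) < \<infinity>"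
  shows "a u = b u"
proof -
  have fa: "a u < \<infinity>" for u using le_suminf_ennreal[of a u] eq fin by (simp add: order_le_less_trans)
  have b: "b u = a u + (b u - a u)" for u using le[of u] by (simp add: add_diff_self_ennreal)
  have "(\<Sum>u. b u) = (\<Sum>u. a u + (b u - a u))" using b by simp
  also have "\<dots> = (\<Sum>u. a u) + (\<Sum>u. b u - a u)" by (rule suminf_add[symmetric]) auto
  finally have "(\<Sum>u. b u) + 0 = (\<Sum>u. b u) + (\<Sum>u. b u - a u)" using eq by simp
  then have "(\<Sum>u. b u - a u) = 0" using fin by (simp only: ennreal_add_left_cancel) auto
  then have "b u - a u = 0" using le_suminf_ennreal[of "\<lambda>u. b u - a u" u] by simp
  then show ?thesis using b[of u] by simp
qed

locale lifted_tower = hofbauer_tower X \<mu> N Z T s \<alpha> D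
  for X :: "'a::euclidean_space set" and \<mu> N Z T s \<alpha> D +
  fixes \<mu>h :: "('a \<times> nat) measure"
  assumes nonatomic: "\<And>x. x \<in> X \<Longrightarrow> emeasure \<mu> {x} = 0"
    and lifts: "lifts_to \<mu> N Z T \<alpha> D \<mu>h"
    and prob_h: "prob_space \<mu>h"
begin

lemma sets_h[simp]: "sets \<mu>h = sets tm" using lift_sets[OF lifts] .
lemma space_h: "space \<mu>h = tw" using lift_space[OF lifts] .
lemma h_tw: "emeasure \<mu>h tw = 1" using prob_space.emeasure_space_1[OF prob_h] by (simp add: space_h)

text \<open>The density of the lift on level \<open>u\<close>, which is the height of its rug.\<close>
definition height :: "nat \<Rightarrow> real" where "height u = (if u \<in> \<alpha> then level_density \<mu> \<alpha> D \<mu>h u else 0)"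

lemma height_nonneg[simp]: "0 \<le> height u" by (simp add: height_def level_density_def)

lemma h_weighted: "\<mu>h = weighted (\<lambda>u. ennreal (height u))"
proof -
  have "(\<lambda>u. ennreal (height u)) = (\<lambda>u. if u \<in> \<alpha> then ennreal (level_density \<mu> \<alpha> D \<mu>h u) else 0)"
    by (auto simp: height_def)
  then show ?thesis using lift_is_weighted[OF lifts] by simp
qed

lemma emeasure_h: "A \<in> sets tm \<Longrightarrow> emeasure \<mu>h A = (\<Sum>u. ennreal (height u) * emeasure \<mu> (slice A u))"
  by (subst h_weighted) (rule emeasure_weighted)

lemma step_weight_bound: assumes v: "v \<in> \<alpha>" shows "step_weight k v \<le> ennreal (1 / prob (D v))"
proof -
  have "step_weight k v * emeasure \<mu> (D v) \<le> emeasure (weighted (step_weight k)) tw"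
    using le_suminf_ennreal[of "\<lambda>u. step_weight k u * emeasure \<mu> (slice tw u)" v] v by (simp add: emeasure_weighted slice_tw)
  then have le: "step_weight k v * ennreal (prob (D v)) \<le> 1" using mass_le_1[of k] by (simp add: emeasure_eq_measure)
  have "step_weight k v = step_weight k v * (ennreal (prob (D v)) * ennreal (1 / prob (D v)))"
    using prob_D_pos[OF lifts v] by (simp add: ennreal_mult[symmetric])
  also have "\<dots> \<le> 1 * ennreal (1 / prob (D v))"
    unfolding mult.assoc[symmetric] by (intro mult_right_mono le) simp
  finally show ?thesis by simp
qed

lemma mean_weight_finite: assumes v: "v \<in> \<alpha>" shows "mean_weight n v < \<infinity>"
proof (cases "n = 0")
  case False
  have "step_weight k v < \<top>" for k using step_weight_bound[OF v, of k] by (rule order_le_less_trans) simp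
  then have "step_weight k v \<noteq> \<top>" for k by (simp add: less_top)
  then have "(\<Sum>k<n. step_weight k v) \<noteq> \<top>" by simp
  then have "mean_weight n v \<noteq> \<top>" using False unfolding mean_weight_def ennreal_divide_eq_top_iff by auto
  then show ?thesis by (simp add: less_top)
qed (simp add: mean_weight_def)

lemma mean_weight_limit: assumes v: "v \<in> \<alpha>" shows "(\<lambda>n. mean_weight n v) \<longlonglongrightarrow> ennreal (height v)"
proof -
  have "(\<lambda>n. ennreal (enn2real (mean_weight n v))) \<longlonglongrightarrow> ennreal (height v)"
    using lift_weight_limit[OF lifts v] v by (intro tendsto_ennrealI) (simp add: height_def)
  moreover have "ennreal (enn2real (mean_weight n v)) = mean_weight n v" for n using mean_weight_finite[OF v, of n] by simp
  ultimately show ?thesis by simp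
qed

lemma mean_weight_limit_Suc: "v \<in> \<alpha> \<Longrightarrow> (\<lambda>n. mean_weight (Suc n) v) \<longlonglongrightarrow> ennreal (height v)"
  by (rule LIMSEQ_Suc[OF mean_weight_limit])

lemma h_le_limit:
  assumes A: "A \<in> sets tm" and le: "\<And>n. emeasure (weighted (mean_weight (Suc n))) A \<le> b n" and b: "b \<longlonglongrightarrow> B"
  shows "emeasure \<mu>h A \<le> B"
  unfolding emeasure_h[OF A]
proof (rule suminf_limit_le_ennreal[OF _ _ b])
  fix u show "(\<lambda>n. mean_weight (Suc n) u * emeasure \<mu> (slice A u)) \<longlonglongrightarrow> ennreal (height u) * emeasure \<mu> (slice A u)"
  proof (cases "u \<in> \<alpha>")
    case True
    have "(\<lambda>n. emeasure \<mu> (slice A u) * mean_weight (Suc n) u) \<longlonglongrightarrow> emeasure \<mu> (slice A u) * ennreal (height u)"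
      by (intro ennreal_tendsto_cmult mean_weight_limit_Suc[OF True]) (simp add: less_top[symmetric])
    then show ?thesis by (simp add: mult.commute)
  qed (simp add: slice_empty[OF tm_subset[OF A]])
next
  fix n show "(\<Sum>u. mean_weight (Suc n) u * emeasure \<mu> (slice A u)) \<le> b n"
    using le[of n] by (simp add: emeasure_weighted[OF A])
qed

lemma tendsto_const_over_Suc: "(\<lambda>n. ennreal (c / real (Suc n))) \<longlonglongrightarrow> 0"
  using tendsto_ennrealI[OF LIMSEQ_Suc[OF lim_const_over_n[of c]]] by simp

text \<open>The masses after \<open>k\<close> steps decrease. If one of them were below \<open>1\<close>, then the averages, and with them the
  lift, would have total mass below \<open>1\<close>.\<close>
lemma mass_1: "emeasure (weighted (step_weight k)) tw = 1"
proof (rule antisym[OF mass_le_1])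
  let ?a = "emeasure (weighted (step_weight k)) tw"
  have "emeasure \<mu>h tw \<le> 0 + ?a"
  proof (rule h_le_limit[OF tw_sets])
    show "(\<lambda>n. ennreal (real k / real (Suc n)) + ?a) \<longlonglongrightarrow> 0 + ?a"
      by (intro tendsto_add tendsto_const_over_Suc tendsto_const)
    fix n
    (* the first k terms are at most 1, all later ones at most the k-th *)
    have "(\<Sum>i<Suc n. emeasure (weighted (step_weight i)) tw) \<le> (\<Sum>i<Suc n. (if i < k then 1 else 0) + ?a)"
    proof (intro sum_mono)
      fix i
      show "emeasure (weighted (step_weight i)) tw \<le> (if i < k then 1 else 0) + ?a"
        using mass_le_1[of i] mass_decreasing[of k i] by (auto simp: add_increasing2)
    qed
    also have "\<dots> = of_nat (card {i. i < Suc n \<and> i < k}) + of_nat (Suc n) * ?a"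
      by (simp add: sum.distrib sum.If_cases Int_def lessThan_def del: of_nat_Suc)
    also have "\<dots> \<le> of_nat k + of_nat (Suc n) * ?a"
    proof -
      have "card {i. i < Suc n \<and> i < k} \<le> card {..<k}" by (intro card_mono) auto
      then show ?thesis by (intro add_right_mono) simp
    qed
    finally have s: "(\<Sum>i<Suc n. emeasure (weighted (step_weight i)) tw) \<le> of_nat k + of_nat (Suc n) * ?a" .
    have "emeasure (weighted (mean_weight (Suc n))) tw \<le> (of_nat k + of_nat (Suc n) * ?a) / of_nat (Suc n)"
      unfolding emeasure_weighted_mean_weight[OF tw_sets] by (rule divide_right_mono_ennreal[OF s])
    also have "\<dots> = of_nat k / of_nat (Suc n) + ?a"
    proof -
      have "of_nat (Suc n) * ?a / of_nat (Suc n) = ?a"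
        by (subst mult.commute, rule ennreal_mult_divide_eq) (auto simp del: of_nat_Suc)
      then show ?thesis by (simp add: add_divide_distrib_ennreal del: of_nat_Suc)
    qed
    also have "of_nat k / of_nat (Suc n) = ennreal (real k / real (Suc n))"
      by (simp add: ennreal_of_nat_eq_real_of_nat divide_ennreal del: of_nat_Suc)
    finally show "emeasure (weighted (mean_weight (Suc n))) tw \<le> ennreal (real k / real (Suc n)) + ?a" .
  qed
  then show "1 \<le> ?a" by (simp add: h_tw)
qed

text \<open>A level charged by the lift is charged by some image of the base measure, and that image loses no mass in the next step.\<close>
lemma no_leak:
  assumes u: "u \<in> \<alpha>" and pos: "0 < height u"
  shows "AE x in \<mu>. x \<in> D u \<longrightarrow> That (x, u) \<in> tw"
proof -
  have "\<exists>k. step_weight k u \<noteq> 0"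
  proof (rule ccontr)
    assume "\<nexists>k. step_weight k u \<noteq> 0"
    then have "mean_weight n u = 0" for n by (simp add: mean_weight_def)
    then have "(\<lambda>n. 0) \<longlonglongrightarrow> ennreal (height u)" using mean_weight_limit[OF u] by simp
    then have "ennreal (height u) = 0" using LIMSEQ_unique tendsto_const by blast
    then show False using pos by simp
  qed
  then obtain k where k: "step_weight k u \<noteq> 0" by blast
  let ?M = "weighted (step_weight k)"
  have "emeasure ?M (pre tw) = emeasure (weighted (step_weight (Suc k))) tw" by (subst weighted_pre) (simp_all add: step_weight_def)
  then have p: "emeasure ?M (pre tw) = 1" by (simp add: mass_1)
  have "emeasure ?M (tw - pre tw) = emeasure ?M tw - emeasure ?M (pre tw)"
    using p by (intro emeasure_Diff) auto
  then have "emeasure ?M (tw - pre tw) = 0" using p by (simp add: mass_1)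
  then have "(\<Sum>v. step_weight k v * emeasure \<mu> (slice (tw - pre tw) v)) = 0" by (subst emeasure_weighted[symmetric]) auto
  then have "step_weight k u * emeasure \<mu> (slice (tw - pre tw) u) = 0"
    using le_suminf_ennreal[of "\<lambda>v. step_weight k v * emeasure \<mu> (slice (tw - pre tw) v)" u] by simp
  then have "emeasure \<mu> (slice (tw - pre tw) u) = 0" using k by simp
  moreover have "slice (tw - pre tw) u \<in> sets \<mu>" by (rule slice_sets) auto
  ultimately have "AE x in \<mu>. x \<notin> slice (tw - pre tw) u" by (intro AE_not_in null_setsI)
  then show ?thesis by eventually_elim (use u in \<open>auto simp: tower_def\<close>)
qed

lemma h_AE_stays: "AE z in \<mu>h. That z \<in> tw"
proof -
  have "AE x in \<mu>. \<forall>u. u \<in> \<alpha> \<and> 0 < height u \<longrightarrow> x \<in> D u \<longrightarrow> That (x, u) \<in> tw"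
    unfolding AE_all_countable using no_leak by (auto intro!: AE_impI)
  from AE_weighted[OF this, of "\<lambda>u. ennreal (height u)"]
  have 1: "AE z in \<mu>h. \<forall>u. u \<in> \<alpha> \<and> 0 < height u \<longrightarrow> fst z \<in> D u \<longrightarrow> That (fst z, u) \<in> tw" by (simp only: h_weighted[symmetric])
  have "AE z in weighted (\<lambda>u. ennreal (height u)). 0 < height (snd z)"
    unfolding weighted_def by (subst AE_density) simp_all
  then have 2: "AE z in \<mu>h. 0 < height (snd z)" by (simp only: h_weighted[symmetric])
  show ?thesis using 1 2 AE_space
  proof eventually_elim
    case (elim z)
    have "snd z \<in> \<alpha>" "fst z \<in> D (snd z)" using elim(3) by (auto simp: space_h tower_def)
    then show ?case using elim(1,2) by (metis prod.collapse)
  qed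
qed

lemma h_pre_tw: "emeasure \<mu>h (pre tw) = 1"
proof -
  have "emeasure \<mu>h (pre tw) = emeasure \<mu>h tw"
  proof (rule emeasure_eq_AE)
    show "AE z in \<mu>h. (z \<in> pre tw) = (z \<in> tw)" using h_AE_stays by eventually_elim auto
  qed auto
  then show ?thesis by (simp add: h_tw)
qed

text \<open>Applying the transfer operator to an average shifts the sum by one, which changes it by a term of order
  \<open>1 / n\<close>; then pass to the limit with Fatou.\<close>
lemma push_le: assumes v: "v \<in> \<alpha>" shows "push (\<lambda>u. ennreal (height u)) v \<le> ennreal (height v)"
proof -
  define c where "c = 1 / prob (D v)"
  have "push (\<lambda>u. ennreal (height u)) v \<le> ennreal (height v) + 0"
    unfolding push_def
  proof (rule suminf_limit_le_ennreal)
    fix u show "(\<lambda>n. mean_weight (Suc n) u * edge_weight u v) \<longlonglongrightarrow> ennreal (height u) * edge_weight u v"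
    proof (cases "u \<in> \<alpha>")
      case True
      have "(\<lambda>n. edge_weight u v * mean_weight (Suc n) u) \<longlonglongrightarrow> edge_weight u v * ennreal (height u)"
        by (intro ennreal_tendsto_cmult mean_weight_limit_Suc[OF True]) (simp add: edge_weight_def)
      then show ?thesis by (simp add: mult.commute)
    qed (simp add: edge_weight_def)
  next
    show "(\<lambda>n. mean_weight (Suc n) v + ennreal (c / real (Suc n))) \<longlonglongrightarrow> ennreal (height v) + 0"
      by (intro tendsto_add mean_weight_limit_Suc v tendsto_const_over_Suc)
    fix n
    let ?n = "of_nat (Suc n) :: ennreal"
    have "(\<Sum>u. mean_weight (Suc n) u * edge_weight u v) = (\<Sum>u. (\<Sum>k<Suc n. step_weight k u * edge_weight u v) * inverse ?n)"
      by (intro suminf_cong) (simp add: mean_weight_def sum_distrib_left[symmetric] divide_ennreal_def ac_simps del: of_nat_Suc sum.lessThan_Suc)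
    also have "\<dots> = (\<Sum>u. \<Sum>k<Suc n. step_weight k u * edge_weight u v) * inverse ?n" by (rule ennreal_suminf_multc)
    also have "(\<Sum>u. \<Sum>k<Suc n. step_weight k u * edge_weight u v) = (\<Sum>k<Suc n. \<Sum>u. step_weight k u * edge_weight u v)"
      by (rule suminf_sum) auto
    also have "\<dots> = (\<Sum>k<Suc n. step_weight (Suc k) v)" by (simp add: step_weight_def push_def[symmetric])
    also have "\<dots> \<le> (\<Sum>k<Suc n. step_weight k v) + step_weight (Suc n) v"
    proof -
      have "(\<Sum>k<Suc n. step_weight (Suc k) v) \<le> step_weight 0 v + (\<Sum>k<Suc n. step_weight (Suc k) v)" by (simp add: add_increasing)
      also have "\<dots> = (\<Sum>k<Suc (Suc n). step_weight k v)" by (rule sum.lessThan_Suc_shift[symmetric])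
      finally show ?thesis by simp
    qed
    also have "\<dots> \<le> (\<Sum>k<Suc n. step_weight k v) + ennreal c" using step_weight_bound[OF v] by (intro add_left_mono) (simp add: c_def)
    finally have "(\<Sum>u. mean_weight (Suc n) u * edge_weight u v) \<le> ((\<Sum>k<Suc n. step_weight k v) + ennreal c) * inverse ?n"
      by (simp add: mult_right_mono del: of_nat_Suc sum.lessThan_Suc)
    also have "\<dots> = mean_weight (Suc n) v + ennreal c / ?n" by (simp add: mean_weight_def distrib_right divide_ennreal_def del: of_nat_Suc sum.lessThan_Suc)
    also have "ennreal c / ?n = ennreal (c / real (Suc n))"
      by (simp add: ennreal_of_nat_eq_real_of_nat divide_ennreal c_def del: of_nat_Suc)
    finally show "(\<Sum>u. mean_weight (Suc n) u * edge_weight u v) \<le> mean_weight (Suc n) v + ennreal (c / real (Suc n))" .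
  qed
  then show ?thesis by simp
qed

text \<open>Both sides have the same total mass because nothing leaks, so the inequality between them is an equality.\<close>
lemma push_height: assumes v: "v \<in> \<alpha>" shows "push (\<lambda>u. ennreal (height u)) v = ennreal (height v)"
proof -
  let ?c = "\<lambda>u. ennreal (height u)"
  have "push ?c u * emeasure \<mu> (slice tw u) = ?c u * emeasure \<mu> (slice tw u)" for u
  proof (rule suminf_eq_imp_eq_ennreal)
    show "push ?c u * emeasure \<mu> (slice tw u) \<le> ?c u * emeasure \<mu> (slice tw u)" for u
      using push_le[of u] by (cases "u \<in> \<alpha>") (auto simp: slice_tw intro: mult_right_mono)
    have "(\<Sum>u. push ?c u * emeasure \<mu> (slice tw u)) = emeasure (weighted ?c) (pre tw)"
      by (simp only: weighted_pre[OF tw_sets] emeasure_weighted[OF tw_sets])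
    then have "(\<Sum>u. push ?c u * emeasure \<mu> (slice tw u)) = 1" using h_pre_tw h_weighted by simp
    moreover have "(\<Sum>u. ?c u * emeasure \<mu> (slice tw u)) = 1" using h_tw by (simp add: emeasure_h)
    ultimately show "(\<Sum>u. push ?c u * emeasure \<mu> (slice tw u)) = (\<Sum>u. ?c u * emeasure \<mu> (slice tw u))"
      "(\<Sum>u. ?c u * emeasure \<mu> (slice tw u)) < \<infinity>" by simp_all
  qed
  from this[of v] have eq: "push ?c v * ennreal (prob (D v)) = ?c v * ennreal (prob (D v))"
    using v by (simp add: slice_tw emeasure_eq_measure)
  have one: "ennreal (prob (D v)) * ennreal (1 / prob (D v)) = 1"
    using prob_D_pos[OF lifts v] by (simp add: ennreal_mult[symmetric])
  have "push ?c v * (ennreal (prob (D v)) * ennreal (1 / prob (D v))) = ?c v * (ennreal (prob (D v)) * ennreal (1 / prob (D v)))"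
    unfolding mult.assoc[symmetric] eq ..
  then show ?thesis unfolding one by simp
qed

lemma h_pre: assumes A: "A \<in> sets tm" shows "emeasure \<mu>h (pre A) = emeasure \<mu>h A"
proof -
  have "emeasure \<mu>h (pre A) = emeasure (weighted (push (\<lambda>u. ennreal (height u)))) A"
    by (subst h_weighted) (rule weighted_pre[OF A])
  also have "\<dots> = (\<Sum>u. push (\<lambda>u. ennreal (height u)) u * emeasure \<mu> (slice A u))" by (rule emeasure_weighted[OF A])
  also have "\<dots> = emeasure \<mu>h A"
    unfolding emeasure_h[OF A]
  proof (intro suminf_cong)
    fix u show "push (\<lambda>u. ennreal (height u)) u * emeasure \<mu> (slice A u) = ennreal (height u) * emeasure \<mu> (slice A u)"
      by (cases "u \<in> \<alpha>") (simp_all add: push_height slice_empty[OF tm_subset[OF A]])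
  qed
  finally show ?thesis .
qed

lemma h_invariant: "invariant_measure \<mu>h That"
  unfolding invariant_measure_def space_h sets_h using h_pre pre_sets by blast

abbreviation eta where "eta \<equiv> distr \<mu>h \<mu> fst"

lemma fst_meas_h: "fst \<in> measurable \<mu>h \<mu>"
  using fst_meas measurable_cong_sets[OF sets_h refl] by blast

lemma emeasure_eta: "A \<in> sets \<mu> \<Longrightarrow> emeasure eta A = emeasure \<mu>h (fst -` A \<inter> tw)"
  using fst_meas_h by (subst emeasure_distr) (auto simp: space_h)

lemma eta_invariant: "invariant_measure eta T"
  unfolding invariant_measure_def
proof (intro ballI conjI)
  fix A assume "A \<in> sets eta"
  then have A: "A \<in> sets \<mu>" by simp
  then show m: "T -` A \<inter> space eta \<in> sets eta" using c2_vimage by (simp add: space_mu)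
  then have m': "T -` A \<inter> X \<in> sets \<mu>" by (simp add: space_mu)
  have "emeasure eta (T -` A \<inter> space eta) = emeasure \<mu>h (fst -` (T -` A \<inter> X) \<inter> tw)"
    using emeasure_eta[OF m'] by (simp add: space_mu)
  also have "\<dots> = emeasure \<mu>h (pre (fst -` A \<inter> tw))"
  proof (rule emeasure_eq_AE)
    show "AE z in \<mu>h. (z \<in> fst -` (T -` A \<inter> X) \<inter> tw) = (z \<in> pre (fst -` A \<inter> tw))"
      using h_AE_stays
    proof eventually_elim
      case (elim z)
      then show ?case using D_closed(2)[of "snd z"] by (cases z) (auto simp: That_simp tower_def)
    qed
  qed (use fst_vimage_sets[OF m'] pre_sets[OF fst_vimage_sets[OF A]] in simp_all)
  also have "\<dots> = emeasure \<mu>h (fst -` A \<inter> tw)" by (rule h_pre[OF fst_vimage_sets[OF A]])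
  finally show "emeasure eta (T -` A \<inter> space eta) = emeasure eta A" by (simp add: emeasure_eta[OF A])
qed

lemma weighted_step_weight_fst_le:
  assumes inv: "invariant_measure \<mu> T" and A: "A \<in> sets \<mu>"
  shows "emeasure (weighted (step_weight k)) (fst -` A \<inter> tw) \<le> emeasure \<mu> A"
proof -
  have k: "(T ^^ k) -` A \<inter> X \<in> sets \<mu> \<and> emeasure \<mu> ((T ^^ k) -` A \<inter> X) = emeasure \<mu> A"
  proof (induction k)
    case 0 then show ?case using A mu_subset by (auto simp: Int_absorb2)
  next
    case (Suc k)
    have eq: "(T ^^ Suc k) -` A \<inter> X = T -` ((T ^^ k) -` A \<inter> X) \<inter> X"
      using T_X by (auto simp: funpow_swap1)
    show ?case unfolding eq using inv Suc unfolding invariant_measure_def space_mu by metis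
  qed
  have "emeasure (weighted (step_weight k)) (fst -` A \<inter> tw) = emeasure (weighted base_weight) (pre_iter k (fst -` A \<inter> tw))"
    using weighted_pre_iter[OF fst_vimage_sets[OF A]] by (simp add: step_weight_def)
  also have "\<dots> \<le> emeasure (weighted base_weight) (fst -` ((T ^^ k) -` A \<inter> X) \<inter> tw)"
  proof (rule emeasure_mono)
    show "pre_iter k (fst -` A \<inter> tw) \<subseteq> fst -` ((T ^^ k) -` A \<inter> X) \<inter> tw"
    proof
      fix z assume z: "z \<in> pre_iter k (fst -` A \<inter> tw)"
      then have "(T ^^ k) (fst z) \<in> A" "z \<in> tw" by (auto simp: pre_iter_def fst_That)
      moreover have "fst z \<in> X" using \<open>z \<in> tw\<close> D_closed(2)[of "snd z"] by (auto simp: tower_def)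
      ultimately show "z \<in> fst -` ((T ^^ k) -` A \<inter> X) \<inter> tw" by simp
    qed
    show "fst -` ((T ^^ k) -` A \<inter> X) \<inter> tw \<in> sets (weighted base_weight)"
      unfolding sets_weighted using k by (intro fst_vimage_sets) blast
  qed
  also have "\<dots> = emeasure \<mu> A" by (simp only: weighted_base_fst[OF conjunct1[OF k]] conjunct2[OF k])
  finally show ?thesis .
qed

text \<open>For invariant \<open>\<mu>\<close> every image of the base measure projects to a measure below \<open>\<mu>\<close>, hence so does the
  lift. Two probability measures, one below the other, are equal.\<close>
lemma eta_eq_mu: assumes inv: "invariant_measure \<mu> T" shows "eta = \<mu>"
proof (rule measure_eqI)
  have le: "emeasure eta A \<le> emeasure \<mu> A" if A: "A \<in> sets \<mu>" for A
    unfolding emeasure_eta[OF A]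
  proof (rule h_le_limit[OF fst_vimage_sets[OF A] _ tendsto_const])
    fix n
    let ?n = "of_nat (Suc n) :: ennreal"
    have "(\<Sum>k<Suc n. emeasure (weighted (step_weight k)) (fst -` A \<inter> tw)) \<le> (\<Sum>k<Suc n. emeasure \<mu> A)"
      by (intro sum_mono weighted_step_weight_fst_le inv A)
    also have "\<dots> = emeasure \<mu> A * ?n" by (simp add: mult.commute del: of_nat_Suc)
    finally have "emeasure (weighted (mean_weight (Suc n))) (fst -` A \<inter> tw) \<le> emeasure \<mu> A * ?n / ?n"
      unfolding emeasure_weighted_mean_weight[OF fst_vimage_sets[OF A]] by (rule divide_right_mono_ennreal)
    then show "emeasure (weighted (mean_weight (Suc n))) (fst -` A \<inter> tw) \<le> emeasure \<mu> A"
      by (subst (asm) ennreal_mult_divide_eq) (auto simp del: of_nat_Suc)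
  qed
  interpret E: prob_space eta using prob_space.prob_space_distr[OF prob_h fst_meas_h] .
  fix A assume "A \<in> sets eta"
  then have A: "A \<in> sets \<mu>" by simp
  have "1 = E.prob A + E.prob (X - A)" using E.prob_compl[of A] A by (simp add: space_mu)
  moreover have "1 = prob A + prob (X - A)" using prob_compl[OF A] by (simp add: space_mu)
  moreover have "E.prob A \<le> prob A" "E.prob (X - A) \<le> prob (X - A)"
    using le[OF A] le[of "X - A"] A by (auto simp: E.emeasure_eq_measure emeasure_eq_measure)
  ultimately have "E.prob A = prob A" by linarith
  then show "emeasure eta A = emeasure \<mu> A" by (simp add: E.emeasure_eq_measure emeasure_eq_measure)
qed simp

end

section \<open>The past determines the level\<close>

context hofbauer_tower begin

lemma tw_fst: "z \<in> tw \<Longrightarrow> fst z \<in> X"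
  using D_closed(2)[of "snd z"] by (auto simp: tower_def)

lemma image_null_Z:
  assumes A: "A \<in> null_sets \<mu>" "A \<subseteq> (\<Union>j\<in>{1..N}. Z j)" shows "T ` A \<in> null_sets \<mu>"
proof -
  have eq: "T ` A = (\<Union>j\<in>{1..N}. T ` (A \<inter> Z j))"
  proof
    show "T ` A \<subseteq> (\<Union>j\<in>{1..N}. T ` (A \<inter> Z j))"
    proof (rule image_subsetI)
      fix x assume x: "x \<in> A"
      then obtain j where "j \<in> {1..N}" "x \<in> Z j" using A(2) by (meson UN_E subsetD)
      then show "T x \<in> (\<Union>j\<in>{1..N}. T ` (A \<inter> Z j))" using x by (intro UN_I[of j]) auto
    qed
  qed (rule UN_least, rule image_mono, rule Int_lower1)
  show ?thesis unfolding eq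
  proof (rule null_sets.finite_UN)
    fix j assume j: "j \<in> {1..N}"
    have "A \<inter> Z j \<in> null_sets \<mu>" using A(1) Z_sets[OF j] by (rule null_set_Int2)
    then show "T ` (A \<inter> Z j) \<in> null_sets \<mu>" by (rule image_null[OF j]) simp
  qed simp
qed

lemma ae_eq_trans:
  assumes "ae_eq_set \<mu> A B" "ae_eq_set \<mu> B C" "A \<in> sets \<mu>" "C \<in> sets \<mu>" shows "ae_eq_set \<mu> A C"
proof -
  have "sym_diff A B \<union> sym_diff B C \<in> null_sets \<mu>" using assms(1,2) unfolding ae_eq_set_def by (rule null_sets.Un)
  moreover have "sym_diff A C \<in> sets \<mu>" using assms(3,4) by (intro sets.Un sets.Diff)
  moreover have "sym_diff A C \<subseteq> sym_diff A B \<union> sym_diff B C" by blast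
  ultimately show ?thesis unfolding ae_eq_set_def by (rule null_sets_subset)
qed

lemma cyl_snoc: "cyl (w @ [j]) = {x \<in> cyl w. (T ^^ length w) x \<in> Z j}"
  unfolding cylinder_def by (auto simp: nth_append less_Suc_eq)

lemma image_sets:
  assumes u: "u \<in> \<alpha>" and w: "set w \<subseteq> {1..N}" "n \<le> length w"
  shows "(T ^^ n) ` (D u \<inter> cyl w) \<in> sets \<mu>"
  using u w by (intro scale_cyl(1)[of _ w]) auto

text \<open>The level reached after \<open>n\<close> steps is the image of the part of the first level in the cylinder of the starting point.\<close>
lemma level_image:
  assumes reg: "\<forall>n. regular_pt ((T ^^ n) x)" and u: "u \<in> \<alpha>" "x \<in> D u" and v: "level_at n u x \<in> \<alpha>"
  shows "ae_eq_set \<mu> (D (level_at n u x)) ((T ^^ n) ` (D u \<inter> cyl (itinerary x (Suc n))))"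
  using v
proof (induction n)
  case 0
  have "regular_pt x" using spec[OF reg, of 0] by simp
  then have "bi x = branch_of u" using regular_in_Z[OF _ branch_of(1)[OF u(1)]] branch_of(2)[OF u(1)] u(2) by blast
  then have "D u \<inter> cyl (itinerary x (Suc 0)) = D u"
    using branch_of(2)[OF u(1)] D_closed(2)[OF u(1)] by (auto simp: itinerary_def cylinder_def)
  then show ?case by (simp add: ae_eq_set_def)
next
  case (Suc n)
  let ?v = "level_at n u x" and ?w = "level_at (Suc n) u x" and ?j = "bi ((T ^^ Suc n) x)"
  let ?W = "itinerary x (Suc n)"
  let ?E = "(T ^^ n) ` (D u \<inter> cyl ?W)"
  have W: "set ?W \<subseteq> {1..N}" by (rule itinerary_set[OF reg])
  have W': "set (itinerary x (Suc (Suc n))) \<subseteq> {1..N}" by (rule itinerary_set[OF reg])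
  have e: "?v \<in> \<alpha>" "?j \<in> {1..N}" "tower_edge \<mu> Z T D ?v ?j ?w"
    using nxt_iff[OF Suc.prems] level_at_Suc[of n u x] by metis+
  have IH: "ae_eq_set \<mu> (D ?v) ?E" by (rule Suc.IH[OF e(1)])
  have E: "?E \<in> sets \<mu>" using u W by (intro image_sets) auto
  have "?E \<subseteq> Z (?W ! n)" by (auto simp: cylinder_def)
  moreover have wn: "?W ! n \<in> {1..N}" using W nth_mem[of n ?W] by (simp del: atLeastAtMost_iff add: subset_iff)
  ultimately have "sym_diff (D ?v) ?E \<subseteq> (\<Union>j\<in>{1..N}. Z j)" using branch_of[OF e(1)] by blast
  with IH have n: "T ` sym_diff (D ?v) ?E \<in> null_sets \<mu>" unfolding ae_eq_set_def by (rule image_null_Z)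
  have 1: "ae_eq_set \<mu> (D ?w) (Z ?j \<inter> T ` D ?v)" using e(3) by (simp add: tower_edge_def)
  have "sym_diff (Z ?j \<inter> T ` D ?v) (Z ?j \<inter> T ` ?E) \<subseteq> T ` sym_diff (D ?v) ?E" by blast
  moreover have "sym_diff (Z ?j \<inter> T ` D ?v) (Z ?j \<inter> T ` ?E) \<in> sets \<mu>"
    using e(1,2) c2_image[OF E] by (intro sets.Un sets.Diff sets.Int Z_sets TD_sets)
  ultimately have 2: "ae_eq_set \<mu> (Z ?j \<inter> T ` D ?v) (Z ?j \<inter> T ` ?E)"
    using n unfolding ae_eq_set_def by (meson null_sets_subset)
  have "itinerary x (Suc (Suc n)) = ?W @ [?j]" by (rule itinerary_Suc)
  then have 3: "Z ?j \<inter> T ` ?E = (T ^^ Suc n) ` (D u \<inter> cyl (itinerary x (Suc (Suc n))))"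
    by (auto simp: cyl_snoc image_iff)
  have "(T ^^ Suc n) ` (D u \<inter> cyl (itinerary x (Suc (Suc n)))) \<in> sets \<mu>" using u W' by (intro image_sets) auto
  then show ?case using ae_eq_trans[OF 1 2[unfolded 3]] D_sets[OF Suc.prems] by blast
qed

lemma prob_sym_diff_triangle:
  assumes "A \<in> sets \<mu>" "B \<in> sets \<mu>" "C \<in> sets \<mu>"
  shows "prob (sym_diff A C) \<le> prob (sym_diff A B) + prob (sym_diff B C)"
proof -
  have "prob (sym_diff A C) \<le> prob (sym_diff A B \<union> sym_diff B C)"
    using assms by (intro finite_measure_mono sets.Un sets.Diff) auto
  also have "\<dots> \<le> prob (sym_diff A B) + prob (sym_diff B C)"
    using assms by (intro measure_Un_le sets.Un sets.Diff)
  finally show ?thesis .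
qed

lemma sym_diff_commute: "sym_diff A B = sym_diff B A" by auto

text \<open>All branches are linear for \<open>\<mu>\<close>, so the proportion of the image of the cylinder which the
  level fills is the proportion of the cylinder inside the starting level.\<close>
lemma level_close:
  assumes reg: "\<forall>n. regular_pt ((T ^^ n) x)" and u: "u \<in> \<alpha>" "x \<in> D u" and v: "level_at n u x \<in> \<alpha>"
    and good: "x \<notin> bad_density (D u) \<delta> (Suc n)" and d: "0 \<le> \<delta>"
  shows "prob (sym_diff ((T ^^ n) ` cyl (itinerary x (Suc n))) (D (level_at n u x))) \<le> \<delta>"
proof -
  let ?W = "itinerary x (Suc n)"
  have W: "set ?W \<subseteq> {1..N}" by (rule itinerary_set[OF reg])
  let ?S = "\<Prod>i<n. s (?W ! i)"
  have S: "1 \<le> ?S" using W by (intro scale_pos) auto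
  let ?L = "(T ^^ n) ` cyl ?W" and ?E = "(T ^^ n) ` (D u \<inter> cyl ?W)"
  have sL: "?L \<in> sets \<mu>" and eL: "emeasure \<mu> ?L = ennreal ?S * emeasure \<mu> (cyl ?W)"
    using scale_cyl[OF cyl_sets[OF W] subset_refl W, of n] by auto
  have "D u \<inter> cyl ?W \<in> sets \<mu>" using u W by auto
  from scale_cyl[OF this Int_lower2 W, of n]
  have sE: "?E \<in> sets \<mu>" and eE: "emeasure \<mu> ?E = ennreal ?S * emeasure \<mu> (D u \<inter> cyl ?W)" by auto
  have pL: "prob ?L = ?S * prob (cyl ?W)" and pE: "prob ?E = ?S * prob (D u \<inter> cyl ?W)"
    using eL eE S by (simp_all add: emeasure_eq_measure ennreal_mult[symmetric])
  have "sym_diff ?L ?E = ?L - ?E" by auto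
  then have "prob (sym_diff ?L ?E) = prob ?L - prob ?E"
    using sL sE by (simp add: finite_measure_Diff image_mono)
  also have "\<dots> = ?S * (prob (cyl ?W) - prob (D u \<inter> cyl ?W))" unfolding pL pE by (simp add: algebra_simps)
  also have "prob (cyl ?W) - prob (D u \<inter> cyl ?W) = prob (cyl ?W - D u)"
  proof -
    have "cyl ?W - D u = cyl ?W - (D u \<inter> cyl ?W)" by auto
    moreover have "prob (cyl ?W - (D u \<inter> cyl ?W)) = prob (cyl ?W) - prob (D u \<inter> cyl ?W)"
      using W u by (intro finite_measure_Diff) auto
    ultimately show ?thesis by simp
  qed
  also have "?S * prob (cyl ?W - D u) \<le> ?S * (\<delta> * prob (cyl ?W))"
    using good u(2) S by (intro mult_left_mono) (auto simp: bad_density_def)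
  also have "\<dots> = \<delta> * prob ?L" unfolding pL by simp
  also have "\<dots> \<le> \<delta>" using d mult_left_mono[OF prob_le_1[of ?L], of \<delta>] by simp
  finally have 1: "prob (sym_diff ?L ?E) \<le> \<delta>" .
  have "sym_diff ?E (D (level_at n u x)) \<in> null_sets \<mu>"
    using level_image[OF reg u v] unfolding ae_eq_set_def by (subst sym_diff_commute)
  then have "prob (sym_diff ?E (D (level_at n u x))) = 0" by (simp add: null_sets_def measure_def)
  then show ?thesis using prob_sym_diff_triangle[OF sL sE D_sets[OF v]] 1 by linarith
qed

text \<open>Points whose cylinder of order \<open>n + 1\<close> is mapped after \<open>n\<close> steps to nearly all of \<open>D v\<close>, and to little
  else. The condition involves the base system only.\<close>
definition past_like :: "nat \<Rightarrow> real \<Rightarrow> nat \<Rightarrow> 'a set" where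
  "past_like v \<delta> n = {x \<in> X. prob (sym_diff ((T ^^ n) ` cyl (itinerary x (Suc n))) (D v)) < \<delta>}"

lemma past_like_sets[simp]: "past_like v \<delta> n \<in> sets \<mu>"
proof -
  have "past_like v \<delta> n = {x \<in> X. itinerary x (Suc n) \<in> {w. prob (sym_diff ((T ^^ n) ` cyl w) (D v)) < \<delta>}}"
    by (simp add: past_like_def)
  then show ?thesis by (simp del: mem_Collect_eq)
qed

text \<open>The measures on the tower whose levels can be recovered from the past: invariant probability
  measures that are bounded on each level by a multiple of \<open>\<mu>\<close>.\<close>
definition admissible :: "('a \<times> nat) measure \<Rightarrow> bool" where
  "admissible M \<longleftrightarrow> sets M = sets tm \<and> prob_space M \<and>
     (\<forall>A\<in>sets tm. emeasure M (pre A) = emeasure M A) \<and>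
     (\<forall>u\<in>\<alpha>. \<exists>c. \<forall>B\<in>sets \<mu>. B \<subseteq> D u \<longrightarrow> emeasure M (B \<times> {u}) \<le> ennreal c * emeasure \<mu> B)"

lemma admissibleD:
  assumes "admissible M" shows "sets M = sets tm" "prob_space M" "A \<in> sets tm \<Longrightarrow> emeasure M (pre A) = emeasure M A"
  using assms unfolding admissible_def by blast+

context
  fixes M :: "('a \<times> nat) measure"
  assumes adm: "admissible M"
begin

lemma adm_sets[simp]: "sets M = sets tm" by (rule admissibleD(1)[OF adm])
lemma adm_space: "space M = tw" using sets_eq_imp_space_eq[OF adm_sets] by (simp add: space_tm)
interpretation M: prob_space M by (rule admissibleD(2)[OF adm])

lemma adm_AE: assumes "AE x in \<mu>. Q x" shows "AE z in M. Q (fst z)"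
proof -
  obtain N where N: "{x \<in> space \<mu>. \<not> Q x} \<subseteq> N" "N \<in> sets \<mu>" "emeasure \<mu> N = 0" using AE_E[OF assms] .
  let ?A = "fst -` N \<inter> tw"
  have As: "?A \<in> sets tm" using N(2) by (rule fst_vimage_sets)
  have "emeasure M ?A = (\<Sum>u. if u \<in> \<alpha> then emeasure M (slice ?A u \<times> {u}) else 0)"
    by (rule emeasure_levels[OF adm_sets As])
  also have "\<dots> = (\<Sum>u. 0)"
  proof (intro suminf_cong)
    fix u
    have "emeasure M (slice ?A u \<times> {u}) = 0" if u: "u \<in> \<alpha>"
    proof -
      obtain c where c: "\<forall>B\<in>sets \<mu>. B \<subseteq> D u \<longrightarrow> emeasure M (B \<times> {u}) \<le> ennreal c * emeasure \<mu> B"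
        using adm u unfolding admissible_def by blast
      have "slice ?A u \<subseteq> N" by auto
      from emeasure_mono[OF this N(2)] have "emeasure \<mu> (slice ?A u) = 0" using N(3) by simp
      moreover have "slice ?A u \<subseteq> D u" by (rule slice_subset[OF tm_subset[OF As] u])
      ultimately show ?thesis using c slice_sets[OF As, of u] by fastforce
    qed
    then show "(if u \<in> \<alpha> then emeasure M (slice ?A u \<times> {u}) else 0) = 0" by simp
  qed
  finally have "?A \<in> null_sets M" using As by (intro null_setsI) auto
  then show ?thesis
  proof (rule AE_I')
    show "{z \<in> space M. \<not> Q (fst z)} \<subseteq> ?A"
    proof
      fix z assume z: "z \<in> {z \<in> space M. \<not> Q (fst z)}"
      then have "z \<in> tw" by (simp add: adm_space)
      then have "fst z \<in> X" using D_closed(2)[of "snd z"] by (auto simp: tower_def)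
      then show "z \<in> ?A" using z N(1) by (auto simp: adm_space space_mu)
    qed
  qed
qed

lemma adm_pre: "A \<in> sets tm \<Longrightarrow> emeasure M (pre A) = emeasure M A"
  by (rule admissibleD(3)[OF adm])

lemma adm_AE_step: "AE z in M. That z \<in> tw"
proof -
  have "emeasure M (pre tw) = 1" using adm_pre[OF tw_sets] M.emeasure_space_1 by (simp add: adm_space)
  then have "M.prob (pre tw) = 1" by (simp add: M.emeasure_eq_measure)
  then have "AE z in M. z \<in> pre tw" by (subst M.prob_eq_1[symmetric]) auto
  then show ?thesis by eventually_elim auto
qed

text \<open>One step at a time, peeling off the first iterate, so that only the behaviour of a single step matters.\<close>
lemma adm_pre_iter: "A \<in> sets tm \<Longrightarrow> emeasure M (pre_iter n A) = emeasure M A"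
proof (induction n)
  case 0
  have "pre_iter 0 A = A" using tm_subset[OF 0] by (auto simp: pre_iter_def)
  then show ?case by simp
next
  case (Suc n)
  have "emeasure M (pre_iter (Suc n) A) = emeasure M (pre (pre_iter n A))"
  proof (rule emeasure_eq_AE)
    show "AE z in M. (z \<in> pre_iter (Suc n) A) = (z \<in> pre (pre_iter n A))"
      using adm_AE_step by eventually_elim (auto simp: pre_iter_def funpow_Suc_right simp del: funpow.simps)
  qed (use pre_iter_sets[OF Suc.prems] pre_sets in auto)
  then show ?case using Suc by (simp add: adm_pre)
qed

lemma adm_AE_stays: "AE z in M. \<forall>n. (That ^^ n) z \<in> tw"
  unfolding AE_all_countable
proof
  fix n
  have "emeasure M (pre_iter n tw) = 1" using adm_pre_iter[OF tw_sets] M.emeasure_space_1 by (simp add: adm_space)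
  then have "M.prob (pre_iter n tw) = 1" by (simp add: M.emeasure_eq_measure)
  then have "AE z in M. z \<in> pre_iter n tw" by (subst M.prob_eq_1[symmetric]) auto
  then show "AE z in M. (That ^^ n) z \<in> tw" by eventually_elim (auto simp: pre_iter_def)
qed

definition bad_tower :: "real \<Rightarrow> nat \<Rightarrow> ('a \<times> nat) set" where
  "bad_tower \<delta> m = {z \<in> tw. fst z \<in> bad_density (D (snd z)) \<delta> m}"

lemma slice_bad_tower: "u \<in> \<alpha> \<Longrightarrow> slice (bad_tower \<delta> m) u = bad_density (D u) \<delta> m"
  by (auto simp: bad_tower_def tower_def bad_density_def)

lemma bad_tower_sets[simp]: "bad_tower \<delta> m \<in> sets tm"
  unfolding sets_tm_iff
proof (intro conjI allI)
  show sub: "bad_tower \<delta> m \<subseteq> tw" by (auto simp: bad_tower_def)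
  fix u show "slice (bad_tower \<delta> m) u \<in> sets \<mu>"
    by (cases "u \<in> \<alpha>") (simp_all add: slice_bad_tower slice_empty[OF sub])
qed

text \<open>Convergence on each level, with the masses of the levels as a summable majorant.\<close>
lemma bad_tower_tendsto:
  assumes d: "0 < \<delta>" shows "(\<lambda>m. emeasure M (bad_tower \<delta> m)) \<longlonglongrightarrow> 0"
proof -
  let ?f = "\<lambda>m u. if u \<in> \<alpha> then emeasure M (bad_density (D u) \<delta> m \<times> {u}) else 0"
  let ?w = "\<lambda>u. if u \<in> \<alpha> then emeasure M (D u \<times> {u}) else 0"
  have sub: "bad_density (D u) \<delta> m \<subseteq> D u" for u m by (auto simp: bad_density_def)
  have eq: "emeasure M (bad_tower \<delta> m) = (\<integral>\<^sup>+u. ?f m u \<partial>count_space UNIV)" for m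
    unfolding nn_integral_count_space_nat emeasure_levels[OF adm_sets bad_tower_sets]
    by (intro suminf_cong) (simp add: slice_bad_tower)
  have w1: "(\<integral>\<^sup>+u. ?w u \<partial>count_space UNIV) = 1"
  proof -
    have "(\<integral>\<^sup>+u. ?w u \<partial>count_space UNIV) = emeasure M tw"
      unfolding nn_integral_count_space_nat emeasure_levels[OF adm_sets tw_sets]
      by (intro suminf_cong) (simp add: slice_tw)
    then show ?thesis using M.emeasure_space_1 by (simp add: adm_space)
  qed
  have "(\<lambda>m. \<integral>\<^sup>+u. ?f m u \<partial>count_space UNIV) \<longlonglongrightarrow> (\<integral>\<^sup>+u. 0 \<partial>count_space (UNIV::nat set))"
  proof (rule nn_integral_dominated_convergence[where w="?w"])
    show "AE u in count_space UNIV. ?f m u \<le> ?w u" for m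
    proof (rule AE_I2)
      fix u
      show "?f m u \<le> ?w u"
        using sub[of u m] prod_sets[of u "D u"] by (cases "u \<in> \<alpha>") (auto intro!: emeasure_mono)
    qed
    show "AE u in count_space UNIV. (\<lambda>m. ?f m u) \<longlonglongrightarrow> 0"
    proof (rule AE_I2)
      fix u
      show "(\<lambda>m. ?f m u) \<longlonglongrightarrow> 0"
      proof (cases "u \<in> \<alpha>")
        case True
        obtain c where c: "\<forall>B\<in>sets \<mu>. B \<subseteq> D u \<longrightarrow> emeasure M (B \<times> {u}) \<le> ennreal c * emeasure \<mu> B"
          using adm True unfolding admissible_def by blast
        have "(\<lambda>m. ennreal (prob (bad_density (D u) \<delta> m))) \<longlonglongrightarrow> ennreal 0"
          by (intro tendsto_ennrealI bad_density_tendsto D_sets True d)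
        then have "(\<lambda>m. ennreal c * emeasure \<mu> (bad_density (D u) \<delta> m)) \<longlonglongrightarrow> ennreal c * 0"
          by (intro ennreal_tendsto_cmult) (simp_all add: emeasure_eq_measure)
        then have "(\<lambda>m. ennreal c * emeasure \<mu> (bad_density (D u) \<delta> m)) \<longlonglongrightarrow> 0" by simp
        then have "(\<lambda>m. emeasure M (bad_density (D u) \<delta> m \<times> {u})) \<longlonglongrightarrow> 0"
          by (rule tendsto_sandwich[OF _ _ tendsto_const, rotated 2])
            (use c sub True in \<open>auto intro!: always_eventually\<close>)
        then show ?thesis using True by simp
      qed simp
    qed
  qed (use w1 in auto)
  then show ?thesis by (simp add: eq)
qed

lemma adm_tight:
  assumes e: "0 < \<epsilon>" shows "\<exists>U. M.prob {z \<in> tw. U \<le> snd z} < \<epsilon>"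
proof -
  have s: "{z \<in> tw. U \<le> snd z} \<in> sets M" for U
  proof -
    have "slice {z \<in> tw. U \<le> snd z} u = (if U \<le> u then slice tw u else {})" for u by auto
    then have "{z \<in> tw. U \<le> snd z} \<in> sets tm" by (auto simp: sets_tm_iff slice_tw)
    then show ?thesis by simp
  qed
  have "(\<lambda>U. M.prob {z \<in> tw. U \<le> snd z}) \<longlonglongrightarrow> M.prob (\<Inter>U. {z \<in> tw. U \<le> snd z})"
    using s by (intro M.finite_Lim_measure_decseq) (auto simp: decseq_def)
  moreover have "(\<Inter>U. {z \<in> tw. U \<le> snd z}) = {}" using Suc_n_not_le_n by blast
  ultimately have "(\<lambda>U. M.prob {z \<in> tw. U \<le> snd z}) \<longlonglongrightarrow> 0" by simp
  from LIMSEQ_D[OF this e] show ?thesis by auto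
qed

text \<open>Up to small measure, being on level \<open>v\<close> after \<open>n\<close> steps is a condition on the base coordinate of the
  starting point alone. Most of the mass is on finitely many levels, which are separated from \<open>D v\<close> by some
  \<open>2 * \<delta>\<close> in measure; the image of the cylinder is within \<open>\<delta> / 2\<close> of the actual level, so it is close
  to \<open>D v\<close> only if that level is \<open>v\<close>.\<close>
theorem level_from_past:
  assumes v: "v \<in> \<alpha>" and e: "0 < \<epsilon>"
  shows "\<exists>\<delta>0>0. \<forall>\<delta>. 0 < \<delta> \<and> \<delta> \<le> \<delta>0 \<longrightarrow>
    (\<forall>\<^sub>F n in sequentially. M.prob (sym_diff (pre_iter n (level D v)) (fst -` past_like v \<delta> n \<inter> tw)) \<le> \<epsilon>)"
proof -
  obtain U where U: "M.prob {z \<in> tw. U \<le> snd z} < \<epsilon> / 2" using adm_tight[of "\<epsilon> / 2"] e by auto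
  let ?G = "(\<lambda>u. prob (sym_diff (D u) (D v)) / 2) ` {u \<in> \<alpha>. u < U \<and> u \<noteq> v}"
  (* half the distance from level v to the other levels below U, or 1 if there are none *)
  define \<delta>0 where "\<delta>0 = Min (insert 1 ?G)"
  have finG: "finite (insert 1 ?G)" by auto
  have "0 < g" if "g \<in> ?G" for g
  proof -
    from that obtain u where u: "u \<in> \<alpha>" "u \<noteq> v" "g = prob (sym_diff (D u) (D v)) / 2" by blast
    have "sym_diff (D u) (D v) \<notin> null_sets \<mu>" using D_unique[OF u(1) v] u(2) by (auto simp: ae_eq_set_def)
    moreover have "sym_diff (D u) (D v) \<in> sets \<mu>" using u v by (intro sets.Un sets.Diff D_sets)
    ultimately have "emeasure \<mu> (sym_diff (D u) (D v)) \<noteq> 0" by (simp add: null_sets_def)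
    then show ?thesis unfolding u(3) by (simp add: emeasure_eq_measure zero_less_measure_iff)
  qed
  then have d0: "0 < \<delta>0" unfolding \<delta>0_def using finG by (subst Min_gr_iff) auto
  have sep: "2 * \<delta>0 \<le> prob (sym_diff (D u) (D v))" if "u \<in> \<alpha>" "u < U" "u \<noteq> v" for u
  proof -
    have "\<delta>0 \<le> prob (sym_diff (D u) (D v)) / 2" unfolding \<delta>0_def using finG that by (intro Min_le) auto
    then show ?thesis by simp
  qed
  let ?H = "{z \<in> tw. U \<le> snd z}"
  have H: "?H \<in> sets tm"
  proof -
    have "slice ?H u = (if U \<le> u then slice tw u else {})" for u by auto
    then show ?thesis by (auto simp: sets_tm_iff slice_tw)
  qed
  show ?thesis
  proof (intro exI[of _ \<delta>0] conjI d0 allI impI)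
    fix \<delta> assume d: "0 < \<delta> \<and> \<delta> \<le> \<delta>0"
    have "(\<lambda>m. M.prob (bad_tower (\<delta> / 2) m)) \<longlonglongrightarrow> 0"
      using bad_tower_tendsto[of "\<delta> / 2"] d by (simp add: M.emeasure_eq_measure ennreal_tendsto_0_iff)
    then have "(\<lambda>n. M.prob (bad_tower (\<delta> / 2) (Suc n))) \<longlonglongrightarrow> 0" by (rule LIMSEQ_Suc)
    then have "\<forall>\<^sub>F n in sequentially. M.prob (bad_tower (\<delta> / 2) (Suc n)) < \<epsilon> / 2"
      using e by (intro order_tendstoD) auto
    then show "\<forall>\<^sub>F n in sequentially. M.prob (sym_diff (pre_iter n (level D v)) (fst -` past_like v \<delta> n \<inter> tw)) \<le> \<epsilon>"
    proof eventually_elim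
      case (elim n)
      let ?S = "sym_diff (pre_iter n (level D v)) (fst -` past_like v \<delta> n \<inter> tw)"
      have "AE z in M. z \<in> ?S \<longrightarrow> z \<in> bad_tower (\<delta> / 2) (Suc n) \<union> pre_iter n ?H"
        using adm_AE[OF AE_orbit[OF AE_regular_pt]] adm_AE_stays AE_space
      proof eventually_elim
        case (elim z)
        obtain x u where z: "z = (x, u)" by fastforce
        have reg: "\<forall>n. regular_pt ((T ^^ n) x)" using elim(1) z by simp
        have u: "u \<in> \<alpha>" "x \<in> D u" using elim(3) z by (auto simp: adm_space tower_def)
        have lvn: "level_at n u x \<in> \<alpha>" "(T ^^ n) x \<in> D (level_at n u x)"
          using elim(2) z unfolding That_pow by (auto simp: That_pow tower_def)
        have xX: "x \<in> X" using u D_closed(2) by blast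
        let ?L = "(T ^^ n) ` cyl (itinerary x (Suc n))"
        show ?case
        proof (intro impI, rule ccontr)
          assume zS: "z \<in> ?S" and neg: "z \<notin> bad_tower (\<delta> / 2) (Suc n) \<union> pre_iter n ?H"
          have nb: "x \<notin> bad_density (D u) (\<delta> / 2) (Suc n)" using neg z u by (auto simp: bad_tower_def tower_def)
          have close: "prob (sym_diff ?L (D (level_at n u x))) \<le> \<delta> / 2"
            using level_close[OF reg u lvn(1) nb] d by simp
          show False
          proof (cases "level_at n u x = v")
            case True
            then have "prob (sym_diff ?L (D v)) < \<delta>" using close d by simp
            then have "z \<in> fst -` past_like v \<delta> n \<inter> tw" using z u xX by (simp add: past_like_def tower_def)
            moreover have "z \<in> pre_iter n (level D v)" using True lvn z u unfolding pre_iter_def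
              by (simp add: That_pow level_def tower_def)
            ultimately show False using zS by blast
          next
            case False
            then have "z \<notin> pre_iter n (level D v)" using z unfolding pre_iter_def by (simp add: That_pow level_def)
            then have "x \<in> past_like v \<delta> n" using zS z by auto
            then have 1: "prob (sym_diff ?L (D v)) < \<delta>" by (simp add: past_like_def)
            have "\<not> U \<le> level_at n u x"
              using neg z u lvn unfolding pre_iter_def by (auto simp: That_pow tower_def)
            then have 2: "2 * \<delta>0 \<le> prob (sym_diff (D (level_at n u x)) (D v))" using sep[OF lvn(1)] False by simp
            have "set (itinerary x (Suc n)) \<subseteq> {1..N}" by (rule itinerary_set[OF reg])
            then have sL: "?L \<in> sets \<mu>" by (intro scale_cyl(1)[of _ "itinerary x (Suc n)"]) auto
            have "prob (sym_diff (D (level_at n u x)) (D v)) \<le> prob (sym_diff (D (level_at n u x)) ?L) + prob (sym_diff ?L (D v))"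
              by (rule prob_sym_diff_triangle[OF D_sets[OF lvn(1)] sL D_sets[OF v]])
            also have "sym_diff (D (level_at n u x)) ?L = sym_diff ?L (D (level_at n u x))" by (rule sym_diff_commute)
            finally show False using 1 2 close d by linarith
          qed
        qed
      qed
      then have "M.prob ?S \<le> M.prob (bad_tower (\<delta> / 2) (Suc n) \<union> pre_iter n ?H)"
        using pre_iter_sets[OF H] by (intro M.finite_measure_mono_AE) auto
      also have "\<dots> \<le> M.prob (bad_tower (\<delta> / 2) (Suc n)) + M.prob (pre_iter n ?H)"
        using pre_iter_sets[OF H] by (intro measure_Un_le) auto
      also have "M.prob (pre_iter n ?H) = M.prob ?H" using adm_pre_iter[OF H] by (simp add: measure_def)
      finally show ?case using U elim by simp
    qed
  qed
qed

end

text \<open>The measure of a piece \<open>B\<close> of level \<open>v\<close> is approximated by the \<open>\<mu>\<close>-measure of a set of starting points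
  that is the same for both measures.\<close>
lemma admissible_unique:
  assumes a: "admissible M" "admissible M'"
    and p: "\<And>A. A \<in> sets \<mu> \<Longrightarrow> emeasure M (fst -` A \<inter> tw) = emeasure \<mu> A"
    and p': "\<And>A. A \<in> sets \<mu> \<Longrightarrow> emeasure M' (fst -` A \<inter> tw) = emeasure \<mu> A"
  shows "M = M'"
proof (rule measure_eqI)
  show "sets M = sets M'" using admissibleD(1)[OF a(1)] admissibleD(1)[OF a(2)] by simp
  have est: "\<bar>measure M (B \<times> {v}) - prob (past_like v \<delta> n \<inter> ((T ^^ n) -` B \<inter> X))\<bar> \<le> \<epsilon>"
    if M: "admissible M" and p: "\<And>A. A \<in> sets \<mu> \<Longrightarrow> emeasure M (fst -` A \<inter> tw) = emeasure \<mu> A"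
      and v: "v \<in> \<alpha>" and B: "B \<in> sets \<mu>" "B \<subseteq> D v"
      and le: "measure M (sym_diff (pre_iter n (level D v)) (fst -` past_like v \<delta> n \<inter> tw)) \<le> \<epsilon>"
    for M v B \<epsilon> \<delta> n
  proof -
    interpret M: prob_space M by (rule admissibleD(2)[OF M])
    have sM: "sets M = sets tm" by (rule admissibleD(1)[OF M])
    let ?W = "(T ^^ n) -` B \<inter> X"
    have W: "?W \<in> sets \<mu>" using measurable_sets[OF Tn_meas B(1)] by (simp add: space_mu)
    let ?P = "pre_iter n (B \<times> {v})" and ?Q = "fst -` (past_like v \<delta> n \<inter> ?W) \<inter> tw"
    let ?S = "sym_diff (pre_iter n (level D v)) (fst -` past_like v \<delta> n \<inter> tw)"
    have sP: "?P \<in> sets M" unfolding sM by (intro pre_iter_sets prod_sets v B)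
    have sQ: "?Q \<in> sets M" unfolding sM using W by (intro fst_vimage_sets) auto
    have sS: "?S \<in> sets M" unfolding sM using v by (intro sets.Un sets.Diff pre_iter_sets level_sets fst_vimage_sets past_like_sets)
    have PQ: "?P - ?Q \<subseteq> ?S" "?Q - ?P \<subseteq> ?S"
      using B(2) tw_fst by (fastforce simp: pre_iter_def That_pow level_def tower_def)+
    have "M.prob ?P \<le> M.prob (?Q \<union> ?S)" by (rule M.finite_measure_mono[OF _ sets.Un[OF sQ sS]]) (use PQ in blast)
    also have "\<dots> \<le> M.prob ?Q + M.prob ?S" using sQ sS by (intro measure_Un_le)
    finally have 1: "M.prob ?P \<le> M.prob ?Q + \<epsilon>" using le by simp
    have "M.prob ?Q \<le> M.prob (?P \<union> ?S)" by (rule M.finite_measure_mono[OF _ sets.Un[OF sP sS]]) (use PQ in blast)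
    also have "\<dots> \<le> M.prob ?P + M.prob ?S" using sP sS by (intro measure_Un_le)
    finally have 2: "M.prob ?Q \<le> M.prob ?P + \<epsilon>" using le by simp
    have "M.prob ?P = M.prob (B \<times> {v})" using adm_pre_iter[OF M prod_sets[OF v B]] by (simp add: measure_def)
    moreover have "M.prob ?Q = prob (past_like v \<delta> n \<inter> ?W)"
      unfolding measure_def using W by (subst p) auto
    ultimately show ?thesis using 1 2 by linarith
  qed
  have eq: "measure M (B \<times> {v}) = measure M' (B \<times> {v})" if v: "v \<in> \<alpha>" and B: "B \<in> sets \<mu>" "B \<subseteq> D v" for v B
  proof (rule ccontr)
    assume ne: "measure M (B \<times> {v}) \<noteq> measure M' (B \<times> {v})"
    define \<epsilon> where "\<epsilon> = \<bar>measure M (B \<times> {v}) - measure M' (B \<times> {v})\<bar> / 3"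
    have e: "0 < \<epsilon>" using ne by (simp add: \<epsilon>_def)
    obtain d1 where d1: "0 < d1" "\<And>\<delta>. 0 < \<delta> \<and> \<delta> \<le> d1 \<Longrightarrow>
       (\<forall>\<^sub>F n in sequentially. measure M (sym_diff (pre_iter n (level D v)) (fst -` past_like v \<delta> n \<inter> tw)) \<le> \<epsilon>)"
      using level_from_past[OF a(1) v e] by blast
    obtain d2 where d2: "0 < d2" "\<And>\<delta>. 0 < \<delta> \<and> \<delta> \<le> d2 \<Longrightarrow>
       (\<forall>\<^sub>F n in sequentially. measure M' (sym_diff (pre_iter n (level D v)) (fst -` past_like v \<delta> n \<inter> tw)) \<le> \<epsilon>)"
      using level_from_past[OF a(2) v e] by blast
    let ?d = "min d1 d2"
    have "\<forall>\<^sub>F n in sequentially. measure M (sym_diff (pre_iter n (level D v)) (fst -` past_like v ?d n \<inter> tw)) \<le> \<epsilon> \<and>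
        measure M' (sym_diff (pre_iter n (level D v)) (fst -` past_like v ?d n \<inter> tw)) \<le> \<epsilon>"
      using d1 d2 by (intro eventually_conj) auto
    then obtain n where "measure M (sym_diff (pre_iter n (level D v)) (fst -` past_like v ?d n \<inter> tw)) \<le> \<epsilon>"
        "measure M' (sym_diff (pre_iter n (level D v)) (fst -` past_like v ?d n \<inter> tw)) \<le> \<epsilon>"
      using eventually_happens'[OF sequentially_bot] by blast
    from est[OF a(1) p v B this(1)] est[OF a(2) p' v B this(2)]
    have "\<bar>measure M (B \<times> {v}) - measure M' (B \<times> {v})\<bar> \<le> 2 * \<epsilon>" by linarith
    then show False using e by (simp add: \<epsilon>_def)
  qed
  fix A assume "A \<in> sets M"
  then have A: "A \<in> sets tm" using admissibleD(1)[OF a(1)] by simp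
  interpret M: prob_space M by (rule admissibleD(2)[OF a(1)])
  interpret M': prob_space M' by (rule admissibleD(2)[OF a(2)])
  show "emeasure M A = emeasure M' A"
    unfolding emeasure_levels[OF adm_sets[OF a(1)] A] emeasure_levels[OF adm_sets[OF a(2)] A]
    using eq[OF _ slice_sets[OF A] slice_subset[OF tm_subset[OF A]]]
    by (intro suminf_cong) (simp add: M.emeasure_eq_measure M'.emeasure_eq_measure)
qed

lemma invariant_lift_admissible:
  assumes M: "invariant_lift \<mu> N Z T \<alpha> D M"
  shows "admissible M" "\<And>A. A \<in> sets \<mu> \<Longrightarrow> emeasure M (fst -` A \<inter> tw) = emeasure \<mu> A"
proof -
  have sM: "sets M = sets tm" and inv: "invariant_measure M That" and d: "distr M \<mu> fst = \<mu>"
    using M by (auto simp: invariant_lift_def)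
  have sp: "space M = tw" using sets_eq_imp_space_eq[OF sM] by (simp add: space_tm)
  have fm: "fst \<in> measurable M \<mu>" using fst_meas measurable_cong_sets[OF sM refl] by blast
  show p: "emeasure M (fst -` A \<inter> tw) = emeasure \<mu> A" if "A \<in> sets \<mu>" for A
    using emeasure_distr[OF fm that] by (simp add: d sp)
  have "fst z \<in> X" if "z \<in> tw" for z using that D_closed(2)[of "snd z"] by (auto simp: tower_def)
  then have "fst -` X \<inter> tw = tw" by auto
  then have "emeasure M tw = 1" using p[OF X_sets] emeasure_space_1 by (simp add: space_mu)
  then have pr: "prob_space M" by (intro prob_spaceI) (simp add: sp)
  have "emeasure M (B \<times> {u}) \<le> ennreal 1 * emeasure \<mu> B" if "u \<in> \<alpha>" "B \<in> sets \<mu>" "B \<subseteq> D u" for u B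
  proof -
    have "emeasure M (B \<times> {u}) \<le> emeasure M (fst -` B \<inter> tw)"
      using that fst_vimage_sets[OF that(2)] by (intro emeasure_mono) (auto simp: sM tower_def)
    then show ?thesis using p[OF that(2)] by simp
  qed
  then have "\<forall>u\<in>\<alpha>. \<exists>c. \<forall>B\<in>sets \<mu>. B \<subseteq> D u \<longrightarrow> emeasure M (B \<times> {u}) \<le> ennreal c * emeasure \<mu> B" by blast
  moreover have "\<forall>A\<in>sets tm. emeasure M (pre A) = emeasure M A"
    using inv unfolding invariant_measure_def sM sp by blast
  ultimately show "admissible M" using sM pr unfolding admissible_def by blast
qed

end

context lifted_tower begin

lemma emeasure_h_level: "u \<in> \<alpha> \<Longrightarrow> B \<in> sets \<mu> \<Longrightarrow> B \<subseteq> D u \<Longrightarrow> emeasure \<mu>h (B \<times> {u}) = ennreal (height u) * emeasure \<mu> B"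
  using lift_eq[OF lifts] by (simp add: height_def)

lemma h_admissible: "admissible \<mu>h"
proof -
  have "\<exists>c. \<forall>B\<in>sets \<mu>. B \<subseteq> D u \<longrightarrow> emeasure \<mu>h (B \<times> {u}) \<le> ennreal c * emeasure \<mu> B" if "u \<in> \<alpha>" for u
    using emeasure_h_level[OF that] by (intro exI[of _ "height u"]) simp
  then show ?thesis using prob_h h_pre sets_h unfolding admissible_def by blast
qed

lemma invariant_lift_iff:
  assumes inv: "invariant_measure \<mu> T" shows "invariant_lift \<mu> N Z T \<alpha> D M \<longleftrightarrow> M = \<mu>h"
proof
  assume M: "invariant_lift \<mu> N Z T \<alpha> D M"
  show "M = \<mu>h"
  proof (rule admissible_unique[OF invariant_lift_admissible(1)[OF M] h_admissible invariant_lift_admissible(2)[OF M]])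
    show "emeasure \<mu>h (fst -` A \<inter> tw) = emeasure \<mu> A" if "A \<in> sets \<mu>" for A
      using emeasure_eta[OF that] eta_eq_mu[OF inv] by simp
  qed
next
  assume "M = \<mu>h"
  then show "invariant_lift \<mu> N Z T \<alpha> D M"
    using h_invariant eta_eq_mu[OF inv] by (simp add: invariant_lift_def)
qed

end

section \<open>The measure on the rugs\<close>

definition rug_slice :: "(('a \<times> nat) \<times> real) set \<Rightarrow> nat \<Rightarrow> ('a \<times> real) set" where
  "rug_slice C u = {p. ((fst p, u), snd p) \<in> C}"

lemma rug_slice_iff[simp]: "p \<in> rug_slice C u \<longleftrightarrow> ((fst p, u), snd p) \<in> C" by (simp add: rug_slice_def)

(* as a congruence rule this would turn lborel into borel inside product measures *)
declare sets_pair_measure_cong [cong del]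

context lifted_tower begin

abbreviation tl where "tl \<equiv> tm \<Otimes>\<^sub>M (lborel :: real measure)"
abbreviation ml where "ml \<equiv> \<mu> \<Otimes>\<^sub>M (lborel :: real measure)"

lemma space_tl: "space tl = tw \<times> UNIV" by (simp add: space_pair_measure space_tm)
lemma space_ml: "space ml = X \<times> UNIV" by (simp add: space_pair_measure space_mu)

lemma tl_subset: "C \<in> sets tl \<Longrightarrow> C \<subseteq> tw \<times> UNIV"
  using sets.sets_into_space[of C tl] by (simp add: space_tl)

lemma rug_slice_sub: "C \<subseteq> tw \<times> UNIV \<Longrightarrow> rug_slice C u \<subseteq> slice tw u \<times> UNIV" by auto
lemma rug_slice_empty: "C \<subseteq> tw \<times> UNIV \<Longrightarrow> u \<notin> \<alpha> \<Longrightarrow> rug_slice C u = {}"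
  using rug_slice_sub[of C u] by (auto simp: slice_tw)

text \<open>The rugs are handled level by level, as subsets of \<open>X \<times> \<real>\<close>.\<close>
lemma sets_tl_iff: "C \<in> sets tl \<longleftrightarrow> C \<subseteq> tw \<times> UNIV \<and> (\<forall>u. rug_slice C u \<in> sets ml)"
proof
  assume C: "C \<in> sets tl"
  have "rug_slice C u \<in> sets ml" for u
  proof -
    have "C \<in> sigma_sets (tw \<times> UNIV) {a \<times> b |a b. a \<in> sets tm \<and> b \<in> sets lborel}"
      using C by (simp add: sets_pair_measure space_tm)
    then show ?thesis
    proof induction
      case (Basic c)
      then obtain a b where ab: "c = a \<times> b" "a \<in> sets tm" "b \<in> sets lborel" by auto
      have "rug_slice c u = slice a u \<times> b" unfolding ab(1) by auto
      then show ?case using pair_measureI[OF slice_sets[OF ab(2), of u] ab(3)] by simp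
    next
      case Empty then show ?case by (simp add: rug_slice_def)
    next
      case (Compl c)
      have "rug_slice (tw \<times> UNIV - c) u = slice tw u \<times> UNIV - rug_slice c u" by auto
      moreover have "slice tw u \<times> (UNIV :: real set) \<in> sets ml" by (intro pair_measureI) (auto simp: slice_tw)
      ultimately show ?case using Compl.IH sets.Diff by metis
    next
      case (Union c)
      have "rug_slice (\<Union> (range c)) u = (\<Union>i. rug_slice (c i) u)" by auto
      moreover have "(\<Union>i. rug_slice (c i) u) \<in> sets ml" using Union.IH by (intro sets.countable_UN) auto
      ultimately show ?case by simp
    qed
  qed
  then show "C \<subseteq> tw \<times> UNIV \<and> (\<forall>u. rug_slice C u \<in> sets ml)" using tl_subset[OF C] by blast
next
  assume C: "C \<subseteq> tw \<times> UNIV \<and> (\<forall>u. rug_slice C u \<in> sets ml)"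
  have m1: "(\<lambda>z. (fst (fst z), snd z)) \<in> measurable tl ml" by measurable
  have m2: "(\<lambda>z. snd (fst z)) \<in> measurable tl (count_space UNIV)" by measurable
  have "((\<lambda>z. (fst (fst z), snd z)) -` rug_slice C u \<inter> space tl) \<inter> ((\<lambda>z. snd (fst z)) -` {u} \<inter> space tl) \<in> sets tl" for u
    using C by (intro sets.Int measurable_sets[OF m1] measurable_sets[OF m2]) auto
  then have "(\<Union>u. ((\<lambda>z. (fst (fst z), snd z)) -` rug_slice C u \<inter> space tl) \<inter> ((\<lambda>z. snd (fst z)) -` {u} \<inter> space tl)) \<in> sets tl"
    by (intro sets.countable_UN image_subsetI)
  moreover have "(\<Union>u. ((\<lambda>z. (fst (fst z), snd z)) -` rug_slice C u \<inter> space tl) \<inter> ((\<lambda>z. snd (fst z)) -` {u} \<inter> space tl)) = C"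
    using C by (auto simp: space_tl)
  ultimately show "C \<in> sets tl" by simp
qed

lemma rug_slice_sets[simp]: "C \<in> sets tl \<Longrightarrow> rug_slice C u \<in> sets ml" by (simp add: sets_tl_iff)

lemma emeasure_tl: assumes C: "C \<in> sets tl" shows "emeasure tl C = (\<Sum>u. emeasure ml (rug_slice C u))"
proof -
  have meas: "(\<lambda>z. emeasure lborel (Pair z -` C)) \<in> borel_measurable tm"
    using C by (rule lborel.measurable_emeasure_Pair)
  have "emeasure tl C = (\<integral>\<^sup>+z. emeasure lborel (Pair z -` C) \<partial>tm)"
    using C by (rule lborel.emeasure_pair_measure_alt)
  also have "\<dots> = (\<Sum>u. if u \<in> \<alpha> then \<integral>\<^sup>+x. emeasure lborel (Pair (x, u) -` C) * indicator (D u) x \<partial>\<mu> else 0)"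
    by (rule nn_integral_tm[OF meas])
  also have "\<dots> = (\<Sum>u. emeasure ml (rug_slice C u))"
  proof (intro suminf_cong)
    fix u
    show "(if u \<in> \<alpha> then \<integral>\<^sup>+x. emeasure lborel (Pair (x, u) -` C) * indicator (D u) x \<partial>\<mu> else 0) = emeasure ml (rug_slice C u)"
    proof (cases "u \<in> \<alpha>")
      case True
      have "emeasure ml (rug_slice C u) = (\<integral>\<^sup>+x. emeasure lborel (Pair x -` rug_slice C u) \<partial>\<mu>)"
        using C by (intro lborel.emeasure_pair_measure_alt) simp
      also have "\<dots> = (\<integral>\<^sup>+x. emeasure lborel (Pair (x, u) -` C) * indicator (D u) x \<partial>\<mu>)"
      proof (intro nn_integral_cong)
        fix x
        have "Pair x -` rug_slice C u = Pair (x, u) -` C" by auto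
        moreover have "Pair (x, u) -` C = {}" if "x \<notin> D u" using that tl_subset[OF C] by (auto simp: tower_def)
        ultimately show "emeasure lborel (Pair x -` rug_slice C u) = emeasure lborel (Pair (x, u) -` C) * indicator (D u) x"
          by (cases "x \<in> D u") auto
      qed
      finally show ?thesis using True by simp
    qed (simp add: rug_slice_empty[OF tl_subset[OF C]])
  qed
  finally show ?thesis .
qed

definition charged :: "nat set" where "charged = {u \<in> \<alpha>. 0 < height u}"

lemma charged_alpha: "u \<in> charged \<Longrightarrow> u \<in> \<alpha>" and charged_height: "u \<in> charged \<Longrightarrow> 0 < height u" by (auto simp: charged_def)

lemma positive_levels_eq: "positive_levels \<alpha> D \<mu>h = charged"
proof -
  have "0 < emeasure \<mu>h (level D u) \<longleftrightarrow> 0 < height u" if "u \<in> \<alpha>" for u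
    using emeasure_h_level[OF that D_sets[OF that]] D_pos[OF that]
    by (auto simp: level_def ennreal_zero_less_mult_iff)
  then show ?thesis by (auto simp: positive_levels_def charged_def)
qed

lemma density_height: "u \<in> \<alpha> \<Longrightarrow> level_density \<mu> \<alpha> D \<mu>h u = height u" by (simp add: height_def)

abbreviation R where "R \<equiv> rugs \<mu> \<alpha> D \<mu>h"
abbreviation nu where "nu \<equiv> rug_measure \<mu> \<alpha> D \<mu>h"
abbreviation F where "F \<equiv> rug_map \<mu> N Z T s \<alpha> D \<mu>h"

lemma R_eq: "R = {z. snd (fst z) \<in> charged \<and> fst (fst z) \<in> D (snd (fst z)) \<and> 0 \<le> snd z \<and> snd z \<le> height (snd (fst z))}"
  unfolding rugs_def positive_levels_eq level_def
  by (auto simp: density_height[OF charged_alpha] dest: charged_alpha)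

lemma rug_slice_R: "rug_slice R u = (if u \<in> charged then D u \<times> {0..height u} else {})"
  by (auto simp: R_eq)

lemma R_sets[simp]: "R \<in> sets tl"
  unfolding sets_tl_iff
proof (intro conjI allI)
  show "R \<subseteq> tw \<times> UNIV" by (auto simp: R_eq tower_def dest: charged_alpha)
  fix u show "rug_slice R u \<in> sets ml"
    unfolding rug_slice_R by (auto intro!: pair_measureI dest: charged_alpha)
qed

lemma sets_nu: "C \<in> sets nu \<longleftrightarrow> C \<in> sets tl \<and> C \<subseteq> R"
  unfolding rug_measure_def using sets.sets_into_space[OF R_sets]
  by (subst sets_restrict_space_iff) (auto simp: Int_absorb2)

lemma space_nu: "space nu = R"
  using sets.sets_into_space[OF R_sets] by (auto simp: rug_measure_def space_restrict_space)

lemma nu_tl: "C \<in> sets nu \<Longrightarrow> C \<in> sets tl" and nu_R: "C \<in> sets nu \<Longrightarrow> C \<subseteq> R" by (auto simp: sets_nu)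

lemma emeasure_nu: assumes C: "C \<in> sets nu" shows "emeasure nu C = (\<Sum>u. emeasure ml (rug_slice C u))"
proof -
  have "emeasure nu C = emeasure tl C"
    unfolding rug_measure_def using C sets.sets_into_space[OF R_sets]
    by (intro emeasure_restrict_space) (auto simp: sets_nu Int_absorb2)
  then show ?thesis using emeasure_tl[OF nu_tl[OF C]] by simp
qed

lemma emeasure_ml_Times: "A \<in> sets \<mu> \<Longrightarrow> B \<in> sets borel \<Longrightarrow> emeasure ml (A \<times> B) = emeasure \<mu> A * emeasure lborel B"
  by (subst lborel.emeasure_pair_measure_Times) auto

text \<open>The rug over a level has the density of the lift as its height, so the rug measure projects to the lift.\<close>
lemma nu_fst:
  assumes B: "B \<in> sets tm" shows "{z \<in> R. fst z \<in> B} \<in> sets nu" "emeasure nu {z \<in> R. fst z \<in> B} = emeasure \<mu>h B"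
proof -
  let ?C = "{z \<in> R. fst z \<in> B}"
  have s: "rug_slice ?C u = (if u \<in> charged then slice B u \<times> {0..height u} else {})" for u
    using slice_subset[OF tm_subset[OF B], of u] charged_alpha[of u] by (auto simp: R_eq subset_iff)
  have "?C \<subseteq> tw \<times> UNIV" using tl_subset[OF R_sets] by auto
  then have "?C \<in> sets tl" unfolding sets_tl_iff s using B by auto
  then show C: "?C \<in> sets nu" by (auto simp: sets_nu)
  show "emeasure nu ?C = emeasure \<mu>h B"
    unfolding emeasure_nu[OF C] emeasure_h[OF B] s
  proof (intro suminf_cong)
    fix u
    show "emeasure ml (if u \<in> charged then slice B u \<times> {0..height u} else {}) = ennreal (height u) * emeasure \<mu> (slice B u)"
    proof (cases "u \<in> charged")
      case True then show ?thesis using B by (simp add: emeasure_ml_Times mult.commute)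
    next
      case False
      then have "height u = 0 \<or> slice B u = {}"
        using height_nonneg[of u] slice_empty[OF tm_subset[OF B], of u] by (auto simp: charged_def)
      then show ?thesis using False by auto
    qed
  qed
qed

lemma prob_nu: "prob_space nu"
proof
  have "{z \<in> R. fst z \<in> tw} = R" using tl_subset[OF R_sets] by auto
  then show "emeasure nu (space nu) = 1" using nu_fst(2)[OF tw_sets] h_tw by (simp add: space_nu)
qed

section \<open>Tiles\<close>

text \<open>The height of the strip into which the rug over \<open>t\<close> is mapped in the rug over \<open>v\<close>; it is zero if there is no arrow.\<close>
definition tile_height :: "nat \<Rightarrow> nat \<Rightarrow> real" where "tile_height v t = (if t \<in> charged \<and> arr t v then height t / slope t else 0)"
definition tile_start :: "nat \<Rightarrow> nat \<Rightarrow> real" where "tile_start v u = (\<Sum>t<u. tile_height v t)"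

lemma slope_pos: "u \<in> \<alpha> \<Longrightarrow> 0 < slope u" using slope_ge[of u] by linarith

lemma tile_height_nonneg[simp]: "0 \<le> tile_height v t"
  using slope_pos[of t] by (auto simp: tile_height_def dest: charged_alpha)

lemma tile_start_Suc: "tile_start v (Suc u) = tile_start v u + tile_height v u" by (simp add: tile_start_def)
lemma tile_start_nonneg: "0 \<le> tile_start v u" by (simp add: tile_start_def sum_nonneg)
lemma tile_start_mono: "t \<le> u \<Longrightarrow> tile_start v t \<le> tile_start v u"
  by (induction u rule: dec_induct) (auto simp: tile_start_Suc intro: add_increasing2)

text \<open>The strips fill the rug: this is the invariance equation for the densities.\<close>
lemma tile_height_sums: assumes v: "v \<in> \<alpha>" shows "tile_height v sums height v"
proof -
  have "ennreal (height u) * edge_weight u v = ennreal (tile_height v u)" for u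
  proof (cases "u \<in> charged")
    case True
    then show ?thesis using v slope_pos[of u] by (auto simp: edge_weight_def tile_height_def ennreal_mult[symmetric] dest: charged_alpha)
  next
    case False
    then show ?thesis using height_nonneg[of u] by (auto simp: edge_weight_def tile_height_def charged_def)
  qed
  then have s: "(\<Sum>u. ennreal (tile_height v u)) = ennreal (height v)" using push_height[OF v] by (simp add: push_def)
  then have "summable (tile_height v)" by (intro summable_suminf_not_top) auto
  moreover have "suminf (tile_height v) = height v"
  proof -
    have "ennreal (suminf (tile_height v)) = ennreal (height v)" using suminf_ennreal2[OF _ \<open>summable (tile_height v)\<close>] s by simp
    then show ?thesis using suminf_nonneg[OF \<open>summable (tile_height v)\<close>] by simp
  qed
  ultimately show ?thesis by (simp add: sums_iff)
qed

lemma tile_start_limit: "v \<in> \<alpha> \<Longrightarrow> tile_start v \<longlonglongrightarrow> height v"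
  using tile_height_sums[of v] by (simp add: sums_def tile_start_def[abs_def])

lemma tile_start_le: "v \<in> \<alpha> \<Longrightarrow> tile_start v u \<le> height v"
  by (rule LIMSEQ_le_const[OF tile_start_limit]) (auto intro: tile_start_mono)

lemma tile_unique: "tile_start v u \<le> y \<Longrightarrow> y < tile_start v (Suc u) \<Longrightarrow> tile_start v u' \<le> y \<Longrightarrow> y < tile_start v (Suc u') \<Longrightarrow> u = u'"
  using tile_start_mono[of "Suc u" u' v] tile_start_mono[of "Suc u'" u v] by (cases u u' rule: linorder_cases) auto

text \<open>The strips are stacked in the order of the indices, so there is no room between them even if there are infinitely many.\<close>
lemma tile_UN: assumes v: "v \<in> \<alpha>" shows "(\<Union>u. {tile_start v u..<tile_start v (Suc u)}) = {0..<height v}"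
proof
  show "(\<Union>u. {tile_start v u..<tile_start v (Suc u)}) \<subseteq> {0..<height v}"
  proof (rule UN_least, rule subsetI)
    fix u y assume y: "y \<in> {tile_start v u..<tile_start v (Suc u)}"
    show "y \<in> {0..<height v}" using y tile_start_nonneg[of v u] tile_start_le[OF v, of "Suc u"] by auto
  qed
  show "{0..<height v} \<subseteq> (\<Union>u. {tile_start v u..<tile_start v (Suc u)})"
  proof
    fix y assume y: "y \<in> {0..<height v}"
    then have "\<forall>\<^sub>F u in sequentially. y < tile_start v u" using order_tendstoD(1)[OF tile_start_limit[OF v]] by auto
    then obtain u0 where "y < tile_start v u0" by (auto simp: eventually_sequentially)
    then have ex: "\<exists>u. y < tile_start v u" by blast
    define m where "m = (LEAST u. y < tile_start v u)"
    have m: "y < tile_start v m" unfolding m_def using ex by (rule LeastI_ex)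
    have "tile_start v 0 = 0" by (simp add: tile_start_def)
    then have "m \<noteq> 0" using m y by (metis atLeastLessThan_iff linorder_not_le)
    then obtain k where k: "m = Suc k" by (cases m) auto
    have "\<not> y < tile_start v k" using not_less_Least[of k "\<lambda>u. y < tile_start v u"] k unfolding m_def[symmetric] by simp
    then show "y \<in> (\<Union>u. {tile_start v u..<tile_start v (Suc u)})" using m k by (intro UN_I[of k]) auto
  qed
qed

lemma arr_pos: assumes "u \<in> charged" "v \<in> \<alpha>" "arr u v" shows "v \<in> charged"
proof -
  have "0 < tile_height v u" using assms charged_height[of u] slope_pos[of u] by (auto simp: tile_height_def dest: charged_alpha)
  also have "tile_height v u \<le> height v" using tile_start_le[OF assms(2), of "Suc u"] tile_start_nonneg[of v u] by (simp add: tile_start_Suc)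
  finally show ?thesis using assms(2) by (simp add: charged_def)
qed

text \<open>The double sum in the definition of the rug map collapses, because each level lies in exactly one piece.\<close>
lemma tile_start_eq: "tile_start v u = (\<Sum>k\<in>{1..N}. \<Sum>t\<in>{t \<in> positive_levels \<alpha> D \<mu>h. t < u \<and> D t \<subseteq> Z k \<and> arr t v}. level_density \<mu> \<alpha> D \<mu>h t / s k)"
proof -
  have "(\<Sum>k\<in>{1..N}. \<Sum>t\<in>{t \<in> positive_levels \<alpha> D \<mu>h. t < u \<and> D t \<subseteq> Z k \<and> arr t v}. level_density \<mu> \<alpha> D \<mu>h t / s k)
     = (\<Sum>k\<in>{1..N}. \<Sum>t<u. if t \<in> charged \<and> D t \<subseteq> Z k \<and> arr t v then height t / s k else 0)"
  proof (rule sum.cong, rule refl)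
    fix k
    have "(\<Sum>t\<in>{t \<in> positive_levels \<alpha> D \<mu>h. t < u \<and> D t \<subseteq> Z k \<and> arr t v}. level_density \<mu> \<alpha> D \<mu>h t / s k)
        = (\<Sum>t\<in>{t \<in> {..<u}. t \<in> charged \<and> D t \<subseteq> Z k \<and> arr t v}. height t / s k)"
      unfolding positive_levels_eq by (intro sum.cong) (auto simp: density_height dest: charged_alpha)
    also have "\<dots> = (\<Sum>t<u. if t \<in> charged \<and> D t \<subseteq> Z k \<and> arr t v then height t / s k else 0)"
      by (rule sum.inter_filter) simp
    finally show "(\<Sum>t\<in>{t \<in> positive_levels \<alpha> D \<mu>h. t < u \<and> D t \<subseteq> Z k \<and> arr t v}. level_density \<mu> \<alpha> D \<mu>h t / s k)
      = (\<Sum>t<u. if t \<in> charged \<and> D t \<subseteq> Z k \<and> arr t v then height t / s k else 0)" .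
  qed
  also have "\<dots> = (\<Sum>t<u. \<Sum>k\<in>{1..N}. if t \<in> charged \<and> D t \<subseteq> Z k \<and> arr t v then height t / s k else 0)" by (rule sum.swap)
  also have "\<dots> = tile_start v u"
    unfolding tile_start_def
  proof (rule sum.cong, rule refl)
    fix t
    show "(\<Sum>k\<in>{1..N}. if t \<in> charged \<and> D t \<subseteq> Z k \<and> arr t v then height t / s k else 0) = tile_height v t"
    proof (cases "t \<in> charged")
      case True
      then have t: "t \<in> \<alpha>" by (rule charged_alpha)
      have iff: "D t \<subseteq> Z k \<longleftrightarrow> k = branch_of t" if "k \<in> {1..N}" for k using branch_of_unique[OF t that] branch_of(2)[OF t] by blast
      have "(\<Sum>k\<in>{1..N}. if t \<in> charged \<and> D t \<subseteq> Z k \<and> arr t v then height t / s k else 0)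
          = (\<Sum>k\<in>{1..N}. if k = branch_of t then tile_height v t else 0)"
        using iff True by (intro sum.cong refl) (auto simp: tile_height_def slope_def)
      also have "\<dots> = tile_height v t" by (subst sum.delta) (use branch_of(1)[OF t] in auto)
      finally show ?thesis .
    qed (simp add: tile_height_def)
  qed
  finally show ?thesis ..
qed

lemma F_eq: "F ((x, u), y) = ((T x, nxt u (bi (T x))), y / s (bi x) + tile_start (nxt u (bi (T x))) u)"
  unfolding rug_map_def tile_start_eq by (simp add: That_simp Let_def)

lemma fst_F: "fst (F z) = That (fst z)"
  by (cases z) (auto simp: rug_map_def Let_def)

section \<open>Injectivity of the rug map\<close>

text \<open>Besides following the arrows exactly, such a point does not leave the tower from a level charged by the lift.\<close>
definition core_pt :: "'a \<Rightarrow> bool" where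
  "core_pt x \<longleftrightarrow> regular_pt x \<and> good_step x \<and> (\<forall>u\<in>\<alpha>. 0 < height u \<longrightarrow> x \<in> D u \<longrightarrow> That (x, u) \<in> tw)"

lemma AE_core_pt: "AE x in \<mu>. core_pt x"
proof -
  have "AE x in \<mu>. \<forall>u. u \<in> \<alpha> \<and> 0 < height u \<longrightarrow> x \<in> D u \<longrightarrow> That (x, u) \<in> tw"
    unfolding AE_all_countable using no_leak by (auto intro!: AE_impI)
  with AE_regular_pt AE_good_step show ?thesis by eventually_elim (auto simp: core_pt_def)
qed

text \<open>Chosen once and for all, so that all sets below have the same exceptional null set.\<close>
definition G :: "'a set" where
  "G = (SOME G. G \<in> sets \<mu> \<and> X - G \<in> null_sets \<mu> \<and> (\<forall>x\<in>G. core_pt x \<and> T x \<in> G))"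

lemma G: "G \<in> sets \<mu>" "X - G \<in> null_sets \<mu>" "x \<in> G \<Longrightarrow> core_pt x" "x \<in> G \<Longrightarrow> T x \<in> G"
proof -
  have "\<exists>G. G \<in> sets \<mu> \<and> X - G \<in> null_sets \<mu> \<and> (\<forall>x\<in>G. core_pt x \<and> T x \<in> G)"
    using invariant_core[OF AE_core_pt] by metis
  then have "G \<in> sets \<mu> \<and> X - G \<in> null_sets \<mu> \<and> (\<forall>x\<in>G. core_pt x \<and> T x \<in> G)" unfolding G_def by (rule someI_ex)
  then show "G \<in> sets \<mu>" "X - G \<in> null_sets \<mu>" "x \<in> G \<Longrightarrow> core_pt x" "x \<in> G \<Longrightarrow> T x \<in> G" by blast+
qed

lemma G_X: "G \<subseteq> X" using mu_subset[OF G(1)] .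
lemma AE_G: "AE x in \<mu>. x \<in> G"
  using AE_not_in[OF G(2)] AE_space by eventually_elim (simp add: space_mu)

lemma G_branch_of: "x \<in> G \<Longrightarrow> u \<in> \<alpha> \<Longrightarrow> x \<in> D u \<Longrightarrow> bi x = branch_of u"
  using G(3)[of x] regular_in_Z[of x "branch_of u"] branch_of[of u] unfolding core_pt_def by blast

lemma G_nxt:
  assumes "x \<in> G" "u \<in> charged" "x \<in> D u"
  shows "nxt u (bi (T x)) \<in> charged" "arr u (nxt u (bi (T x)))" "T x \<in> D (nxt u (bi (T x)))"
proof -
  have u: "u \<in> \<alpha>" "0 < height u" using assms(2) by (auto simp: charged_def)
  have c: "core_pt x" using G(3) assms(1) .
  then have "That (x, u) \<in> tw" using u assms(3) unfolding core_pt_def by blast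
  then have v: "nxt u (bi (T x)) \<in> \<alpha>" by (simp add: That_simp tower_def)
  then show a: "arr u (nxt u (bi (T x)))" "T x \<in> D (nxt u (bi (T x)))"
    using c u assms(3) unfolding core_pt_def good_step_def by blast+
  show "nxt u (bi (T x)) \<in> charged" using arr_pos[OF assms(2) v a(1)] .
qed

lemma G_nxt_iff:
  assumes "x \<in> G" "u \<in> \<alpha>" "x \<in> D u" "v \<in> \<alpha>" shows "nxt u (bi (T x)) = v \<longleftrightarrow> arr u v \<and> T x \<in> D v"
  using G(3)[OF assms(1)] assms unfolding core_pt_def good_step_def by blast

lemma T_inj_G: "u \<in> \<alpha> \<Longrightarrow> inj_on T (D u \<inter> G)"
proof (rule inj_onI)
  fix x y assume u: "u \<in> \<alpha>" and xy: "x \<in> D u \<inter> G" "y \<in> D u \<inter> G" "T x = T y"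
  have "bi x = bi y" using G_branch_of[OF _ u] xy by auto
  moreover have "regular_pt x" "regular_pt y" using G(3) xy unfolding core_pt_def by auto
  ultimately show "x = y" using regular_inj xy(3) by blast
qed

text \<open>The rugs over good base points. They are half open in the vertical direction, so that the strips in one
  rug are disjoint.\<close>
definition Q :: "(('a \<times> nat) \<times> real) set" where
  "Q = {z. snd (fst z) \<in> charged \<and> fst (fst z) \<in> D (snd (fst z)) \<inter> G \<and> 0 \<le> snd z \<and> snd z < height (snd (fst z))}"

lemma Q_iff: "((x, u), y) \<in> Q \<longleftrightarrow> u \<in> charged \<and> x \<in> D u \<and> x \<in> G \<and> 0 \<le> y \<and> y < height u"
  by (auto simp: Q_def)

lemma Q_R: "Q \<subseteq> R" by (auto simp: Q_def R_eq)

lemma rug_slice_Q: "rug_slice Q u = (if u \<in> charged then (D u \<inter> G) \<times> {0..<height u} else {})"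
  by (auto simp: Q_def)

lemma Q_sets[simp]: "Q \<in> sets tl"
  unfolding sets_tl_iff
proof (intro conjI allI)
  show "Q \<subseteq> tw \<times> UNIV" using Q_R tl_subset[OF R_sets] by blast
  fix u show "rug_slice Q u \<in> sets ml"
    unfolding rug_slice_Q using G(1) by (auto intro!: pair_measureI sets.Int D_sets charged_alpha)
qed

lemma Q_nu[simp]: "Q \<in> sets nu" using Q_R by (simp add: sets_nu)

lemma nu_Q: "emeasure nu Q = 1"
proof -
  have "emeasure nu Q = emeasure nu R"
    unfolding emeasure_nu[OF Q_nu] emeasure_nu[OF sets.top[of nu, unfolded space_nu]] rug_slice_Q rug_slice_R
  proof (intro suminf_cong)
    fix u
    have "emeasure \<mu> (D u \<inter> G) = emeasure \<mu> (D u)" if "u \<in> charged"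
      by (rule emeasure_eq_AE) (use AE_G G(1) charged_alpha[OF that] in \<open>auto elim: eventually_mono\<close>)
    then show "emeasure ml (if u \<in> charged then (D u \<inter> G) \<times> {0..<height u} else {}) = emeasure ml (if u \<in> charged then D u \<times> {0..height u} else {})"
      using G(1) by (simp add: emeasure_ml_Times charged_alpha sets.Int)
  qed
  then show ?thesis using prob_space.emeasure_space_1[OF prob_nu] by (simp add: space_nu)
qed

lemma F_Q_eq:
  assumes "((x, u), y) \<in> Q"
  shows "F ((x, u), y) = ((T x, nxt u (bi (T x))), y / slope u + tile_start (nxt u (bi (T x))) u)"
  using assms G_branch_of[of x u] charged_alpha[of u] by (auto simp: F_eq Q_iff slope_def)

lemma F_tile:
  assumes z: "((x, u), y) \<in> Q" and v: "v = nxt u (bi (T x))"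
  shows "tile_start v u \<le> y / slope u + tile_start v u" "y / slope u + tile_start v u < tile_start v (Suc u)"
proof -
  have u: "u \<in> charged" "x \<in> D u" "x \<in> G" "0 \<le> y" "y < height u" using z by (auto simp: Q_iff)
  have slope: "0 < slope u" using slope_pos[OF charged_alpha[OF u(1)]] .
  show "tile_start v u \<le> y / slope u + tile_start v u" using u(4) slope by simp
  have "tile_height v u = height u / slope u" using G_nxt(2)[OF u(3,1,2)] u(1) v by (simp add: tile_height_def)
  then show "y / slope u + tile_start v u < tile_start v (Suc u)" using u(5) slope by (simp add: tile_start_Suc divide_strict_right_mono)
qed

lemma F_Q: "z \<in> Q \<Longrightarrow> F z \<in> Q"
proof -
  assume zQ: "z \<in> Q"
  obtain x u y where z: "z = ((x, u), y)" by (metis prod.collapse)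
  define v where "v = nxt u (bi (T x))"
  have u: "u \<in> charged" "x \<in> D u" "x \<in> G" using zQ z by (auto simp: Q_iff)
  have v: "v \<in> charged" "T x \<in> D v" using G_nxt[OF u(3,1,2)] by (auto simp: v_def)
  have t: "tile_start v u \<le> y / slope u + tile_start v u" "y / slope u + tile_start v u < tile_start v (Suc u)"
    using F_tile[OF zQ[unfolded z] v_def] by auto
  have "0 \<le> y / slope u + tile_start v u" using t(1) tile_start_nonneg[of v u] by linarith
  moreover have "y / slope u + tile_start v u < height v" using t(2) tile_start_le[OF charged_alpha[OF v(1)], of "Suc u"] by linarith
  ultimately show "F z \<in> Q" using v G(4)[OF u(3)] F_Q_eq[OF zQ[unfolded z]]
    by (simp add: z Q_iff v_def[symmetric])
qed

text \<open>The height of the image determines the strip and so the level; on a level the branch is injective.\<close>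
lemma F_inj: "inj_on F Q"
proof (rule inj_onI)
  fix z z' assume zQ: "z \<in> Q" "z' \<in> Q" and eq: "F z = F z'"
  obtain x u y where z: "z = ((x, u), y)" by (metis prod.collapse)
  obtain x' u' y' where z': "z' = ((x', u'), y')" by (metis prod.collapse)
  note Q = zQ[unfolded z z']
  define v where "v = nxt u (bi (T x))"
  have e: "T x = T x'" "v = nxt u' (bi (T x'))" "y / slope u + tile_start v u = y' / slope u' + tile_start v u'"
    using eq F_Q_eq[OF Q(1)] F_Q_eq[OF Q(2)] by (auto simp: z z' v_def)
  have uu: "u = u'" using F_tile[OF Q(1) v_def] F_tile[OF Q(2) e(2)] e(3) tile_unique by metis
  have u: "u \<in> \<alpha>" using Q(1) charged_alpha by (auto simp: Q_iff)
  have "y = y'" using e(3) slope_pos[OF u] uu by simp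
  moreover have "x = x'" using inj_onD[OF T_inj_G[OF u] e(1)] Q uu by (auto simp: Q_iff)
  ultimately show "z = z'" using z z' uu by simp
qed

end

section \<open>Preimages and images under the rug map\<close>

context lifted_tower begin

text \<open>The points over level \<open>u\<close> which the rug map sends into \<open>E\<close> over level \<open>v\<close>.\<close>
definition piece :: "nat \<Rightarrow> nat \<Rightarrow> ('a \<times> real) set \<Rightarrow> ('a \<times> real) set" where
  "piece u v E = {p. fst p \<in> D u \<inter> G \<and> T (fst p) \<in> D v \<and> 0 \<le> snd p \<and> snd p < height u \<and>
     (T (fst p), snd p / slope u + tile_start v u) \<in> E}"

lemma piece_sets:
  assumes u: "u \<in> \<alpha>" and v: "v \<in> \<alpha>" and E: "E \<in> sets ml" shows "piece u v E \<in> sets ml"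
proof -
  have m: "(\<lambda>p. (T (fst p), snd p / slope u + tile_start v u)) \<in> measurable ml ml" by measurable
  have "piece u v E = ((D u \<inter> G \<inter> (T -` D v \<inter> X)) \<times> {0..<height u}) \<inter> ((\<lambda>p. (T (fst p), snd p / slope u + tile_start v u)) -` E \<inter> space ml)"
    using G_X by (auto simp: piece_def space_ml)
  moreover have "(D u \<inter> G \<inter> (T -` D v \<inter> X)) \<times> {0..<height u} \<in> sets ml"
    by (rule pair_measureI) (auto intro!: sets.Int D_sets u v G(1) c2_vimage simp: Int_assoc)
  ultimately show ?thesis using measurable_sets[OF m E] by (simp add: sets.Int)
qed

lemma lborel_affine:
  assumes S: "S \<in> sets borel" and c: "0 < (c::real)"
  shows "emeasure lborel {y. y / c + t \<in> S} = ennreal c * emeasure lborel S"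
proof -
  have "(\<lambda>y::real. y / c + t) \<in> borel_measurable borel" by measurable
  from measurable_sets[OF this S] have m: "{y. y / c + t \<in> S} \<in> sets borel" by (simp add: vimage_def)
  have "emeasure lborel S = (\<integral>\<^sup>+y. indicator S y \<partial>lborel)" using S by simp
  also have "\<dots> = ennreal \<bar>1 / c\<bar> * (\<integral>\<^sup>+y. indicator S (t + (1 / c) * y) \<partial>lborel)"
    using S c by (intro nn_integral_real_affine) auto
  also have "(\<integral>\<^sup>+y. indicator S (t + (1 / c) * y) \<partial>lborel) = (\<integral>\<^sup>+y. indicator {y. y / c + t \<in> S} y \<partial>lborel)"
    by (intro nn_integral_cong) (auto simp: indicator_def add.commute)
  also have "\<dots> = emeasure lborel {y. y / c + t \<in> S}" using m by simp
  finally have "ennreal c * emeasure lborel S = (ennreal c * ennreal (1 / c)) * emeasure lborel {y. y / c + t \<in> S}"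
    using c by (simp add: mult.assoc)
  also have "ennreal c * ennreal (1 / c) = 1" using c by (simp add: ennreal_mult[symmetric])
  finally show ?thesis by simp
qed

text \<open>The base is expanded by the slope and the fibre is contracted by the slope, so the rug map preserves
  measure between a rug and its strip.\<close>
lemma piece_emeasure:
  assumes u: "u \<in> charged" and v: "v \<in> \<alpha>" and a: "arr u v" and E: "E \<in> sets ml"
  shows "emeasure ml (piece u v E) = emeasure ml (E \<inter> (D v \<times> {tile_start v u..<tile_start v (Suc u)}))"
proof -
  have ua: "u \<in> \<alpha>" using u by (rule charged_alpha)
  have slope: "0 < slope u" by (rule slope_pos[OF ua])
  have tile_height: "tile_height v u = height u / slope u" using u a by (simp add: tile_height_def)
  let ?E = "E \<inter> (D v \<times> {tile_start v u..<tile_start v (Suc u)})"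
  have Es: "?E \<in> sets ml" using E v by (intro sets.Int pair_measureI) auto
  define g where "g x = emeasure lborel (Pair x -` ?E)" for x
  have gm: "g \<in> borel_measurable \<mu>" unfolding g_def using Es by (rule lborel.measurable_emeasure_Pair)
  have fib: "emeasure lborel (Pair x -` piece u v E) = ennreal (slope u) * (g (T x) * indicator (D u) x)" if x: "x \<in> G" for x
  proof (cases "x \<in> D u")
    case True
    have eq: "Pair x -` piece u v E = {y. y / slope u + tile_start v u \<in> Pair (T x) -` ?E}"
      using True x slope tile_height by (auto simp: piece_def tile_start_Suc field_simps)
    have "Pair (T x) -` ?E \<in> sets lborel" by (rule sets_Pair1[OF Es])
    then have "Pair (T x) -` ?E \<in> sets borel" by (simp only: sets_lborel)
    from lborel_affine[OF this slope, of "tile_start v u"]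
    have "emeasure lborel (Pair x -` piece u v E) = ennreal (slope u) * emeasure lborel (Pair (T x) -` ?E)"
      unfolding eq .
    then show ?thesis using True by (simp only: g_def indicator_simps mult_1_right)
  qed (auto simp: piece_def)
  have "emeasure ml (piece u v E) = (\<integral>\<^sup>+x. emeasure lborel (Pair x -` piece u v E) \<partial>\<mu>)"
    using piece_sets[OF ua v E] by (rule lborel.emeasure_pair_measure_alt)
  also have "\<dots> = (\<integral>\<^sup>+x. ennreal (slope u) * (g (T x) * indicator (D u) x) \<partial>\<mu>)"
    using AE_G by (intro nn_integral_cong_AE) (auto simp: fib elim: eventually_mono)
  also have "\<dots> = ennreal (slope u) * (\<integral>\<^sup>+x. g (T x) * indicator (D u) x \<partial>\<mu>)"
    using measurable_compose[OF T_meas gm] ua by (intro nn_integral_cmult borel_measurable_times_ennreal borel_measurable_indicator) auto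
  also have "(\<integral>\<^sup>+x. g (T x) * indicator (D u) x \<partial>\<mu>) = ennreal (1 / slope u) * (\<integral>\<^sup>+x. g x * indicator (T ` D u) x \<partial>\<mu>)"
    unfolding slope_def using branch_of[OF ua] ua gm by (intro branch_nn_integral) auto
  also have "ennreal (slope u) * \<dots> = (\<integral>\<^sup>+x. g x * indicator (T ` D u) x \<partial>\<mu>)"
    using slope by (simp add: mult.assoc[symmetric] ennreal_mult[symmetric])
  also have "\<dots> = (\<integral>\<^sup>+x. g x \<partial>\<mu>)"
  proof (rule nn_integral_cong_AE)
    show "AE x in \<mu>. g x * indicator (T ` D u) x = g x" using AE_arr[OF ua v a]
    proof eventually_elim
      case (elim x)
      show ?case
      proof (cases "x \<in> D v")
        case False
        then have "Pair x -` ?E = {}" by auto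
        then show ?thesis by (simp add: g_def)
      qed (use elim in simp)
    qed
  qed
  also have "\<dots> = emeasure ml ?E" unfolding g_def using Es by (rule lborel.emeasure_pair_measure_alt[symmetric])
  finally show ?thesis .
qed

definition arrow_piece :: "nat \<Rightarrow> nat \<Rightarrow> ('a \<times> real) set \<Rightarrow> ('a \<times> real) set" where
  "arrow_piece u v E = (if u \<in> charged \<and> v \<in> \<alpha> \<and> arr u v then piece u v E else {})"

lemma gpiece_sets: "E \<in> sets ml \<Longrightarrow> arrow_piece u v E \<in> sets ml"
  using piece_sets charged_alpha by (auto simp: arrow_piece_def)

lemma rug_slice_F_preimage: "rug_slice (F -` C \<inter> Q) u = (\<Union>v. arrow_piece u v (rug_slice C v))"
proof (rule set_eqI)
  fix p :: "'a \<times> real"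
  obtain x y where p: "p = (x, y)" by fastforce
  show "p \<in> rug_slice (F -` C \<inter> Q) u \<longleftrightarrow> p \<in> (\<Union>v. arrow_piece u v (rug_slice C v))"
  proof
    assume "p \<in> rug_slice (F -` C \<inter> Q) u"
    then have z: "((x, u), y) \<in> Q" "F ((x, u), y) \<in> C" by (auto simp: p)
    let ?v = "nxt u (bi (T x))"
    have q: "u \<in> charged" "x \<in> D u" "x \<in> G" "0 \<le> y" "y < height u" using z(1) by (auto simp: Q_iff)
    have v: "?v \<in> charged" "arr u ?v" "T x \<in> D ?v" using G_nxt[OF q(3,1,2)] by auto
    have "p \<in> arrow_piece u ?v (rug_slice C ?v)"
      using q v z(2) charged_alpha[OF v(1)] F_Q_eq[OF z(1)] by (simp add: arrow_piece_def piece_def p)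
    then show "p \<in> (\<Union>v. arrow_piece u v (rug_slice C v))" by blast
  next
    assume "p \<in> (\<Union>v. arrow_piece u v (rug_slice C v))"
    then obtain v where pv: "p \<in> arrow_piece u v (rug_slice C v)" by blast
    then have q: "u \<in> charged" "v \<in> \<alpha>" "arr u v" "x \<in> D u" "x \<in> G" "T x \<in> D v" "0 \<le> y" "y < height u"
      "((T x, v), y / slope u + tile_start v u) \<in> C"
      by (auto simp: arrow_piece_def piece_def p split: if_splits)
    have z: "((x, u), y) \<in> Q" using q by (simp add: Q_iff)
    have "nxt u (bi (T x)) = v" using G_nxt_iff[OF q(5) charged_alpha[OF q(1)] q(4) q(2)] q by simp
    then show "p \<in> rug_slice (F -` C \<inter> Q) u" using z q(9) F_Q_eq[OF z] by (simp add: p)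
  qed
qed

lemma F_preimage_sets: assumes C: "C \<in> sets tl" shows "F -` C \<inter> Q \<in> sets nu"
proof -
  have "rug_slice (F -` C \<inter> Q) u \<in> sets ml" for u
    unfolding rug_slice_F_preimage using gpiece_sets[OF rug_slice_sets[OF C]] by (intro sets.countable_UN image_subsetI)
  moreover have "F -` C \<inter> Q \<subseteq> tw \<times> UNIV" using tl_subset[OF Q_sets] by blast
  ultimately show ?thesis using Q_R by (auto simp: sets_nu sets_tl_iff)
qed

lemma rug_slice_tiles:
  assumes C: "C \<in> sets nu"
  shows "emeasure ml (rug_slice C v) = (\<Sum>u. emeasure ml (rug_slice C v \<inter> (D v \<times> {tile_start v u..<tile_start v (Suc u)})))"
proof (cases "v \<in> charged")
  case True
  then have v: "v \<in> \<alpha>" by (rule charged_alpha)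
  let ?S = "\<lambda>u. rug_slice C v \<inter> (D v \<times> {tile_start v u..<tile_start v (Suc u)})"
  have sC: "rug_slice C v \<in> sets ml" using nu_tl[OF C] by simp
  have S: "?S u \<in> sets ml" for u using sC v by (intro sets.Int pair_measureI) auto
  have "(\<Sum>u. emeasure ml (?S u)) = emeasure ml (\<Union>u. ?S u)"
  proof (rule suminf_emeasure)
    show "range ?S \<subseteq> sets ml" using S by blast
    show "disjoint_family ?S" unfolding disjoint_family_on_def using tile_unique by fastforce
  qed
  moreover have "(\<Union>u. ?S u) = rug_slice C v \<inter> (D v \<times> {0..<height v})" unfolding tile_UN[OF v, symmetric] by blast
  moreover have "emeasure ml (rug_slice C v) = emeasure ml (rug_slice C v \<inter> (D v \<times> {0..<height v}))"
  proof (rule antisym)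
    have "rug_slice C v \<subseteq> rug_slice R v" using nu_R[OF C] by auto
    then have "rug_slice C v \<subseteq> D v \<times> {0..height v}" using True by (simp only: rug_slice_R if_True)
    then have "rug_slice C v \<subseteq> (rug_slice C v \<inter> (D v \<times> {0..<height v})) \<union> D v \<times> {height v}" by auto
    moreover have s: "D v \<times> {height v} \<in> sets ml" "rug_slice C v \<inter> (D v \<times> {0..<height v}) \<in> sets ml"
      using v sC by (auto intro!: sets.Int pair_measureI)
    ultimately have "emeasure ml (rug_slice C v) \<le> emeasure ml ((rug_slice C v \<inter> (D v \<times> {0..<height v})) \<union> D v \<times> {height v})"
      by (intro emeasure_mono sets.Un)
    also have "\<dots> \<le> emeasure ml (rug_slice C v \<inter> (D v \<times> {0..<height v})) + emeasure ml (D v \<times> {height v})"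
      using s by (intro emeasure_subadditive)
    also have "emeasure ml (D v \<times> {height v}) = 0" using v by (simp add: emeasure_ml_Times)
    finally show "emeasure ml (rug_slice C v) \<le> emeasure ml (rug_slice C v \<inter> (D v \<times> {0..<height v}))" by simp
    show "emeasure ml (rug_slice C v \<inter> (D v \<times> {0..<height v})) \<le> emeasure ml (rug_slice C v)"
      using sC by (intro emeasure_mono) auto
  qed
  ultimately show ?thesis by simp
next
  case False
  have "rug_slice C v \<subseteq> rug_slice R v" using nu_R[OF C] by auto
  then have "rug_slice C v = {}" using False by (simp add: rug_slice_R)
  then show ?thesis by simp
qed

text \<open>Sum over the arrows, grouped by target: the strips of a rug add up to the rug.\<close>
lemma F_measure_preserving:
  assumes C: "C \<in> sets nu" shows "emeasure nu (F -` C \<inter> Q) = emeasure nu C"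
proof -
  have sC: "rug_slice C v \<in> sets ml" for v using nu_tl[OF C] by simp
  have "emeasure nu (F -` C \<inter> Q) = (\<Sum>u. emeasure ml (\<Union>v. arrow_piece u v (rug_slice C v)))"
    unfolding emeasure_nu[OF F_preimage_sets[OF nu_tl[OF C]]] rug_slice_F_preimage ..
  also have "\<dots> = (\<Sum>u. \<Sum>v. emeasure ml (arrow_piece u v (rug_slice C v)))"
  proof (intro suminf_cong suminf_emeasure[symmetric])
    fix u
    show "range (\<lambda>v. arrow_piece u v (rug_slice C v)) \<subseteq> sets ml" using gpiece_sets[OF sC] by blast
    have "v = v'" if "p \<in> arrow_piece u v (rug_slice C v)" "p \<in> arrow_piece u v' (rug_slice C v')" for v v' p
    proof -
      have "u \<in> charged" "fst p \<in> G" "fst p \<in> D u" "v \<in> \<alpha>" "v' \<in> \<alpha>" "arr u v \<and> T (fst p) \<in> D v" "arr u v' \<and> T (fst p) \<in> D v'"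
        using that by (auto simp: arrow_piece_def piece_def split: if_splits)
      then show "v = v'" using G_nxt_iff[of "fst p" u] charged_alpha by metis
    qed
    then show "disjoint_family (\<lambda>v. arrow_piece u v (rug_slice C v))" unfolding disjoint_family_on_def by blast
  qed
  also have "\<dots> = (\<Sum>u. \<Sum>v. emeasure ml (rug_slice C v \<inter> (D v \<times> {tile_start v u..<tile_start v (Suc u)})))"
  proof (intro suminf_cong)
    fix u v
    show "emeasure ml (arrow_piece u v (rug_slice C v)) = emeasure ml (rug_slice C v \<inter> (D v \<times> {tile_start v u..<tile_start v (Suc u)}))"
    proof (cases "u \<in> charged \<and> v \<in> \<alpha> \<and> arr u v")
      case True then show ?thesis using piece_emeasure[OF _ _ _ sC] by (simp add: arrow_piece_def)
    next
      case False
      then have "tile_height v u = 0 \<or> rug_slice C v = {}"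
        using rug_slice_empty[OF tl_subset[OF nu_tl[OF C]], of v] by (auto simp: tile_height_def)
      then have "rug_slice C v \<inter> (D v \<times> {tile_start v u..<tile_start v (Suc u)}) = {}" by (auto simp: tile_start_Suc)
      then show ?thesis using False by (simp only: arrow_piece_def if_False emeasure_empty)
    qed
  qed
  also have "\<dots> = (\<Sum>v. \<Sum>u. emeasure ml (rug_slice C v \<inter> (D v \<times> {tile_start v u..<tile_start v (Suc u)})))" by (rule suminf_swap_ennreal)
  also have "\<dots> = emeasure nu C" unfolding emeasure_nu[OF C] using rug_slice_tiles[OF C] by (intro suminf_cong) simp
  finally show ?thesis .
qed

text \<open>The inverse branch on the image of level \<open>u\<close>, with an arbitrary constant value elsewhere so that it is total.\<close>
definition Tinv :: "nat \<Rightarrow> 'a \<Rightarrow> 'a" where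
  "Tinv u x = (if x \<in> T ` (D u \<inter> G) then the_inv_into (D u \<inter> G) T x else (SOME x. x \<in> X))"

lemma Tinv_T: "u \<in> \<alpha> \<Longrightarrow> x \<in> D u \<inter> G \<Longrightarrow> Tinv u (T x) = x"
  using the_inv_into_f_f[OF T_inj_G] by (auto simp: Tinv_def)

lemma Tinv_meas: assumes u: "u \<in> \<alpha>" shows "Tinv u \<in> measurable \<mu> \<mu>"
proof (rule measurableI)
  have "X \<noteq> {}" using not_empty by (simp add: space_mu)
  then have sX: "(SOME x. x \<in> X) \<in> X" by (simp add: some_in_eq)
  have DG: "D u \<inter> G \<in> sets \<mu>" using u G(1) by (intro sets.Int D_sets)
  fix x assume "x \<in> space \<mu>"
  show "Tinv u x \<in> space \<mu>"
  proof (cases "x \<in> T ` (D u \<inter> G)")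
    case True
    then obtain y where "y \<in> D u \<inter> G" "x = T y" by blast
    then show ?thesis using Tinv_T[OF u] G_X by (auto simp: space_mu)
  qed (simp add: Tinv_def space_mu sX)
next
  fix B assume B: "B \<in> sets \<mu>"
  have DG: "D u \<inter> G \<in> sets \<mu>" using u G(1) by (intro sets.Int D_sets)
  have TX: "T ` (D u \<inter> G) \<subseteq> X" using G_X T_X by blast
  let ?c = "SOME x. x \<in> X"
  have "Tinv u -` B \<inter> space \<mu> = T ` (D u \<inter> G \<inter> B) \<union> (if ?c \<in> B then X - T ` (D u \<inter> G) else {})"
  proof (rule set_eqI)
    fix x
    show "x \<in> Tinv u -` B \<inter> space \<mu> \<longleftrightarrow> x \<in> T ` (D u \<inter> G \<inter> B) \<union> (if ?c \<in> B then X - T ` (D u \<inter> G) else {})"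
    proof (cases "x \<in> T ` (D u \<inter> G)")
      case True
      then obtain y where y: "y \<in> D u \<inter> G" "x = T y" by blast
      have "x \<in> T ` (D u \<inter> G \<inter> B) \<longleftrightarrow> y \<in> B"
        using y inj_onD[OF T_inj_G[OF u]] by blast
      moreover have "Tinv u x = y" using Tinv_T[OF u y(1)] y(2) by simp
      ultimately show ?thesis using True TX by (auto simp: space_mu)
    next
      case False
      then have "Tinv u x = ?c" by (simp add: Tinv_def)
      then show ?thesis using False by (auto simp: space_mu)
    qed
  qed
  moreover have "T ` (D u \<inter> G \<inter> B) \<in> sets \<mu>" "T ` (D u \<inter> G) \<in> sets \<mu>"
    using DG B by (auto intro!: c2_image sets.Int)
  ultimately show "Tinv u -` B \<inter> space \<mu> \<in> sets \<mu>" by (simp add: sets.Diff)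
qed

text \<open>The part over level \<open>v\<close> of the image of a set \<open>E\<close> over level \<open>u\<close>, written as a preimage under the inverse of the map.\<close>
definition image_piece :: "nat \<Rightarrow> nat \<Rightarrow> ('a \<times> real) set \<Rightarrow> ('a \<times> real) set" where
  "image_piece u v E = (if u \<in> charged \<and> v \<in> \<alpha> \<and> arr u v then
     {p. fst p \<in> T ` (D u \<inter> G) \<inter> D v \<and> tile_start v u \<le> snd p \<and> snd p < tile_start v (Suc u) \<and>
       (Tinv u (fst p), (snd p - tile_start v u) * slope u) \<in> E} else {})"

lemma ipiece_sets: assumes E: "E \<in> sets ml" shows "image_piece u v E \<in> sets ml"
proof (cases "u \<in> charged \<and> v \<in> \<alpha> \<and> arr u v")
  case True
  then have u: "u \<in> \<alpha>" and v: "v \<in> \<alpha>" using charged_alpha by auto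
  note [measurable] = Tinv_meas[OF u]
  have m: "(\<lambda>p. (Tinv u (fst p), (snd p - tile_start v u) * slope u)) \<in> measurable ml ml" by measurable
  have TX: "T ` (D u \<inter> G) \<subseteq> X" using G_X T_X by blast
  have eq: "image_piece u v E = ((T ` (D u \<inter> G) \<inter> D v) \<times> {tile_start v u..<tile_start v (Suc u)}) \<inter>
    ((\<lambda>p. (Tinv u (fst p), (snd p - tile_start v u) * slope u)) -` E \<inter> space ml)"
    using TX True by (auto simp: image_piece_def space_ml)
  have "T ` (D u \<inter> G) \<inter> D v \<in> sets \<mu>" using u v G(1) by (intro sets.Int D_sets c2_image)
  then have "(T ` (D u \<inter> G) \<inter> D v) \<times> {tile_start v u..<tile_start v (Suc u)} \<in> sets ml" by (intro pair_measureI) auto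
  then show ?thesis unfolding eq using measurable_sets[OF m E] by (rule sets.Int)
next
  case False then show ?thesis by (simp only: image_piece_def if_False sets.empty_sets)
qed

lemma rug_slice_F_image: "rug_slice (F ` (C \<inter> Q)) v = (\<Union>u. image_piece u v (rug_slice C u))"
proof (rule set_eqI)
  fix p :: "'a \<times> real"
  obtain x' y' where p: "p = (x', y')" by fastforce
  show "p \<in> rug_slice (F ` (C \<inter> Q)) v \<longleftrightarrow> p \<in> (\<Union>u. image_piece u v (rug_slice C u))"
  proof
    assume "p \<in> rug_slice (F ` (C \<inter> Q)) v"
    then obtain z where z: "z \<in> C" "z \<in> Q" "((x', v), y') = F z" by (auto simp: p)
    obtain x u y where zz: "z = ((x, u), y)" by (metis prod.collapse)
    have zQ: "((x, u), y) \<in> Q" using z(2) zz by simp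
    have q: "u \<in> charged" "x \<in> D u" "x \<in> G" "0 \<le> y" "y < height u" using zQ by (auto simp: Q_iff)
    have u: "u \<in> \<alpha>" using q(1) by (rule charged_alpha)
    have e: "x' = T x" "v = nxt u (bi (T x))" "y' = y / slope u + tile_start v u"
      using z(3) F_Q_eq[OF zQ] by (auto simp: zz)
    have v: "v \<in> charged" "arr u v" "T x \<in> D v" using G_nxt[OF q(3,1,2)] e by auto
    have t: "tile_start v u \<le> y'" "y' < tile_start v (Suc u)" using F_tile[OF zQ e(2)] e(3) by auto
    have "Tinv u x' = x" using Tinv_T[OF u] q e by simp
    moreover have "(y' - tile_start v u) * slope u = y" using e(3) slope_pos[OF u] by simp
    ultimately have "p \<in> image_piece u v (rug_slice C u)"
      using q v t e(1) z(1) charged_alpha[OF v(1)] by (simp add: image_piece_def p zz)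
    then show "p \<in> (\<Union>u. image_piece u v (rug_slice C u))" by blast
  next
    assume "p \<in> (\<Union>u. image_piece u v (rug_slice C u))"
    then obtain u where "p \<in> image_piece u v (rug_slice C u)" by blast
    then have q: "u \<in> charged" "v \<in> \<alpha>" "arr u v" "x' \<in> T ` (D u \<inter> G)" "x' \<in> D v"
      "tile_start v u \<le> y'" "y' < tile_start v (Suc u)" "((Tinv u x', u), (y' - tile_start v u) * slope u) \<in> C"
      by (auto simp: image_piece_def p split: if_splits)
    have u: "u \<in> \<alpha>" using q(1) by (rule charged_alpha)
    have slope: "0 < slope u" by (rule slope_pos[OF u])
    obtain x where x: "x \<in> D u" "x \<in> G" "x' = T x" using q(4) by blast
    have Ti: "Tinv u x' = x" using Tinv_T[OF u] x by simp
    define y where "y = (y' - tile_start v u) * slope u"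
    have "tile_height v u = height u / slope u" using q by (simp add: tile_height_def)
    then have "height u = tile_height v u * slope u" using slope by simp
    then have y: "0 \<le> y" "y < height u" using q(6,7) slope by (simp_all add: y_def tile_start_Suc)
    have zQ: "((x, u), y) \<in> Q" using q x y by (simp add: Q_iff)
    have "nxt u (bi (T x)) = v" using G_nxt_iff[OF x(2) u x(1) q(2)] q x by simp
    moreover have "y / slope u + tile_start v u = y'" using slope by (simp add: y_def)
    ultimately have "F ((x, u), y) = ((x', v), y')" using F_Q_eq[OF zQ] x(3) by simp
    moreover have "((x, u), y) \<in> C" using q(8) Ti y_def by simp
    ultimately show "p \<in> rug_slice (F ` (C \<inter> Q)) v" using zQ by (force simp: p)
  qed
qed

lemma F_image_sets: assumes C: "C \<in> sets nu" "C \<subseteq> Q" shows "F ` C \<in> sets nu"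
proof -
  have eq: "C \<inter> Q = C" using C(2) by blast
  have "rug_slice (F ` C) v \<in> sets ml" for v
    unfolding rug_slice_F_image[of C, unfolded eq] using ipiece_sets[OF rug_slice_sets[OF nu_tl[OF C(1)]]]
    by (intro sets.countable_UN image_subsetI)
  moreover have sub: "F ` C \<subseteq> Q" using F_Q C(2) by blast
  moreover have "Q \<subseteq> tw \<times> UNIV" using tl_subset[OF Q_sets] .
  ultimately have "F ` C \<in> sets tl" unfolding sets_tl_iff by blast
  then show ?thesis using sub Q_R by (auto simp: sets_nu)
qed

lemma F_image_emeasure: assumes C: "C \<in> sets nu" "C \<subseteq> Q" shows "emeasure nu (F ` C) = emeasure nu C"
proof -
  have "F -` (F ` C) \<inter> Q = C" using C(2) F_inj unfolding inj_on_def by blast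
  then show ?thesis using F_measure_preserving[OF F_image_sets[OF C]] by simp
qed

section \<open>The bijective part of the rugs\<close>

text \<open>The points of \<open>Q\<close> with an infinite backward orbit in \<open>Q\<close>.\<close>
definition Y :: "(('a \<times> nat) \<times> real) set" where "Y = (\<Inter>n. (F ^^ n) ` Q)"

lemma FnQ: "(F ^^ n) ` Q \<subseteq> Q"
proof (induction n)
  case (Suc n)
  have "(F ^^ Suc n) ` Q = F ` ((F ^^ n) ` Q)" by (simp add: image_comp)
  also have "\<dots> \<subseteq> Q" using Suc F_Q by blast
  finally show ?case .
qed simp

lemma FnQ_sets: "(F ^^ n) ` Q \<in> sets nu \<and> emeasure nu ((F ^^ n) ` Q) = 1"
proof (induction n)
  case 0 then show ?case by (simp add: nu_Q)
next
  case (Suc n)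
  have "(F ^^ Suc n) ` Q = F ` ((F ^^ n) ` Q)" by (simp add: image_comp)
  then show ?case using F_image_sets[OF _ FnQ] F_image_emeasure[OF _ FnQ] Suc by simp
qed

lemma Y_Q: "Y \<subseteq> Q"
proof -
  have "Y \<subseteq> (F ^^ 0) ` Q" unfolding Y_def by blast
  then show ?thesis by simp
qed

lemma Y_sets[simp]: "Y \<in> sets nu" unfolding Y_def using FnQ_sets by blast

lemma FY: "F ` Y = Y"
proof -
  have "F ` Y = (\<Inter>n. F ` ((F ^^ n) ` Q))"
    unfolding Y_def using FnQ by (intro image_INT[OF F_inj]) auto
  also have "\<dots> = (\<Inter>n. (F ^^ Suc n) ` Q)" by (simp add: image_comp)
  also have "\<dots> = Y"
  proof
    show "(\<Inter>n. (F ^^ Suc n) ` Q) \<subseteq> Y"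
    proof
      fix z assume z: "z \<in> (\<Inter>n. (F ^^ Suc n) ` Q)"
      have "z \<in> (F ^^ n) ` Q" for n
      proof (cases n)
        case 0
        have "z \<in> (F ^^ Suc 0) ` Q" using z by blast
        then show ?thesis using FnQ[of "Suc 0"] 0 by auto
      next
        case (Suc m) then show ?thesis using z by blast
      qed
      then show "z \<in> Y" by (simp add: Y_def)
    qed
    show "Y \<subseteq> (\<Inter>n. (F ^^ Suc n) ` Q)" unfolding Y_def by blast
  qed
  finally show ?thesis .
qed

lemma F_inj_Y: "inj_on F Y" using F_inj Y_Q by (rule inj_on_subset)

lemma nu_Y: "emeasure nu Y = 1"
proof -
  interpret nu: prob_space nu by (rule prob_nu)
  have "AE z in nu. z \<in> (F ^^ n) ` Q" for n
  proof -
    have "nu.prob ((F ^^ n) ` Q) = 1" using FnQ_sets[of n] by (simp add: measure_def)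
    then show ?thesis using FnQ_sets[of n] by (subst nu.prob_eq_1[symmetric]) auto
  qed
  then have "AE z in nu. \<forall>n. z \<in> (F ^^ n) ` Q" unfolding AE_all_countable by (rule allI)
  then have "AE z in nu. z \<in> Y" by eventually_elim (simp add: Y_def)
  then have "nu.prob Y = 1" by (subst nu.prob_eq_1) auto
  then show ?thesis by (simp add: nu.emeasure_eq_measure)
qed

lemma nu_full: assumes A: "A \<in> sets nu" "emeasure nu A = 1" shows "space nu - A \<in> null_sets nu"
proof -
  interpret nu: prob_space nu by (rule prob_nu)
  have "emeasure nu (space nu - A) = emeasure nu (space nu) - emeasure nu A"
    using A by (intro emeasure_compl) auto
  then show ?thesis using A nu.emeasure_space_1 by (intro null_setsI) auto
qed

lemma full_Y: "full_set nu Y"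
  unfolding full_set_def using nu_full[OF Y_sets nu_Y] by simp

lemma F_preimage_Y:
  assumes C: "C \<in> sets nu"
  shows "F -` C \<inter> Y \<in> sets nu" "emeasure nu (F -` C \<inter> Y) = emeasure nu C"
proof -
  have eq: "F -` C \<inter> Y = (F -` C \<inter> Q) \<inter> Y" using Y_Q by blast
  have P: "F -` C \<inter> Q \<in> sets nu" using F_preimage_sets[OF nu_tl[OF C]] .
  show s: "F -` C \<inter> Y \<in> sets nu" unfolding eq using P Y_sets by (rule sets.Int)
  have "emeasure nu (F -` C \<inter> Y) = emeasure nu (F -` C \<inter> Q)"
  proof (rule emeasure_eq_AE)
    have "AE z in nu. z \<in> Y" using AE_not_in[OF nu_full[OF Y_sets nu_Y]] AE_space by eventually_elim auto
    then show "AE z in nu. (z \<in> F -` C \<inter> Y) = (z \<in> F -` C \<inter> Q)" by eventually_elim (use Y_Q in auto)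
  qed (use s P in auto)
  then show "emeasure nu (F -` C \<inter> Y) = emeasure nu C" using F_measure_preserving[OF C] by simp
qed

lemma ae_invertible_F: "ae_invertible nu F"
  unfolding ae_invertible_def
proof (intro exI[of _ Y] conjI ballI full_Y)
  show "bij_betw F Y Y" using F_inj_Y FY by (simp add: bij_betw_def)
  fix C assume C: "C \<in> sets nu"
  show "F -` C \<inter> Y \<in> sets nu" by (rule F_preimage_Y[OF C])
  show "F ` (C \<inter> Y) \<in> sets nu" using C Y_Q by (intro F_image_sets) auto
qed

end

section \<open>Systems with one itinerary\<close>

lemma image_sym_diff:
  assumes "inj_on f S" "A \<subseteq> S" "B \<subseteq> S" shows "f ` sym_diff A B = sym_diff (f ` A) (f ` B)"
proof -
  have "f ` (A - B) = f ` A - f ` B" using assms by (intro inj_on_image_set_diff[OF assms(1)]) auto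
  moreover have "f ` (B - A) = f ` B - f ` A" using assms by (intro inj_on_image_set_diff[OF assms(1)]) auto
  ultimately show ?thesis by (simp add: image_Un)
qed

context piecewise_system begin

text \<open>On a compact set where every measurable set is null or full, each point has a null neighbourhood
  unless it is a point mass, and finitely many of these cover the set.\<close>
lemma zero_one_contradiction:
  assumes K: "compact K" "K \<subseteq> X" "0 < prob K"
    and zo: "\<And>A. A \<in> sets \<mu> \<Longrightarrow> prob (A \<inter> K) = 0 \<or> prob (A \<inter> K) = prob K"
    and na: "\<And>x. x \<in> K \<Longrightarrow> prob {x} = 0"
  shows False
proof -
  have Ks: "K \<in> sets \<mu>" using K by (intro closed_sets compact_imp_closed)
  have ball_sets: "cball x r \<inter> X \<in> sets \<mu>" for x :: 'a and r
    using X_leb by (auto simp: sets_mu_iff intro!: sets.Int)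
  have "\<exists>r>0. prob (cball x r \<inter> K) = 0" if x: "x \<in> K" for x
  proof -
    let ?B = "\<lambda>n. cball x (1 / real (Suc n)) \<inter> K"
    have Bs: "?B n \<in> sets \<mu>" for n
    proof -
      have "?B n = (cball x (1 / real (Suc n)) \<inter> X) \<inter> K" using K(2) by blast
      then show ?thesis using ball_sets Ks by (metis sets.Int)
    qed
    have "(\<lambda>n. prob (?B n)) \<longlonglongrightarrow> prob (\<Inter>n. ?B n)"
    proof (rule finite_Lim_measure_decseq)
      show "range ?B \<subseteq> sets \<mu>" using Bs by blast
      show "decseq ?B"
      proof (rule decseq_SucI)
        fix n
        have "1 / real (Suc (Suc n)) \<le> 1 / real (Suc n)" by (simp add: frac_le)
        then show "?B (Suc n) \<subseteq> ?B n" by (intro Int_mono cball_subset_cball_iff[THEN iffD2]) auto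
      qed
    qed
    moreover have "(\<Inter>n. ?B n) = {x}"
    proof
      show "(\<Inter>n. ?B n) \<subseteq> {x}"
      proof
        fix y assume y: "y \<in> (\<Inter>n. ?B n)"
        have "dist x y \<le> 1 / real (Suc n)" for n using y by auto
        then have "dist x y \<le> 0"
          by (intro LIMSEQ_le_const[OF LIMSEQ_Suc[OF lim_const_over_n[of 1]]]) auto
        then show "y \<in> {x}" by simp
      qed
    qed (use x in auto)
    ultimately have "(\<lambda>n. prob (?B n)) \<longlonglongrightarrow> 0" using na[OF x] by simp
    then have "\<forall>\<^sub>F n in sequentially. prob (?B n) < prob K" using K(3) by (rule order_tendstoD)
    then obtain n where "prob (?B n) < prob K" by (auto simp: eventually_sequentially)
    moreover have "prob (?B n) = 0 \<or> prob (?B n) = prob K" using zo[OF Bs, of n] by (simp add: Int_assoc)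
    ultimately have "prob (?B n) = 0" by simp
    then show ?thesis by (intro exI[of _ "1 / real (Suc n)"]) simp
  qed
  then obtain r where r: "\<And>x. x \<in> K \<Longrightarrow> 0 < r x" "\<And>x. x \<in> K \<Longrightarrow> prob (cball x (r x) \<inter> K) = 0" by metis
  have "K \<subseteq> (\<Union>x\<in>K. ball x (r x))" using r(1) by force
  then obtain K' where K': "K' \<subseteq> K" "finite K'" "K \<subseteq> (\<Union>x\<in>K'. ball x (r x))"
    using compactE_image[OF K(1), of K "\<lambda>x. ball x (r x)"] by auto
  have s: "cball x (r x) \<inter> K \<in> sets \<mu>" for x
  proof -
    have "cball x (r x) \<inter> K = (cball x (r x) \<inter> X) \<inter> K" using K(2) by blast
    then show ?thesis using ball_sets Ks by (metis sets.Int)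
  qed
  have "K \<subseteq> (\<Union>x\<in>K'. cball x (r x) \<inter> K)" 
  proof
    fix y assume y: "y \<in> K"
    then obtain x where "x \<in> K'" "y \<in> ball x (r x)" using K'(3) by blast
    then show "y \<in> (\<Union>x\<in>K'. cball x (r x) \<inter> K)" using y by (intro UN_I[of x]) auto
  qed
  then have "prob K \<le> prob (\<Union>x\<in>K'. cball x (r x) \<inter> K)" 
    by (rule finite_measure_mono) (intro sets.finite_UN s K'(2))
  also have "\<dots> \<le> (\<Sum>x\<in>K'. prob (cball x (r x) \<inter> K))" using s K'(2) by (intro finite_measure_subadditive_finite) auto
  also have "\<dots> = 0" using r(2) K'(1) by (intro sum.neutral) auto
  finally show False using K(3) by simp
qed

text \<open>If almost all points share an itinerary, every cell is null or full, and so is every set they approximate.\<close>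
lemma constant_itinerary_zero_one:
  assumes K: "K \<in> sets \<mu>" and const: "AE x in \<mu>. x \<in> K \<longrightarrow> (\<forall>n. itinerary x n = map k [0..<n])"
    and A: "A \<in> sets \<mu>"
  shows "prob (A \<inter> K) = 0 \<or> prob (A \<inter> K) = prob K"
proof (rule ccontr)
  assume neg: "\<not> ?thesis"
  have "prob (A \<inter> K) \<le> prob K" using A K by (intro finite_measure_mono) auto
  moreover have "0 \<le> prob (A \<inter> K)" by (rule measure_nonneg)
  ultimately have p: "0 < prob (A \<inter> K)" "0 < prob K - prob (A \<inter> K)" using neg by linarith+
  define \<epsilon> where "\<epsilon> = min (prob (A \<inter> K)) (prob K - prob (A \<inter> K))"
  have e: "0 < \<epsilon>" "\<epsilon> \<le> prob (A \<inter> K)" "\<epsilon> \<le> prob K - prob (A \<inter> K)" using p by (auto simp: \<epsilon>_def)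
  obtain n W where W: "prob (sym_diff A {x \<in> X. itinerary x n \<in> W}) < \<epsilon>"
    using approximable_all[OF A] e(1) unfolding approximable_def by blast
  have S: "sym_diff A {x \<in> X. itinerary x n \<in> W} \<in> sets \<mu>" using A by (intro sets.Un sets.Diff cell_sets)
  show False
  proof (cases "map k [0..<n] \<in> W")
    case True
    have "AE x in \<mu>. x \<in> K - A \<longrightarrow> x \<in> sym_diff A {x \<in> X. itinerary x n \<in> W}"
      using const AE_space by eventually_elim (use True in \<open>auto simp: space_mu\<close>)
    then have "prob (K - A) \<le> prob (sym_diff A {x \<in> X. itinerary x n \<in> W})" by (intro finite_measure_mono_AE S)
    moreover have "prob (K - A) = prob K - prob (A \<inter> K)"
      using A K by (subst finite_measure_Diff'[of K A]) (auto simp: Int_commute)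
    ultimately show False using W e(3) by linarith
  next
    case False
    have "AE x in \<mu>. x \<in> A \<inter> K \<longrightarrow> x \<in> sym_diff A {x \<in> X. itinerary x n \<in> W}"
      using const AE_space by eventually_elim (use False in \<open>auto simp: space_mu\<close>)
    then have "prob (A \<inter> K) \<le> prob (sym_diff A {x \<in> X. itinerary x n \<in> W})" by (intro finite_measure_mono_AE S)
    then show False using W e(2) by linarith
  qed
qed

end

section \<open>The sigma-algebra of the past\<close>

context lifted_tower begin

abbreviation lvl :: "('a \<times> nat) \<times> real \<Rightarrow> nat" where "lvl z \<equiv> snd (fst z)"
abbreviation phi :: "('a \<times> nat) \<times> real \<Rightarrow> 'a" where "phi \<equiv> fst \<circ> fst"

definition Finv where "Finv = the_inv_into Y F"

lemma Finv_Y: "z \<in> Y \<Longrightarrow> Finv z \<in> Y" and F_Finv: "z \<in> Y \<Longrightarrow> F (Finv z) = z" and Finv_F: "z \<in> Y \<Longrightarrow> Finv (F z) = z"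
  using the_inv_into_into[OF F_inj_Y, of z Y] f_the_inv_into_f[OF F_inj_Y, of z] the_inv_into_f_f[OF F_inj_Y, of z] FY
  by (auto simp: Finv_def)

lemma F_Y: "z \<in> Y \<Longrightarrow> F z \<in> Y" using FY by blast

lemma Y_D: "z \<in> Y \<Longrightarrow> lvl z \<in> charged \<and> phi z \<in> D (lvl z) \<and> phi z \<in> G \<and> 0 \<le> snd z \<and> snd z < height (lvl z)"
  using Y_Q by (auto simp: Q_def)

lemma Y_step:
  assumes z: "z \<in> Y"
  shows "arr (lvl z) (lvl (F z))" "snd (F z) = snd z / slope (lvl z) + tile_start (lvl (F z)) (lvl z)" "phi (F z) = T (phi z)"
proof -
  obtain x u y where zz: "z = ((x, u), y)" by (metis prod.collapse)
  have q: "((x, u), y) \<in> Q" using z zz Y_Q by auto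
  then show "arr (lvl z) (lvl (F z))" "snd (F z) = snd z / slope (lvl z) + tile_start (lvl (F z)) (lvl z)" "phi (F z) = T (phi z)"
    using F_Q_eq[OF q] G_nxt(2)[of x u] by (auto simp: zz Q_iff)
qed

text \<open>The smallest sigma-algebra containing the images \<open>F\<^sup>n (\<phi>\<^sup>-\<^sup>1 A)\<close>, that is, the one generated by the
  base coordinates of all backward iterates.\<close>
definition past_gen :: "(('a \<times> nat) \<times> real) set set" where
  "past_gen = sigma_sets Y {(F ^^ n) ` (phi -` A \<inter> Y) | n A. A \<in> sets \<mu>}"

text \<open>The measurable sets that agree almost everywhere with a set of the past. In this structure a
  coordinate that is only almost everywhere a limit of functions of the past is measurable.\<close>
definition past_complete :: "(('a \<times> nat) \<times> real) set set" where
  "past_complete = {C \<in> sets nu. C \<subseteq> Y \<and> (\<exists>E\<in>past_gen. ae_eq_set nu C E)}"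

lemma Y_R: "z \<in> Y \<Longrightarrow> z \<in> R \<and> fst z \<in> tw"
proof -
  assume "z \<in> Y"
  then have R: "z \<in> R" using Y_Q Q_R by blast
  then have "z \<in> tw \<times> UNIV" using tl_subset[OF R_sets] by blast
  with R show "z \<in> R \<and> fst z \<in> tw" by (simp add: mem_Times_iff)
qed

lemma phi_Y_sets: "A \<in> sets \<mu> \<Longrightarrow> phi -` A \<inter> Y \<in> sets nu"
proof -
  assume A: "A \<in> sets \<mu>"
  have "phi -` A \<inter> Y = {z \<in> R. fst z \<in> fst -` A \<inter> tw} \<inter> Y"
    using Y_R by auto
  then show ?thesis using nu_fst(1)[OF fst_vimage_sets[OF A]] by (simp add: sets.Int)
qed

lemma FnY_sub: "C \<subseteq> Y \<Longrightarrow> (F ^^ n) ` C \<subseteq> Y"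
proof (induction n)
  case (Suc n)
  have "(F ^^ Suc n) ` C = F ` ((F ^^ n) ` C)" by (simp add: image_comp)
  then show ?case using Suc FY by blast
qed simp

lemma Fn_image:
  assumes "C \<in> sets nu" "C \<subseteq> Y"
  shows "(F ^^ n) ` C \<in> sets nu" "emeasure nu ((F ^^ n) ` C) = emeasure nu C"
proof -
  have "(F ^^ n) ` C \<in> sets nu \<and> emeasure nu ((F ^^ n) ` C) = emeasure nu C"
  proof (induction n)
    case (Suc n)
    have "(F ^^ Suc n) ` C = F ` ((F ^^ n) ` C)" by (simp add: image_comp)
    moreover have "(F ^^ n) ` C \<subseteq> Q" using FnY_sub[OF assms(2)] Y_Q by blast
    ultimately show ?case using F_image_sets F_image_emeasure Suc by metis
  qed (use assms in simp)
  then show "(F ^^ n) ` C \<in> sets nu" "emeasure nu ((F ^^ n) ` C) = emeasure nu C" by auto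
qed

lemma past_gen_nu: assumes "E \<in> past_gen" shows "E \<in> sets nu" "E \<subseteq> Y"
proof -
  have "E \<in> sets nu \<and> E \<subseteq> Y" using assms unfolding past_gen_def
  proof induction
    case (Basic a)
    then obtain n A where "A \<in> sets \<mu>" "a = (F ^^ n) ` (phi -` A \<inter> Y)" by blast
    then show ?case using Fn_image(1)[OF phi_Y_sets, of A n] FnY_sub[of "phi -` A \<inter> Y" n] by simp
  qed (auto simp: sets.Diff)
  then show "E \<in> sets nu" "E \<subseteq> Y" by auto
qed

lemma past_gen_F: assumes "E \<in> past_gen" shows "F ` E \<in> past_gen"
  using assms unfolding past_gen_def
proof induction
  case (Basic a)
  then obtain n A where nA: "A \<in> sets \<mu>" "a = (F ^^ n) ` (phi -` A \<inter> Y)" by blast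
  then have "F ` a = (F ^^ Suc n) ` (phi -` A \<inter> Y)" by (simp add: image_comp)
  then show ?case using nA(1) by (intro sigma_sets.Basic) blast
next
  case Empty then show ?case by (simp add: sigma_sets.Empty)
next
  case (Compl a)
  have "a \<subseteq> Y" using Compl.hyps past_gen_nu(2) by (simp add: past_gen_def)
  then have "F ` (Y - a) = Y - F ` a" using inj_on_image_set_diff[OF F_inj_Y, of Y a] FY by simp
  then show ?case using Compl.IH by (simp add: sigma_sets.Compl)
next
  case (Union a)
  have "F ` (\<Union> (range a)) = (\<Union>i. F ` a i)" by blast
  then show ?case using Union.IH by (simp add: sigma_sets.Union)
qed

lemma ae_eq_nu_iff:
  assumes "C \<in> sets nu" "E \<in> sets nu"
  shows "ae_eq_set nu C E \<longleftrightarrow> (AE z in nu. z \<in> C \<longleftrightarrow> z \<in> E)"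
proof -
  have "sym_diff C E \<in> sets nu" using assms by (intro sets.Un sets.Diff)
  then have "sym_diff C E \<in> null_sets nu \<longleftrightarrow> (AE z in nu. z \<notin> sym_diff C E)" by (rule AE_iff_null_sets)
  moreover have "(z \<notin> sym_diff C E) = (z \<in> C \<longleftrightarrow> z \<in> E)" for z by blast
  ultimately show ?thesis by (simp only: ae_eq_set_def)
qed

lemma past_complete_iff: "C \<in> past_complete \<longleftrightarrow> C \<in> sets nu \<and> C \<subseteq> Y \<and> (\<exists>E\<in>past_gen. AE z in nu. z \<in> C \<longleftrightarrow> z \<in> E)"
  unfolding past_complete_def using ae_eq_nu_iff past_gen_nu(1) by blast

lemma past_gen_past_complete: "E \<in> past_gen \<Longrightarrow> E \<in> past_complete"
  unfolding past_complete_iff using past_gen_nu by (intro conjI bexI[of _ E]) auto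

lemma past_complete_AE:
  assumes "C \<in> sets nu" "C \<subseteq> Y" "C' \<in> past_complete" "AE z in nu. z \<in> C \<longleftrightarrow> z \<in> C'" shows "C \<in> past_complete"
proof -
  obtain E where E: "E \<in> past_gen" "AE z in nu. z \<in> C' \<longleftrightarrow> z \<in> E" using assms(3) unfolding past_complete_iff by blast
  have "AE z in nu. z \<in> C \<longleftrightarrow> z \<in> E" using assms(4) E(2) by eventually_elim simp
  then show ?thesis unfolding past_complete_iff using assms(1,2) E(1) by blast
qed

lemma sigma_past_complete: "sigma_algebra Y past_complete"
  unfolding sigma_algebra_iff2
proof (intro conjI ballI allI impI)
  show "past_complete \<subseteq> Pow Y" by (auto simp: past_complete_def)
  show "{} \<in> past_complete" by (intro past_gen_past_complete) (simp add: past_gen_def sigma_sets.Empty)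
next
  fix C assume "C \<in> past_complete"
  then obtain E where C: "C \<in> sets nu" "C \<subseteq> Y" and E: "E \<in> past_gen" "AE z in nu. z \<in> C \<longleftrightarrow> z \<in> E" unfolding past_complete_iff by blast
  have "Y - E \<in> past_gen" using E(1) unfolding past_gen_def by (rule sigma_sets.Compl)
  moreover have "AE z in nu. z \<in> Y - C \<longleftrightarrow> z \<in> Y - E" using E(2) by eventually_elim simp
  moreover have "Y - C \<in> sets nu" using C(1) by (intro sets.Diff Y_sets)
  ultimately show "Y - C \<in> past_complete" unfolding past_complete_iff by blast
next
  fix A :: "nat \<Rightarrow> (('a \<times> nat) \<times> real) set" assume A: "range A \<subseteq> past_complete"
  have "\<exists>E. E \<in> past_gen \<and> (AE z in nu. z \<in> A i \<longleftrightarrow> z \<in> E)" for i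
  proof -
    have "A i \<in> past_complete" using A by (rule range_subsetD)
    then show ?thesis unfolding past_complete_iff by blast
  qed
  then have "\<forall>i. \<exists>E. E \<in> past_gen \<and> (AE z in nu. z \<in> A i \<longleftrightarrow> z \<in> E)" ..
  from choice[OF this] obtain E where "\<forall>i. E i \<in> past_gen \<and> (AE z in nu. z \<in> A i \<longleftrightarrow> z \<in> E i)" ..
  then have E: "E i \<in> past_gen" "AE z in nu. z \<in> A i \<longleftrightarrow> z \<in> E i" for i by simp_all
  have "(\<Union>i. E i) \<in> past_gen" using E(1) unfolding past_gen_def by (intro sigma_sets.Union)
  moreover have "AE z in nu. \<forall>i. z \<in> A i \<longleftrightarrow> z \<in> E i" unfolding AE_all_countable using E(2) by (rule_tac allI)
  then have "AE z in nu. z \<in> (\<Union>i. A i) \<longleftrightarrow> z \<in> (\<Union>i. E i)" by eventually_elim simp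
  moreover have Ai: "A i \<in> sets nu" "A i \<subseteq> Y" for i
    using range_subsetD[OF A, of i] by (simp_all add: past_complete_def)
  have "(\<Union>i. A i) \<in> sets nu" by (intro sets.countable_UN image_subsetI Ai)
  moreover have "(\<Union>i. A i) \<subseteq> Y" using Ai(2) by (rule UN_least)
  ultimately show "\<Union> (range A) \<in> past_complete" unfolding past_complete_iff by blast
qed

definition past_space :: "(('a \<times> nat) \<times> real) measure" where "past_space = sigma Y past_complete"

lemma space_past_space: "space past_space = Y" and sets_past_space: "sets past_space = past_complete"
  using sigma_algebra.space_measure_of_eq[OF sigma_past_complete] sigma_algebra.sets_measure_of_eq[OF sigma_past_complete]
  by (simp_all add: past_space_def)

lemma past_complete_nu: "C \<in> past_complete \<Longrightarrow> C \<in> sets nu \<and> C \<subseteq> Y" by (simp add: past_complete_def)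

text \<open>Membership of the preimage of a point in a set of the past is itself an event of the past.\<close>
lemma past_complete_F: assumes "C \<in> past_complete" shows "F ` C \<in> past_complete"
proof -
  obtain E where C: "C \<in> sets nu" "C \<subseteq> Y" and E: "E \<in> past_gen" "ae_eq_set nu C E" using assms unfolding past_complete_def by blast
  note EY = past_gen_nu[OF E(1)]
  have S: "sym_diff C E \<in> sets nu" "sym_diff C E \<subseteq> Q"
    using C EY Y_Q by (auto intro!: sets.Un sets.Diff)
  have "sym_diff (F ` C) (F ` E) = F ` sym_diff C E"
    by (rule image_sym_diff[OF F_inj_Y C(2) EY(2), symmetric])
  moreover have "F ` sym_diff C E \<in> null_sets nu"
    using F_image_sets[OF S] F_image_emeasure[OF S] E(2) by (simp add: ae_eq_set_def null_sets_def)
  ultimately have "ae_eq_set nu (F ` C) (F ` E)" by (simp add: ae_eq_set_def)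
  moreover have "F ` C \<in> sets nu" "F ` C \<subseteq> Y" using F_image_sets[OF C(1)] C(2) Y_Q FY by auto
  ultimately show ?thesis unfolding past_complete_def using past_gen_F[OF E(1)] by blast
qed

lemma phi_past_space: "phi \<in> measurable past_space \<mu>"
proof (rule measurableI)
  fix z assume "z \<in> space past_space"
  then show "phi z \<in> space \<mu>" using Y_D[of z] G_X by (auto simp: space_past_space space_mu)
next
  fix A assume A: "A \<in> sets \<mu>"
  have "(F ^^ 0) ` (phi -` A \<inter> Y) \<in> past_gen" unfolding past_gen_def using A by (intro sigma_sets.Basic) blast
  then show "phi -` A \<inter> space past_space \<in> sets past_space" using past_gen_past_complete by (simp add: space_past_space sets_past_space)
qed

lemma Finv_past_space: "Finv \<in> measurable past_space past_space"
proof (rule measurableI)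
  fix z assume "z \<in> space past_space" then show "Finv z \<in> space past_space" using Finv_Y by (simp add: space_past_space)
next
  fix C assume "C \<in> sets past_space"
  then have C: "C \<in> past_complete" by (simp add: sets_past_space)
  have "Finv -` C \<inter> Y = F ` C"
    using past_complete_nu[OF C] F_Finv Finv_F F_Y by (auto simp: image_iff) metis
  then show "Finv -` C \<inter> space past_space \<in> sets past_space" using past_complete_F[OF C] by (simp add: space_past_space sets_past_space)
qed

text \<open>Recover the level at time \<open>n\<close> from the base coordinate at time \<open>0\<close> and shift by \<open>n\<close>: the level now is
  approximated by an event that depends on the base coordinate \<open>n\<close> steps ago.\<close>
lemma level_approx:
  assumes v: "v \<in> \<alpha>" and e: "0 < \<epsilon>"
  shows "\<exists>E\<in>past_gen. measure nu (sym_diff {z \<in> Y. lvl z = v} E) \<le> \<epsilon>"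
proof -
  obtain d where d: "0 < d" "\<And>\<delta>. 0 < \<delta> \<and> \<delta> \<le> d \<Longrightarrow>
     (\<forall>\<^sub>F n in sequentially. measure \<mu>h (sym_diff (pre_iter n (level D v)) (fst -` past_like v \<delta> n \<inter> tw)) \<le> \<epsilon>)"
    using level_from_past[OF h_admissible v e] by blast
  then have "\<forall>\<^sub>F n in sequentially. measure \<mu>h (sym_diff (pre_iter n (level D v)) (fst -` past_like v d n \<inter> tw)) \<le> \<epsilon>" by simp
  then obtain n where n: "measure \<mu>h (sym_diff (pre_iter n (level D v)) (fst -` past_like v d n \<inter> tw)) \<le> \<epsilon>"
    using eventually_happens'[OF sequentially_bot] by blast
  let ?A = "past_like v d n"
  let ?S = "sym_diff (pre_iter n (level D v)) (fst -` ?A \<inter> tw)"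
  let ?L = "{z \<in> Y. fst ((F ^^ n) z) \<in> level D v}" and ?P = "phi -` ?A \<inter> Y"
  have Ss: "?S \<in> sets tm" using v by (intro sets.Un sets.Diff pre_iter_sets level_sets fst_vimage_sets past_like_sets)
  have fstFn: "fst ((F ^^ n) z) = (That ^^ n) (fst z)" for z by (induction n) (simp_all add: fst_F)
  have YR: "z \<in> R" "fst z \<in> tw" if "z \<in> Y" for z using Y_R[OF that] by auto
  have FnY: "(F ^^ n) z \<in> Y" if "z \<in> Y" for z using FnY_sub[of Y n] that by blast
  (* both the level set and the event of the past are images of events n steps earlier *)
  have L_eq: "{z \<in> Y. lvl z = v} = (F ^^ n) ` ?L"
  proof
    have "(F ^^ n) ` Y = Y"
    proof (induction n)
      case (Suc n)
      have "(F ^^ Suc n) ` Y = F ` ((F ^^ n) ` Y)" by (simp add: image_comp)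
      then show ?case using Suc FY by simp
    qed simp
    moreover have "fst z \<in> level D v" if "z \<in> Y" "lvl z = v" for z using Y_D[OF that(1)] that(2) by (cases "fst z") (auto simp: level_def)
    ultimately show "{z \<in> Y. lvl z = v} \<subseteq> (F ^^ n) ` ?L" by (smt (verit, best) image_iff mem_Collect_eq subsetI)
    show "(F ^^ n) ` ?L \<subseteq> {z \<in> Y. lvl z = v}" using FnY by (auto simp: level_def)
  qed
  have inj: "inj_on (F ^^ n) Y"
  proof (induction n)
    case (Suc n)
    have "inj_on (F \<circ> (F ^^ n)) Y" using Suc F_inj_Y FnY_sub[of Y n] by (intro comp_inj_on) (auto intro: inj_on_subset)
    then show ?case by (simp add: comp_def)
  qed simp
  let ?E = "(F ^^ n) ` ?P"
  have Eg: "?E \<in> past_gen" unfolding past_gen_def using past_like_sets[of v d n] by (intro sigma_sets.Basic) blast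
  have sub: "sym_diff ?L ?P \<subseteq> {z \<in> R. fst z \<in> ?S} \<inter> Y" using YR by (auto simp: pre_iter_def fstFn)
  have sL: "?L = {z \<in> R. fst z \<in> pre_iter n (level D v)} \<inter> Y" using YR by (auto simp: pre_iter_def fstFn)
  have Ls: "?L \<in> sets nu" unfolding sL using v by (intro sets.Int nu_fst Y_sets pre_iter_sets level_sets)
  have SDs: "sym_diff ?L ?P \<in> sets nu" using Ls phi_Y_sets[OF past_like_sets] by (intro sets.Un sets.Diff)
  have "sym_diff {z \<in> Y. lvl z = v} ?E = (F ^^ n) ` sym_diff ?L ?P"
    unfolding L_eq by (rule image_sym_diff[OF inj, symmetric]) auto
  moreover have "emeasure nu ((F ^^ n) ` sym_diff ?L ?P) = emeasure nu (sym_diff ?L ?P)"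
    by (rule Fn_image(2)[OF SDs]) blast
  ultimately have "emeasure nu (sym_diff {z \<in> Y. lvl z = v} ?E) = emeasure nu (sym_diff ?L ?P)" by simp
  also have "\<dots> \<le> emeasure nu {z \<in> R. fst z \<in> ?S}"
    using sub nu_fst(1)[OF Ss] by (intro emeasure_mono) blast+
  also have "\<dots> = emeasure \<mu>h ?S" by (rule nu_fst(2)[OF Ss])
  finally have "measure nu (sym_diff {z \<in> Y. lvl z = v} ?E) \<le> measure \<mu>h ?S"
    unfolding measure_def
    by (intro enn2real_mono) (simp_all add: order_le_less_trans[OF prob_space.emeasure_le_1[OF prob_h]])
  then show ?thesis using n Eg by force
qed

lemma lvl_Y_sets: "{z \<in> Y. lvl z = v} \<in> sets nu"
proof (cases "v \<in> \<alpha>")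
  case True
  have "{z \<in> Y. lvl z = v} = {z \<in> R. fst z \<in> level D v} \<inter> Y"
    using Y_D Y_Q Q_R by (fastforce simp: level_def mem_Times_iff)
  then show ?thesis using nu_fst(1)[OF level_sets[OF True]] by (simp add: sets.Int)
next
  case False
  then have "{z \<in> Y. lvl z = v} = {}" using Y_D charged_alpha by blast
  then show ?thesis by (simp only: sets.empty_sets)
qed

text \<open>By Borel-Cantelli an approximation with summable errors converges almost everywhere.\<close>
lemma lvl_past_complete: assumes v: "v \<in> \<alpha>" shows "{z \<in> Y. lvl z = v} \<in> past_complete"
proof -
  interpret nu: prob_space nu by (rule prob_nu)
  let ?L = "{z \<in> Y. lvl z = v}"
  have "\<exists>E. E \<in> past_gen \<and> nu.prob (sym_diff ?L E) \<le> (1 / 2) ^ k" for k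
    using level_approx[OF v, of "(1 / 2) ^ k"] by auto
  then have "\<forall>k. \<exists>E. E \<in> past_gen \<and> nu.prob (sym_diff ?L E) \<le> (1 / 2) ^ k" ..
  from choice[OF this] obtain E where "\<forall>k. E k \<in> past_gen \<and> nu.prob (sym_diff ?L (E k)) \<le> (1 / 2) ^ k" ..
  then have E: "E k \<in> past_gen" "nu.prob (sym_diff ?L (E k)) \<le> (1 / 2) ^ k" for k by simp_all
  have S: "sym_diff ?L (E k) \<in> sets nu" for k using lvl_Y_sets past_gen_nu(1)[OF E(1)] by (intro sets.Un sets.Diff)
  have "summable (\<lambda>k. nu.prob (sym_diff ?L (E k)))"
    by (rule summable_comparison_test_ev[OF _ summable_geometric[of "1 / 2 :: real"]]) (use E(2) in auto)
  from borel_cantelli_AE1[OF S _ this]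
  have AE: "AE z in nu. \<forall>\<^sub>F k in sequentially. z \<in> space nu - sym_diff ?L (E k)" by (simp add: nu.emeasure_eq_measure)
  (* the points which lie in almost all of the approximations *)
  define E' where "E' = (\<Union>m. \<Inter>k. E (m + k))"
  have "E' \<in> past_complete"
  proof -
    interpret S: sigma_algebra Y past_complete by (rule sigma_past_complete)
    show ?thesis unfolding E'_def using past_gen_past_complete[OF E(1)] by (intro S.countable_UN S.countable_INT) auto
  qed
  moreover have "AE z in nu. z \<in> ?L \<longleftrightarrow> z \<in> E'" using AE
  proof eventually_elim
    case (elim z)
    then obtain m where m: "\<And>k. m \<le> k \<Longrightarrow> z \<notin> sym_diff ?L (E k)" unfolding eventually_sequentially by blast
    show ?case
    proof
      assume "z \<in> ?L"
      then have "z \<in> E (m + k)" for k using m[of "m + k"] by auto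
      then show "z \<in> E'" unfolding E'_def by blast
    next
      assume "z \<in> E'"
      then obtain m' where m': "\<And>k. z \<in> E (m' + k)" unfolding E'_def by blast
      have "z \<in> E (m' + m)" by (rule m')
      then show "z \<in> ?L" using m[of "m' + m"] by auto
    qed
  qed
  ultimately show ?thesis using past_complete_AE[OF lvl_Y_sets, of v E'] by auto
qed

lemma lvl_past_space[measurable]: "lvl \<in> measurable past_space (count_space UNIV)"
proof -
  have "{z \<in> space past_space. lvl z = v} \<in> sets past_space" for v
  proof (cases "v \<in> \<alpha>")
    case False
    then have "{z \<in> Y. lvl z = v} = {}" using Y_D charged_alpha by blast
    then show ?thesis by (simp only: space_past_space sets.empty_sets)
  qed (simp add: space_past_space sets_past_space lvl_past_complete)
  then show ?thesis
    by (subst measurable_count_space_eq2_countable) (auto simp: vimage_def Int_def conj_commute)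
qed

end

section \<open>Strips shrink\<close>

context lifted_tower begin

text \<open>The levels visited in the last \<open>n\<close> steps confine the height of a point to an interval; here is its
  lower end, obtained by unfolding the second coordinate of the rug map.\<close>
primrec strip_left :: "nat \<Rightarrow> ('a \<times> nat) \<times> real \<Rightarrow> real" where
  "strip_left 0 z = 0"
| "strip_left (Suc n) z = strip_left n (Finv z) / slope (lvl (Finv z)) + tile_start (lvl z) (lvl (Finv z))"

primrec strip_width :: "nat \<Rightarrow> ('a \<times> nat) \<times> real \<Rightarrow> real" where
  "strip_width 0 z = height (lvl z)"
| "strip_width (Suc n) z = strip_width n (Finv z) / slope (lvl (Finv z))"

lemma Finv_step:
  assumes z: "z \<in> Y"
  shows "arr (lvl (Finv z)) (lvl z)" "snd z = snd (Finv z) / slope (lvl (Finv z)) + tile_start (lvl z) (lvl (Finv z))"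
  using Y_step[OF Finv_Y[OF z]] F_Finv[OF z] by auto

lemma slope_Y: "z \<in> Y \<Longrightarrow> 0 < slope (lvl z)"
  using Y_D charged_alpha slope_pos by blast

lemma strip_bounds:
  "z \<in> Y \<Longrightarrow> strip_left n z \<le> snd z \<and> snd z \<le> strip_left n z + strip_width n z"
proof (induction n arbitrary: z)
  case 0 then show ?case using Y_D[OF 0] by simp
next
  case (Suc n)
  let ?w = "Finv z"
  have w: "?w \<in> Y" using Suc.prems by (rule Finv_Y)
  have slope: "0 < slope (lvl ?w)" using slope_Y[OF w] .
  have "strip_left n ?w \<le> snd ?w" "snd ?w \<le> strip_left n ?w + strip_width n ?w" using Suc.IH[OF w] by auto
  then have "strip_left n ?w / slope (lvl ?w) \<le> snd ?w / slope (lvl ?w)"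
    "snd ?w / slope (lvl ?w) \<le> (strip_left n ?w + strip_width n ?w) / slope (lvl ?w)"
    using slope by (auto intro: divide_right_mono)
  then show ?case using Finv_step(2)[OF Suc.prems] by (simp add: add_divide_distrib)
qed

lemma strip_width_nonneg: "z \<in> Y \<Longrightarrow> 0 \<le> strip_width n z"
  using strip_bounds[of z n] by linarith

lemma strip_width_dec: "z \<in> Y \<Longrightarrow> strip_width (Suc n) z \<le> strip_width n z"
proof (induction n arbitrary: z)
  case 0
  let ?w = "Finv z"
  have w: "?w \<in> Y" using 0 by (rule Finv_Y)
  have v: "lvl z \<in> \<alpha>" using Y_D[OF 0] charged_alpha by blast
  have "height (lvl ?w) / slope (lvl ?w) = tile_height (lvl z) (lvl ?w)" using Finv_step(1)[OF 0] Y_D[OF w] by (simp add: tile_height_def)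
  also have "\<dots> \<le> height (lvl z)" using tile_start_le[OF v, of "Suc (lvl ?w)"] tile_start_nonneg[of "lvl z" "lvl ?w"] by (simp add: tile_start_Suc)
  finally show ?case by simp
next
  case (Suc n)
  have w: "Finv z \<in> Y" using Suc.prems by (rule Finv_Y)
  have "strip_width (Suc n) (Finv z) / slope (lvl (Finv z)) \<le> strip_width n (Finv z) / slope (lvl (Finv z))"
    using Suc.IH[OF w] slope_Y[OF w] by (intro divide_right_mono) auto
  then show ?case by (simp only: strip_width.simps)
qed

definition strip_limit :: "('a \<times> nat) \<times> real \<Rightarrow> real" where "strip_limit z = lim (\<lambda>n. strip_width n z)"

lemma strip_limit: assumes z: "z \<in> Y"
  shows "(\<lambda>n. strip_width n z) \<longlonglongrightarrow> strip_limit z" "0 \<le> strip_limit z" "strip_limit z \<le> height (lvl z)"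
proof -
  have d: "decseq (\<lambda>n. strip_width n z)" using strip_width_dec[OF z] by (rule decseq_SucI)
  then obtain L where "(\<lambda>n. strip_width n z) \<longlonglongrightarrow> L"
    using strip_width_nonneg[OF z] by (auto elim: decseq_convergent[of _ 0])
  then have "convergent (\<lambda>n. strip_width n z)" by (rule convergentI)
  then show l: "(\<lambda>n. strip_width n z) \<longlonglongrightarrow> strip_limit z" unfolding strip_limit_def by (simp add: convergent_LIMSEQ_iff)
  show "0 \<le> strip_limit z" using strip_width_nonneg[OF z] by (intro LIMSEQ_le_const[OF l]) auto
  show "strip_limit z \<le> height (lvl z)" using decseq_ge[OF d l, of 0] by simp
qed

text \<open>One step of the rug map contracts the fibre by the slope, and with it the limit of the strips.\<close>
lemma strip_limit_F: assumes z: "z \<in> Y" shows "strip_limit (F z) = strip_limit z / slope (lvl z)"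
proof -
  have "(\<lambda>n. strip_width (Suc n) (F z)) \<longlonglongrightarrow> strip_limit (F z)"
    by (rule LIMSEQ_Suc[OF strip_limit(1)[OF F_Y[OF z]]])
  then have "(\<lambda>n. strip_width n z / slope (lvl z)) \<longlonglongrightarrow> strip_limit (F z)" by (simp add: Finv_F[OF z])
  moreover have "(\<lambda>n. strip_width n z / slope (lvl z)) \<longlonglongrightarrow> strip_limit z / slope (lvl z)"
    using slope_Y[OF z] by (intro tendsto_divide strip_limit(1)[OF z] tendsto_const) auto
  ultimately show ?thesis by (rule LIMSEQ_unique)
qed

lemma level_fun_past_space: "(\<lambda>z. f (lvl z) (lvl (Finv z)) :: real) \<in> borel_measurable past_space"
proof -
  have "(\<lambda>z. (lvl z, lvl (Finv z))) \<in> measurable past_space (count_space UNIV \<Otimes>\<^sub>M count_space UNIV)"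
    by (intro measurable_Pair lvl_past_space measurable_compose[OF Finv_past_space lvl_past_space])
  then have "(\<lambda>z. case (lvl z, lvl (Finv z)) of (a, b) \<Rightarrow> f a b) \<in> borel_measurable past_space"
    by (rule measurable_compose) (simp add: pair_measure_countable)
  then show ?thesis by simp
qed

lemma strip_left_past_space: "strip_left n \<in> borel_measurable past_space"
proof (induction n)
  case (Suc n)
  have "(\<lambda>z. strip_left n (Finv z) / slope (lvl (Finv z)) + tile_start (lvl z) (lvl (Finv z))) \<in> borel_measurable past_space"
    by (intro borel_measurable_add borel_measurable_divide measurable_compose[OF Finv_past_space Suc] level_fun_past_space)
  then show ?case by (simp add: strip_left.simps(2)[abs_def] fun_eq_iff cong: measurable_cong)
qed simp

lemma strip_width_past_space: "strip_width n \<in> borel_measurable past_space"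
proof (induction n)
  case 0
  have "(\<lambda>z. height (lvl z)) \<in> borel_measurable past_space" by (rule level_fun_past_space)
  then show ?case by (simp cong: measurable_cong)
next
  case (Suc n)
  have "(\<lambda>z. strip_width n (Finv z) / slope (lvl (Finv z))) \<in> borel_measurable past_space"
    by (intro borel_measurable_divide measurable_compose[OF Finv_past_space Suc] level_fun_past_space)
  then show ?case by (simp cong: measurable_cong)
qed

lemma strip_limit_past_space: "strip_limit \<in> borel_measurable past_space"
  unfolding strip_limit_def[abs_def] using strip_width_past_space by (rule borel_measurable_lim_metric)

definition nuY where "nuY = restrict_space nu Y"

lemma space_nuY: "space nuY = Y"
  using sets.sets_into_space[OF Y_sets] by (auto simp: nuY_def space_restrict_space)

lemma sets_nuY: "C \<in> sets nuY \<longleftrightarrow> C \<in> sets nu \<and> C \<subseteq> Y"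
  unfolding nuY_def using sets.sets_into_space[OF Y_sets]
  by (subst sets_restrict_space_iff) (auto simp: Int_absorb2)

lemma emeasure_nuY: "C \<in> sets nuY \<Longrightarrow> emeasure nuY C = emeasure nu C"
  unfolding nuY_def using sets.sets_into_space[OF Y_sets]
  by (intro emeasure_restrict_space) (auto simp: sets_nuY[unfolded nuY_def] Int_absorb2)

lemma prob_nuY: "prob_space nuY"
proof
  have "Y \<in> sets nuY" by (simp add: sets_nuY)
  then show "emeasure nuY (space nuY) = 1" using nu_Y by (simp add: space_nuY emeasure_nuY)
qed

lemma past_space_nuY: "f \<in> measurable past_space M \<Longrightarrow> f \<in> measurable nuY M"
  by (rule measurable_mono[of M M past_space nuY, THEN subsetD, rotated 4])
    (auto simp: space_past_space space_nuY sets_past_space sets_nuY past_complete_def)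

lemma F_nuY: "F \<in> measurable nuY nuY"
proof (rule measurableI)
  fix z assume "z \<in> space nuY" then show "F z \<in> space nuY" using F_Y by (simp add: space_nuY)
next
  fix C assume "C \<in> sets nuY"
  then show "F -` C \<inter> space nuY \<in> sets nuY" using F_preimage_Y(1) by (auto simp: space_nuY sets_nuY)
qed

lemma F_preserves_nuY: "C \<in> sets nuY \<Longrightarrow> emeasure nuY (F -` C \<inter> Y) = emeasure nuY C"
  using F_preimage_Y by (auto simp: sets_nuY emeasure_nuY)

lemma distr_F: "distr nuY nuY F = nuY"
proof (rule measure_eqI)
  fix C assume "C \<in> sets (distr nuY nuY F)"
  then have C: "C \<in> sets nuY" by simp
  show "emeasure (distr nuY nuY F) C = emeasure nuY C"
    using C F_nuY F_preserves_nuY[OF C] by (simp add: emeasure_distr space_nuY)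
qed simp

text \<open>The measure of the limit of the strips containing a point.\<close>
definition strip_mass :: "('a \<times> nat) \<times> real \<Rightarrow> real" where
  "strip_mass z = strip_limit z * prob (D (lvl z))"

lemma strip_mass_past_space: "strip_mass \<in> borel_measurable past_space"
  unfolding strip_mass_def[abs_def]
  by (intro borel_measurable_times strip_limit_past_space level_fun_past_space[of "\<lambda>u _. prob (D u)"])

lemma arr_prob_le:
  assumes u: "u \<in> \<alpha>" and v: "v \<in> \<alpha>" and a: "arr u v"
  shows "prob (D v) \<le> slope u * prob (D u)"
proof -
  have "AE x in \<mu>. x \<in> D v \<longrightarrow> x \<in> T ` D u" using AE_arr[OF u v a] by eventually_elim simp
  then have "prob (D v) \<le> prob (T ` D u)" using u by (intro finite_measure_mono_AE TD_sets)
  also have "\<dots> = slope u * prob (D u)"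
    using TD_emeasure[OF u] slope_pos[OF u] by (simp add: emeasure_eq_measure ennreal_mult[symmetric])
  finally show ?thesis .
qed

text \<open>The base of the strip expands by at most the slope, and it is cut if the level has several successors.\<close>
lemma strip_mass_F_le: assumes z: "z \<in> Y" shows "strip_mass (F z) \<le> strip_mass z"
proof -
  have u: "lvl z \<in> \<alpha>" "lvl (F z) \<in> \<alpha>" using Y_D[OF z] Y_D[OF F_Y[OF z]] charged_alpha by auto
  have "strip_mass (F z) = strip_limit z / slope (lvl z) * prob (D (lvl (F z)))" by (simp add: strip_mass_def strip_limit_F[OF z])
  also have "\<dots> \<le> strip_limit z / slope (lvl z) * (slope (lvl z) * prob (D (lvl z)))"
    using strip_limit(2)[OF z] slope_Y[OF z] by (intro mult_left_mono arr_prob_le u Y_step z) auto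
  also have "\<dots> = strip_mass z" using slope_Y[OF z] by (simp add: strip_mass_def)
  finally show ?thesis .
qed

lemma strip_mass_bound: assumes z: "z \<in> Y" shows "0 \<le> strip_mass z" "strip_mass z \<le> 1"
proof -
  have u: "lvl z \<in> \<alpha>" using Y_D[OF z] charged_alpha by auto
  show "0 \<le> strip_mass z" using strip_limit(2)[OF z] by (simp add: strip_mass_def)
  have "strip_mass z \<le> height (lvl z) * prob (D (lvl z))"
    using strip_limit(3)[OF z] by (simp add: strip_mass_def mult_right_mono)
  also have "\<dots> = measure \<mu>h (level D (lvl z))"
    using rho_level[OF lifts u] u by (simp add: height_def)
  also have "\<dots> \<le> 1" by (rule prob_space.prob_le_1[OF prob_h])
  finally show "strip_mass z \<le> 1" .
qed

text \<open>A bounded function that does not increase along a measure preserving map is invariant.\<close>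
lemma AE_strip_mass_F: "AE z in nuY. strip_mass (F z) = strip_mass z"
proof -
  interpret nuY: prob_space nuY by (rule prob_nuY)
  have m: "strip_mass \<in> borel_measurable nuY" by (rule past_space_nuY[OF strip_mass_past_space])
  have mF: "(\<lambda>z. strip_mass (F z)) \<in> borel_measurable nuY" by (rule measurable_compose[OF F_nuY m])
  have i: "integrable nuY strip_mass"
    by (rule nuY.integrable_const_bound[where B=1]) (use strip_mass_bound m in \<open>auto simp: space_nuY intro!: AE_I2\<close>)
  have iF: "integrable nuY (\<lambda>z. strip_mass (F z))"
  proof (rule nuY.integrable_const_bound[where B=1])
    show "AE z in nuY. norm (strip_mass (F z)) \<le> 1"
      using strip_mass_bound[OF F_Y] by (intro AE_I2) (simp add: space_nuY)
  qed (rule mF)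
  have "(\<integral>z. strip_mass (F z) \<partial>nuY) = (\<integral>z. strip_mass z \<partial>distr nuY nuY F)"
    by (rule integral_distr[OF F_nuY m, symmetric])
  then have "(\<integral>z. strip_mass z - strip_mass (F z) \<partial>nuY) = 0" using i iF by (simp add: distr_F)
  moreover have "AE z in nuY. 0 \<le> strip_mass z - strip_mass (F z)"
    using strip_mass_F_le by (intro AE_I2) (simp add: space_nuY)
  ultimately have "AE z in nuY. strip_mass z - strip_mass (F z) = 0"
    using integral_nonneg_eq_0_iff_AE[of nuY "\<lambda>z. strip_mass z - strip_mass (F z)"] i iF by simp
  then show ?thesis by eventually_elim simp
qed

text \<open>The points on level \<open>u\<close> whose strips do not shrink.\<close>
definition wide :: "nat \<Rightarrow> (('a \<times> nat) \<times> real) set" where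
  "wide u = {z \<in> Y. 0 < strip_limit z \<and> lvl z = u}"

lemma wide_sets: "wide u \<in> sets nuY"
proof -
  note [measurable] = past_space_nuY[OF strip_limit_past_space] past_space_nuY[OF lvl_past_space]
  have "{z \<in> space nuY. 0 < strip_limit z \<and> lvl z = u} \<in> sets nuY" by measurable
  then show ?thesis by (simp add: wide_def space_nuY)
qed

text \<open>By invariance of the strip mass, the branch maps the whole of level \<open>u\<close> onto the next level, and the next level is wide as well.\<close>
lemma wide_step:
  assumes W: "wide u \<notin> null_sets nuY"
  shows "\<exists>v. wide v \<notin> null_sets nuY \<and> u \<in> \<alpha> \<and> v \<in> \<alpha> \<and> arr u v \<and> prob (D v) = slope u * prob (D u)"
proof -
  let ?S = "\<lambda>v. wide u \<inter> (F -` {z \<in> Y. lvl z = v} \<inter> Y)"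
  have slice: "{z \<in> Y. lvl z = v} \<in> sets nuY" for v using lvl_Y_sets by (auto simp: sets_nuY)
  have S: "?S v \<in> sets nuY" for v
    using wide_sets measurable_sets[OF F_nuY slice[of v]] unfolding space_nuY by (rule sets.Int)
  have "wide u = (\<Union>v. ?S v)" using F_Y by (auto simp: wide_def)
  then have "\<exists>v. ?S v \<notin> null_sets nuY" using W null_sets_UN[of ?S nuY] by auto
  then obtain v where v: "?S v \<notin> null_sets nuY" ..
  (* a set which is not null contains a point at which the strip mass is invariant *)
  obtain z where z: "z \<in> ?S v" "strip_mass (F z) = strip_mass z"
  proof (rule ccontr)
    assume neg: "\<not> thesis"
    have "AE z in nuY. z \<notin> ?S v" using AE_strip_mass_F by eventually_elim (use neg that in blast)
    then show False using v S by (simp add: AE_iff_null_sets)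
  qed
  have zY: "z \<in> Y" and l: "0 < strip_limit z" "lvl z = u" "lvl (F z) = v" using z(1) by (auto simp: wide_def)
  have u: "u \<in> \<alpha>" "v \<in> \<alpha>" using Y_D[OF zY] Y_D[OF F_Y[OF zY]] l charged_alpha by auto
  have a: "arr u v" using Y_step(1)[OF zY] l by simp
  have "strip_limit z / slope u * prob (D v) = strip_limit z * prob (D u)"
    using z(2) l by (simp add: strip_mass_def strip_limit_F[OF zY])
  then have p: "prob (D v) = slope u * prob (D u)" using l(1) slope_pos[OF u(1)] by (simp add: field_simps)
  have "?S v \<subseteq> F -` wide v \<inter> Y"
    using F_Y strip_limit_F slope_Y by (auto simp: wide_def)
  have "wide v \<notin> null_sets nuY"
  proof
    assume "wide v \<in> null_sets nuY"
    then have "emeasure nuY (F -` wide v \<inter> Y) = 0" using F_preserves_nuY[OF wide_sets] by (simp add: null_sets_def)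
    then have "F -` wide v \<inter> Y \<in> null_sets nuY"
      using measurable_sets[OF F_nuY wide_sets[of v]] by (simp add: null_sets_def space_nuY)
    then have "?S v \<in> null_sets nuY" using S \<open>?S v \<subseteq> _\<close> by (rule null_sets_subset)
    then show False using v by simp
  qed
  then show ?thesis using u a p by blast
qed

text \<open>Following the steps from a wide level gives a sequence of levels that are mapped onto each other
  without being cut. Almost all points of the first level then share their itinerary.\<close>
lemma wide_null: "wide u \<in> null_sets nuY"
proof (rule ccontr)
  assume W: "wide u \<notin> null_sets nuY"
  have "\<exists>f. \<forall>n. wide (f n) \<notin> null_sets nuY \<and>
     (f n \<in> \<alpha> \<and> f (Suc n) \<in> \<alpha> \<and> arr (f n) (f (Suc n)) \<and> prob (D (f (Suc n))) = slope (f n) * prob (D (f n)))"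
    by (rule dependent_nat_choice) (use W wide_step in blast)+
  then obtain f where f: "\<And>n. f n \<in> \<alpha>" "\<And>n. arr (f n) (f (Suc n))" "\<And>n. prob (D (f (Suc n))) = slope (f n) * prob (D (f n))"
    by blast
  have "AE y in \<mu>. y \<in> T ` D (f n) \<longrightarrow> y \<in> D (f (Suc n))" for n
  proof -
    have pT: "prob (T ` D (f n)) = prob (D (f (Suc n)))"
      using TD_emeasure[OF f(1), of n] slope_pos[OF f(1), of n] f(3)[of n] by (simp add: emeasure_eq_measure ennreal_mult[symmetric])
    have s: "T ` D (f n) \<in> sets \<mu>" "D (f (Suc n)) \<in> sets \<mu>" using f(1) by auto
    have "prob (T ` D (f n) \<inter> D (f (Suc n))) = prob (D (f (Suc n)))"
      by (rule finite_measure_eq_AE) (use AE_arr[OF f(1) f(1) f(2), of n] s in \<open>auto elim: eventually_mono\<close>)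
    then have "prob (T ` D (f n) - D (f (Suc n))) = 0" using finite_measure_Diff'[OF s] pT by simp
    then have "T ` D (f n) - D (f (Suc n)) \<in> null_sets \<mu>" using s by (auto simp: emeasure_eq_measure intro!: null_setsI)
    from AE_not_in[OF this] show ?thesis by eventually_elim blast
  qed
  then have "AE y in \<mu>. \<forall>n. y \<in> T ` D (f n) \<longrightarrow> y \<in> D (f (Suc n))" by (simp add: AE_all_countable)
  from AE_orbit[OF AE_T[OF this]] AE_orbit[OF AE_regular_pt]
  have "AE x in \<mu>. x \<in> D (f 0) \<longrightarrow> (\<forall>n. itinerary x n = map (\<lambda>i. branch_of (f i)) [0..<n])"
  proof eventually_elim
    case (elim x)
    show ?case
    proof (intro impI allI)
      fix n assume x: "x \<in> D (f 0)"
      have "(T ^^ i) x \<in> D (f i)" for i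
      proof (induction i)
        case (Suc i)
        then have "T ((T ^^ i) x) \<in> T ` D (f i)" by (rule imageI)
        then show ?case using elim(1) by simp
      qed (use x in simp)
      then have "bi ((T ^^ i) x) = branch_of (f i)" for i
        using elim(2) regular_in_Z[of "(T ^^ i) x" "branch_of (f i)"] branch_of[OF f(1), of i] by blast
      then show "itinerary x n = map (\<lambda>i. branch_of (f i)) [0..<n]" by (simp add: itinerary_def)
    qed
  qed
  note zo = constant_itinerary_zero_one[OF D_sets[OF f(1)] this]
  have "compact (D (f 0))" using D_closed[OF f(1), of 0] compact_X by (meson bounded_subset compact_eq_bounded_closed)
  moreover have "prob {x} = 0" if "x \<in> D (f 0)" for x
  proof -
    have "x \<in> X" using D_closed(2)[OF f(1)] that by blast
    then show ?thesis by (simp add: measure_def nonatomic)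
  qed
  ultimately show False
    using zero_one_contradiction[OF _ D_closed(2)[OF f(1)] prob_D_pos[OF lifts f(1)] zo] by blast
qed

lemma AE_strip_limit: "AE z in nuY. strip_limit z = 0"
proof -
  have "AE z in nuY. \<forall>u. z \<notin> wide u" unfolding AE_all_countable using AE_not_in[OF wide_null] by blast
  with AE_space show ?thesis
  proof eventually_elim
    case (elim z)
    then have "z \<in> Y" by (simp add: space_nuY)
    then show ?case using elim(2) strip_limit(2)[of z] unfolding wide_def by force
  qed
qed

lemma AE_nuY_nu: assumes "AE z in nuY. P z" shows "AE z in nu. z \<in> Y \<longrightarrow> P z"
  using assms unfolding nuY_def by (subst (asm) AE_restrict_space_iff) (use sets.sets_into_space[OF Y_sets] in \<open>auto simp: Int_absorb2\<close>)

section \<open>The natural extension\<close>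

text \<open>The strips shrink to the point, so the height is the limit of the lower ends, which are functions of the past levels.\<close>
lemma snd_past_complete: assumes B: "B \<in> sets borel" shows "{z \<in> Y. snd z \<in> B} \<in> past_complete"
proof -
  define g where "g z = lim (\<lambda>n. strip_left n z)" for z
  have gm: "g \<in> borel_measurable past_space" unfolding g_def[abs_def] using strip_left_past_space by (rule borel_measurable_lim_metric)
  have g: "g z = snd z" if "z \<in> Y" "strip_limit z = 0" for z
  proof -
    have w0: "(\<lambda>n. strip_width n z) \<longlonglongrightarrow> 0" using strip_limit(1)[OF that(1)] that(2) by simp
    have "(\<lambda>n. snd z - strip_width n z) \<longlonglongrightarrow> snd z - 0" by (intro tendsto_diff tendsto_const w0)
    then have lower: "(\<lambda>n. snd z - strip_width n z) \<longlonglongrightarrow> snd z" by simp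
    have "(\<lambda>n. strip_left n z) \<longlonglongrightarrow> snd z"
    proof (rule tendsto_sandwich[OF _ _ lower tendsto_const])
      show "\<forall>\<^sub>F n in sequentially. snd z - strip_width n z \<le> strip_left n z"
        using strip_bounds[OF that(1)] by (intro always_eventually allI) (simp add: diff_le_eq)
      show "\<forall>\<^sub>F n in sequentially. strip_left n z \<le> snd z"
        using strip_bounds[OF that(1)] by (intro always_eventually allI) simp
    qed
    then show ?thesis by (simp add: g_def limI)
  qed
  have "g -` B \<inter> space past_space \<in> sets past_space" using gm B by (rule measurable_sets)
  then have 1: "g -` B \<inter> Y \<in> past_complete" by (simp add: space_past_space sets_past_space)
  have "(\<lambda>z. snd z) \<in> measurable tl lborel" by measurable
  from measurable_sets[OF this, of B] B have "{z \<in> space tl. snd z \<in> B} \<in> sets tl" by (simp add: vimage_def Int_def conj_commute)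
  then have "{z \<in> space tl. snd z \<in> B} \<inter> Y \<in> sets tl" using nu_tl[OF Y_sets] by (rule sets.Int)
  moreover have "{z \<in> space tl. snd z \<in> B} \<inter> Y = {z \<in> Y. snd z \<in> B}" using Y_R by (auto simp: space_tl mem_Times_iff)
  ultimately have 2: "{z \<in> Y. snd z \<in> B} \<in> sets nu" using Y_R by (auto simp: sets_nu)
  show ?thesis
  proof (rule past_complete_AE[OF 2 _ 1])
    show "AE z in nu. (z \<in> {z \<in> Y. snd z \<in> B}) = (z \<in> g -` B \<inter> Y)"
      using AE_nuY_nu[OF AE_strip_limit] by eventually_elim (use g in auto)
  qed auto
qed

lemma fst_past_space: "fst \<in> measurable past_space tm"
proof (rule measurableI)
  fix z assume "z \<in> space past_space" then show "fst z \<in> space tm" using Y_R by (simp add: space_past_space space_tm)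
next
  fix A assume A: "A \<in> sets tm"
  have eq: "fst -` A \<inter> space past_space = (\<Union>u. (phi -` slice A u \<inter> space past_space) \<inter> (lvl -` {u} \<inter> space past_space))" by auto
  show "fst -` A \<inter> space past_space \<in> sets past_space" unfolding eq
    using A by (intro sets.countable_UN image_subsetI sets.Int measurable_sets[OF phi_past_space] measurable_sets[OF lvl_past_space]) auto
qed

lemma snd_past_space: "snd \<in> measurable past_space lborel"
proof (rule measurableI)
  fix B :: "real set" assume "B \<in> sets lborel"
  then have "{z \<in> Y. snd z \<in> B} \<in> past_complete" by (intro snd_past_complete) simp
  moreover have "snd -` B \<inter> space past_space = {z \<in> Y. snd z \<in> B}" by (auto simp: space_past_space)
  ultimately show "snd -` B \<inter> space past_space \<in> sets past_space" by (simp add: sets_past_space)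
qed simp

lemma generating: assumes C: "C \<in> sets nu" shows "\<exists>E\<in>past_gen. ae_eq_set nu C E"
proof -
  have "(\<lambda>z. (fst z, snd z)) \<in> measurable past_space tl" by (rule measurable_Pair[OF fst_past_space snd_past_space])
  from measurable_sets[OF this nu_tl[OF C]] have "C \<inter> Y \<in> past_complete" by (simp add: space_past_space sets_past_space)
  then obtain E where E: "E \<in> past_gen" "AE z in nu. z \<in> C \<inter> Y \<longleftrightarrow> z \<in> E" unfolding past_complete_iff by blast
  have "AE z in nu. z \<in> C \<longleftrightarrow> z \<in> E" using E(2) AE_not_in[OF nu_full[OF Y_sets nu_Y]] AE_space by eventually_elim auto
  then show ?thesis using E(1) ae_eq_nu_iff[OF C past_gen_nu(1)[OF E(1)]] by blast
qed

lemma phi_image_sets: assumes C: "C \<in> sets nu" shows "phi ` C \<in> sets \<mu>"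
proof -
  have "fst ` rug_slice C u \<in> sets \<mu>" for u
  proof (rule measurable_projection_lebesgue[OF _ sets_mu X_leb])
    show "bounded X" using compact_X by (rule compact_imp_bounded)
    have "sets ml = sets (\<mu> \<Otimes>\<^sub>M borel)" by (rule sets_pair_measure_cong) simp_all
    then show "rug_slice C u \<in> sets (\<mu> \<Otimes>\<^sub>M borel)" using rug_slice_sets[OF nu_tl[OF C], of u] by simp
  qed
  then have "(\<Union>u. fst ` rug_slice C u) \<in> sets \<mu>" by blast
  moreover have "phi ` C = (\<Union>u. fst ` rug_slice C u)"
  proof
    show "phi ` C \<subseteq> (\<Union>u. fst ` rug_slice C u)"
    proof (rule image_subsetI)
      fix z assume "z \<in> C"
      then have "(phi z, snd z) \<in> rug_slice C (lvl z)" by simp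
      then have "fst (phi z, snd z) \<in> fst ` rug_slice C (lvl z)" by (rule imageI)
      then show "phi z \<in> (\<Union>u. fst ` rug_slice C u)" unfolding fst_conv by (rule UN_I[OF UNIV_I])
    qed
    show "(\<Union>u. fst ` rug_slice C u) \<subseteq> phi ` C"
    proof (rule UN_least, rule image_subsetI)
      fix u p assume "p \<in> rug_slice C u"
      then have "((fst p, u), snd p) \<in> C" by simp
      from imageI[OF this, of phi] show "fst p \<in> phi ` C" by simp
    qed
  qed
  ultimately show ?thesis by simp
qed

lemma eta_phi: assumes A: "A \<in> sets \<mu>" shows "emeasure eta A = emeasure nu (phi -` A \<inter> Y)"
proof -
  let ?C = "{z \<in> R. fst z \<in> fst -` A \<inter> tw}"
  have "emeasure eta A = emeasure nu ?C"
    using emeasure_eta[OF A] nu_fst(2)[OF fst_vimage_sets[OF A]] by simp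
  also have "\<dots> = emeasure nu (phi -` A \<inter> Y)"
  proof (rule emeasure_eq_AE)
    show "AE z in nu. (z \<in> ?C) = (z \<in> phi -` A \<inter> Y)"
      using AE_not_in[OF nu_full[OF Y_sets nu_Y]] AE_space
    proof eventually_elim
      case (elim z)
      then have "z \<in> Y" by blast
      then show ?case using Y_R by auto
    qed
  qed (use nu_fst(1)[OF fst_vimage_sets[OF A]] phi_Y_sets[OF A] in auto)
  finally show ?thesis .
qed

text \<open>Both full sets come from the bijective part \<open>Y\<close> of the rugs: its projection is measurable by the
  projection theorem and forward invariant because \<open>\<phi>\<close> intertwines the maps.\<close>
theorem rug_natural_extension: "natural_extension nu F eta T (fst \<circ> fst)"
  unfolding natural_extension_def
proof (intro conjI exI[of _ "phi ` Y"] exI[of _ Y])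
  have sp: "space eta = X" by (simp add: space_mu)
  show "T \<in> space eta \<rightarrow> space eta" unfolding sp by (rule T_into)
  show "invariant_measure eta T" by (rule eta_invariant)
  have pY: "phi ` Y \<in> sets \<mu>" using Y_sets by (rule phi_image_sets)
  show "full_set eta (phi ` Y)"
    unfolding full_set_def sp
  proof
    show "phi ` Y \<in> sets eta" using pY by simp
    have c: "X - phi ` Y \<in> sets \<mu>" using pY by (intro sets.Diff X_sets)
    have "phi -` (X - phi ` Y) \<inter> Y = {}" by blast
    then have "emeasure eta (X - phi ` Y) = 0" using eta_phi[OF c] by (simp only: emeasure_empty)
    then show "X - phi ` Y \<in> null_sets eta" using c by (intro null_setsI) auto
  qed
  show "full_set nu Y" by (rule full_Y)
  show "T ` (phi ` Y) \<subseteq> phi ` Y"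
  proof (rule image_subsetI)
    fix x assume "x \<in> phi ` Y"
    then obtain z where z: "z \<in> Y" "x = phi z" by blast
    then have "T x = phi (F z)" using Y_step(3)[OF z(1)] by simp
    then show "T x \<in> phi ` Y" using F_Y[OF z(1)] by blast
  qed
  show "F ` Y \<subseteq> Y" using FY by simp
  show "\<forall>C\<in>sets nu. F -` C \<inter> Y \<in> sets nu \<and> emeasure nu (F -` C \<inter> Y) = emeasure nu C"
    using F_preimage_Y by blast
  show "ae_invertible nu F" by (rule ae_invertible_F)
  show "phi ` Y = phi ` Y" ..
  show "\<forall>A\<in>sets eta. phi -` A \<inter> Y \<in> sets nu" using phi_Y_sets by simp
  show "\<forall>C\<in>sets nu. phi ` (C \<inter> Y) \<in> sets eta"
  proof
    fix C assume "C \<in> sets nu"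
    then have "C \<inter> Y \<in> sets nu" using Y_sets by (rule sets.Int)
    from phi_image_sets[OF this] show "phi ` (C \<inter> Y) \<in> sets eta" by simp
  qed
  show "\<forall>A\<in>sets eta. emeasure eta A = emeasure nu (phi -` A \<inter> Y)" using eta_phi by simp
  show "\<forall>z\<in>Y. phi (F z) = T (phi z)" using Y_step(3) by blast
  have "{(F ^^ n) ` (phi -` A \<inter> Y) |n A. A \<in> sets eta} = {(F ^^ n) ` (phi -` A \<inter> Y) |n A. A \<in> sets \<mu>}" by simp
  then show "let \<G> = sigma_sets Y {(F ^^ n) ` (phi -` A \<inter> Y) |n A. A \<in> sets eta} in
    \<G> \<subseteq> sets nu \<and> (\<forall>C\<in>sets nu. \<exists>E\<in>\<G>. ae_eq_set nu C E)"
    unfolding Let_def by (simp only: past_gen_def[symmetric]) (blast intro: past_gen_nu(1) generating)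
qed

end

theorem theorem2:
  fixes X :: "'a::euclidean_space set"
    and \<mu> :: "'a measure"
    and N :: nat
    and Z :: "nat \<Rightarrow> 'a set"
    and T :: "'a \<Rightarrow> 'a"
    and s :: "nat \<Rightarrow> real"
    and \<alpha> :: "nat set"
    and D :: "nat \<Rightarrow> 'a set"
    and \<mu>h :: "('a \<times> nat) measure"
  assumes system: "piecewise_system X \<mu> N Z T s"
    and nonatomic: "\<And>x. x \<in> X \<Longrightarrow> emeasure \<mu> {x} = 0"
    and enumeration: "tower_enumeration \<mu> N Z T \<alpha> D"
    and lifts: "lifts_to \<mu> N Z T \<alpha> D \<mu>h"
    and prob: "prob_space \<mu>h"
  shows "natural_extension (rug_measure \<mu> \<alpha> D \<mu>h) (rug_map \<mu> N Z T s \<alpha> D \<mu>h)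
           (distr \<mu>h \<mu> fst) T (fst \<circ> fst) \<and>
         (invariant_measure \<mu> T \<longrightarrow>
            distr \<mu>h \<mu> fst = \<mu> \<and>
            (\<forall>M. lifts_to \<mu> N Z T \<alpha> D M \<longleftrightarrow> M = \<mu>h) \<and>
            (\<forall>M. invariant_lift \<mu> N Z T \<alpha> D M \<longleftrightarrow> M = \<mu>h))"
proof -
  have "lifted_tower X \<mu> N Z T s \<alpha> D \<mu>h"
    using assms by (intro lifted_tower.intro hofbauer_tower.intro hofbauer_tower_axioms.intro lifted_tower_axioms.intro)
  then interpret lifted_tower X \<mu> N Z T s \<alpha> D \<mu>h .
  have "lifts_to \<mu> N Z T \<alpha> D M \<longleftrightarrow> M = \<mu>h" for M
    using lift_unique[OF _ lifts, of M] lifts by blast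
  then show ?thesis using rug_natural_extension eta_eq_mu invariant_lift_iff by blast
qed

end
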